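(* Let $m\ge2$ be even and $0\le i\le m-2$. Let $K^i_{+,m}(\underline{x},\underline{y})=\tilde f_m^i(s,t)+\hat f_m^i(s,t)+(\underline{x}\wedge\underline{y})g_m^i(s,t)$ and $\mathcal{F}^i_{+,m}[f](\underline{y})=(2\pi)^{-m/2}\int_{\mathbb{R}^m}K^i_{+,m}(\underline{x},\underline{y})f(\underline{x})\,dV(\underline{x})$. Then for all $p,k\in\mathbb{N}$ and admissible $\ell$: If $i$ is even: for $k$ even, $\mathcal{F}^i_{+,m}[\psi_{2p,k,\ell}]=(-1)^{m/2}\frac{(k+i-1)!!}{(k-i+m-3)!!}(-1)^p\psi_{2p,k,\ell}$ and $\mathcal{F}^i_{+,m}[\psi_{2p+1,k,\ell}]=\frac{(k+i-1)!!}{(k+m-i-3)!!}(-1)^p\psi_{2p+1,k,\ell}$; for $k$ odd, $\mathcal{F}^i_{+,m}[\psi_{2p,k,\ell}]=\frac{(k+i)!!}{(k+m-i-2)!!}(-1)^{p+1}\psi_{2p,k,\ell}$ and $\mathcal{F}^i_{+,m}[\psi_{2p+1,k,\ell}]=(-1)^{m/2}\frac{(k+i)!!}{(k-i+m-2)!!}(-1)^p\psi_{2p+1,k,\ell}$. If $i$ is odd: for $k$ even, $\mathcal{F}^i_{+,m}[\psi_{2p,k,\ell}]=\frac{(k+i)!!}{(k+m-i-2)!!}(-1)^{p+1}\psi_{2p,k,\ell}$ and $\mathcal{F}^i_{+,m}[\psi_{2p+1,k,\ell}]=(-1)^{m/2}\frac{(k+i)!!}{(k+m-i-2)!!}(-1)^{p+1}\psi_{2p+1,k,\ell}$;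 for $k$ odd, $\mathcal{F}^i_{+,m}[\psi_{2p,k,\ell}]=(-1)^{m/2}\frac{(k+i-1)!!}{(k+m-i-3)!!}(-1)^{p+1}\psi_{2p,k,\ell}$ and $\mathcal{F}^i_{+,m}[\psi_{2p+1,k,\ell}]=\frac{(k+i-1)!!}{(k+m-i-3)!!}(-1)^p\psi_{2p+1,k,\ell}$.
   Context: $\mathcal{C}l_{0,m}$ is the real Clifford algebra generated by $e_1,\dots,e_m$ with $e_ie_j+e_je_i=-2\delta_{ij}$; $\underline{x}=\sum_jx_je_j$, $\underline{x}\wedge\underline{y}=\sum_{j<k}e_je_k(x_jy_k-x_ky_j)$, $\partial_{\underline{x}}=\sum_je_j\partial_{x_j}$, $s=\langle\underline{x},\underline{y}\rangle$, $t=|\underline{x}\wedge\underline{y}|=\sqrt{|\underline{x}|^2|\underline{y}|^2-s^2}$, $\widetilde J_\alpha(t)=t^{-\alpha}J_\alpha(t)$ ($J_\alpha$ Bessel function). $\tilde f_m^i(s,t)=-\sqrt{\pi/2}\sum_{\ell=0}^{\lfloor (i-1)/2\rfloor}s^{i-1-2\ell}\frac{1}{2^\ell\ell!}\frac{\Gamma(i+1)}{\Gamma(i-2\ell)}\widetilde J_{(m-2\ell-3)/2}(t)$ for $i\ge1$, $\tilde f_m^0:=0$; $\hat f_m^i(s,t)=(-1)^{m/2+i}\sqrt{\pi/2}\sum_{\ell=0}^{\lfloor i/2\rfloor}s^{i-2\ell}\frac{1}{2^\ell\ell!}\frac{\Gamma(i+1)}{\Gamma(i+1-2\ell)}\widetilde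 J_{(m-2\ell-3)/2}(t)$; $g_m^i(s,t)=\sqrt{\pi/2}\sum_{\ell=0}^{\lfloor i/2\rfloor}s^{i-2\ell}\frac{1}{2^\ell\ell!}\frac{\Gamma(i+1)}{\Gamma(i+1-2\ell)}\widetilde J_{(m-2\ell-1)/2}(t)$. $\mathcal{M}_k$ is the space of spherical monogenics of degree $k$ (homogeneous $\mathcal{C}l_{0,m}$-valued polynomials $M$ of degree $k$ with $\partial_{\underline{x}}M=0$) with basis $M_k^{(\ell)}$; $\psi_{2p,k,\ell}(\underline{x})=L_p^{m/2+k-1}(|\underline{x}|^2)M_k^{(\ell)}(\underline{x})e^{-|\underline{x}|^2/2}$, $\psi_{2p+1,k,\ell}(\underline{x})=L_p^{m/2+k}(|\underline{x}|^2)\,\underline{x}\,M_k^{(\ell)}(\underline{x})e^{-|\underline{x}|^2/2}$, $L_p^\alpha$ generalized Laguerre polynomials. Double factorials: $u!!=u(u-2)\cdots$ down to $1$ or $2$, $0!!=(-1)!!=1$. *)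

theory Defs
  imports "HOL-Analysis.Analysis"
begin

text \<open>Elements of Cl(0,m) are represented by their coordinates with respect to the
basis blades e_A, A a subset of {0..<m} (the generator e_(j+1) of the paper is blade {j});
e_A is the ordered product of the e_j, j in A, in increasing order.
Coordinates of blades not contained in {0..<m} are zero for all elements produced below.\<close>

type_synonym cl = "nat set \<Rightarrow> real"

definition cl_sign :: "nat set \<Rightarrow> nat set \<Rightarrow> real" where
  "cl_sign A B = (-1) ^ (card {(a, b). a \<in> A \<and> b \<in> B \<and> b < a} + card (A \<inter> B))"

text \<open>e_A e_B = cl_sign A B e_(A symmetric-difference B), which encodes e_i e_j + e_j e_i = -2 delta_ij.\<close>

definition cl_mult :: "nat \<Rightarrow> cl \<Rightarrow> cl \<Rightarrow> cl" where
  "cl_mult m u v = (\<lambda>C. \<Sum>A\<in>Pow {..<m}. \<Sum>B\<in>Pow {..<m}.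
      if (A - B) \<union> (B - A) = C then cl_sign A B * u A * v B else 0)"

definition cl_add :: "cl \<Rightarrow> cl \<Rightarrow> cl" where
  "cl_add u v = (\<lambda>A. u A + v A)"

definition cl_scale :: "real \<Rightarrow> cl \<Rightarrow> cl" where
  "cl_scale r u = (\<lambda>A. r * u A)"

definition cl_scalar :: "real \<Rightarrow> cl" where
  "cl_scalar r = (\<lambda>A. if A = {} then r else 0)"

definition cl_e :: "nat \<Rightarrow> cl" where
  "cl_e j = (\<lambda>A. if A = {j} then 1 else 0)"

text \<open>Vectors of R^m are functions nat => real, only the coordinates 0..<m matter.\<close>

definition cl_vec :: "nat \<Rightarrow> (nat \<Rightarrow> real) \<Rightarrow> cl" where
  "cl_vec m x = (\<lambda>A. \<Sum>j<m. if A = {j} then x j else 0)"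

definition cl_wedge :: "nat \<Rightarrow> (nat \<Rightarrow> real) \<Rightarrow> (nat \<Rightarrow> real) \<Rightarrow> cl" where
  "cl_wedge m x y = (\<lambda>A. \<Sum>j<m. \<Sum>k<m.
      if j < k \<and> A = {j, k} then x j * y k - x k * y j else 0)"

definition inner_m :: "nat \<Rightarrow> (nat \<Rightarrow> real) \<Rightarrow> (nat \<Rightarrow> real) \<Rightarrow> real" where
  "inner_m m x y = (\<Sum>j<m. x j * y j)"

definition normsq_m :: "nat \<Rightarrow> (nat \<Rightarrow> real) \<Rightarrow> real" where
  "normsq_m m x = (\<Sum>j<m. (x j)\<^sup>2)"

definition wedge_abs :: "nat \<Rightarrow> (nat \<Rightarrow> real) \<Rightarrow> (nat \<Rightarrow> real) \<Rightarrow> real" where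
  "wedge_abs m x y = sqrt (normsq_m m x * normsq_m m y - (inner_m m x y)\<^sup>2)"

text \<open>tJ a t = t^(-a) J_a(t) = 2^(-a) * sum_n (-1)^n (t/2)^(2n) / (n! Gamma(n+a+1)),
 extended continuously to t = 0 (rGamma = 1/Gamma).\<close>

definition tJ :: "real \<Rightarrow> real \<Rightarrow> real" where
  "tJ a t = 2 powr (- a) *
     (\<Sum>n. (-1) ^ n * (t / 2) ^ (2 * n) * rGamma (real n + a + 1) / fact n)"

definition f_tilde :: "nat \<Rightarrow> nat \<Rightarrow> real \<Rightarrow> real \<Rightarrow> real" where
  "f_tilde m i s t = (if i = 0 then 0 else
     - sqrt (pi / 2) * (\<Sum>l\<le>(i - 1) div 2.
        s ^ (i - 1 - 2 * l) * (1 / (2 ^ l * fact l)) * (fact i / fact (i - 1 - 2 * l))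
        * tJ ((real m - 2 * real l - 3) / 2) t))"

definition f_hat :: "nat \<Rightarrow> nat \<Rightarrow> real \<Rightarrow> real \<Rightarrow> real" where
  "f_hat m i s t = (-1) ^ (m div 2 + i) * sqrt (pi / 2) * (\<Sum>l\<le>i div 2.
        s ^ (i - 2 * l) * (1 / (2 ^ l * fact l)) * (fact i / fact (i - 2 * l))
        * tJ ((real m - 2 * real l - 3) / 2) t)"

definition g_fun :: "nat \<Rightarrow> nat \<Rightarrow> real \<Rightarrow> real \<Rightarrow> real" where
  "g_fun m i s t = sqrt (pi / 2) * (\<Sum>l\<le>i div 2.
        s ^ (i - 2 * l) * (1 / (2 ^ l * fact l)) * (fact i / fact (i - 2 * l))
        * tJ ((real m - 2 * real l - 1) / 2) t)"

definition K_plus :: "nat \<Rightarrow> nat \<Rightarrow> (nat \<Rightarrow> real) \<Rightarrow> (nat \<Rightarrow> real) \<Rightarrow> cl" where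
  "K_plus m i x y =
     (let s = inner_m m x y; t = wedge_abs m x y in
      cl_add (cl_scalar (f_tilde m i s t + f_hat m i s t))
             (cl_scale (g_fun m i s t) (cl_wedge m x y)))"

definition lebesgue_m :: "nat \<Rightarrow> (nat \<Rightarrow> real) measure" where
  "lebesgue_m m = PiM {..<m} (\<lambda>_. lborel)"

definition cl_integral :: "'a measure \<Rightarrow> ('a \<Rightarrow> cl) \<Rightarrow> cl" where
  "cl_integral N f = (\<lambda>A. integral\<^sup>L N (\<lambda>x. f x A))"

definition F_plus :: "nat \<Rightarrow> nat \<Rightarrow> ((nat \<Rightarrow> real) \<Rightarrow> cl) \<Rightarrow> (nat \<Rightarrow> real) \<Rightarrow> cl" where
  "F_plus m i f y = cl_scale ((2 * pi) powr (- real m / 2))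
      (cl_integral (lebesgue_m m) (\<lambda>x. cl_mult m (K_plus m i x y) (f x)))"

definition multi_idx :: "nat \<Rightarrow> nat \<Rightarrow> (nat \<Rightarrow> nat) set" where
  "multi_idx m k = {\<alpha>. \<alpha> \<in> {..<m} \<rightarrow>\<^sub>E {..k} \<and> (\<Sum>j<m. \<alpha> j) = k}"

definition cl_partial :: "((nat \<Rightarrow> real) \<Rightarrow> cl) \<Rightarrow> nat \<Rightarrow> (nat \<Rightarrow> real) \<Rightarrow> cl" where
  "cl_partial M j x = (\<lambda>A. deriv (\<lambda>h. M (x(j := x j + h)) A) 0)"

definition dirac :: "nat \<Rightarrow> ((nat \<Rightarrow> real) \<Rightarrow> cl) \<Rightarrow> (nat \<Rightarrow> real) \<Rightarrow> cl" where
  "dirac m M x = (\<lambda>C. \<Sum>j<m. cl_mult m (cl_e j) (cl_partial M j x) C)"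

definition spherical_monogenics :: "nat \<Rightarrow> nat \<Rightarrow> ((nat \<Rightarrow> real) \<Rightarrow> cl) set" where
  "spherical_monogenics m k = {M.
     (\<exists>c :: (nat \<Rightarrow> nat) \<Rightarrow> cl.
        (\<forall>\<alpha> A. \<not> A \<subseteq> {..<m} \<longrightarrow> c \<alpha> A = 0) \<and>
        (\<forall>x. M x = (\<lambda>A. \<Sum>\<alpha>\<in>multi_idx m k. c \<alpha> A * (\<Prod>j<m. x j ^ \<alpha> j)))) \<and>
     (\<forall>x. dirac m M x = (\<lambda>A. 0))}"

definition laguerre :: "nat \<Rightarrow> real \<Rightarrow> real \<Rightarrow> real" where
  "laguerre p a x = (\<Sum>j\<le>p. (-1) ^ j * ((real p + a) gchoose (p - j)) * x ^ j / fact j)"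

definition psi_even :: "nat \<Rightarrow> nat \<Rightarrow> nat \<Rightarrow> ((nat \<Rightarrow> real) \<Rightarrow> cl) \<Rightarrow> (nat \<Rightarrow> real) \<Rightarrow> cl" where
  "psi_even m p k M x = cl_scale
     (laguerre p (real m / 2 + real k - 1) (normsq_m m x) * exp (- normsq_m m x / 2)) (M x)"

definition psi_odd :: "nat \<Rightarrow> nat \<Rightarrow> nat \<Rightarrow> ((nat \<Rightarrow> real) \<Rightarrow> cl) \<Rightarrow> (nat \<Rightarrow> real) \<Rightarrow> cl" where
  "psi_odd m p k M x = cl_scale
     (laguerre p (real m / 2 + real k) (normsq_m m x) * exp (- normsq_m m x / 2))
     (cl_mult m (cl_vec m x) (M x))"

fun dfact_nat :: "nat \<Rightarrow> nat" where
  "dfact_nat 0 = 1"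
| "dfact_nat (Suc 0) = 1"
| "dfact_nat (Suc (Suc n)) = Suc (Suc n) * dfact_nat n"

definition dfact :: "int \<Rightarrow> real" where
  "dfact z = (if z < 0 then 1 else real (dfact_nat (nat z)))"

end

theory Submission
  imports Defs "HOL-Probability.Distributions"
begin

text \<open>
  Write \<open>A\<^sub>i\<close> for the sum over \<open>\<ell>\<close> in the definition of the kernels, in dimension \<open>m\<close>. Up to constants
  \<open>f_hat\<close> is \<open>A\<^sub>i\<close>, \<open>f_tilde\<close> is \<open>A\<^sub>i\<^sub>-\<^sub>1\<close>, and \<open>g_fun\<close> is \<open>A\<^sub>i\<close> in dimension \<open>m + 2\<close>. Both \<open>A\<^sub>i\<close> and
  the coordinates of \<open>(x \<and> y) g\<close> are eigenfunctions of the Laplacian in \<open>x\<close> with eigenvalue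
  \<open>- |y|\<^sup>2\<close>. For a homogeneous polynomial \<open>P\<close> of degree \<open>D\<close> and a harmonic polynomial \<open>H\<close> of degree
  \<open>d\<close>, Stein's identity gives \<open>(D - d) E[P H] = E[(\<Delta> P) H]\<close> for the Gaussian expectation \<open>E\<close>.
  Hence the pairing of \<open>H\<close> with the homogeneous part of degree \<open>d + 2 N\<close> of such an eigenfunction is
  \<open>(- |y|\<^sup>2 / 2) ^ N / N!\<close> times the pairing with the part of degree \<open>d\<close>, which sums up to a
  multiple of \<open>exp (- |y|\<^sup>2 / 2)\<close>; the pairing in degree \<open>d\<close> is a Vandermonde sum. A Laguerre factor
  \<open>L\<^sub>p (|x|\<^sup>2)\<close> only multiplies the part of degree \<open>d + 2 N\<close> by a polynomial in \<open>N\<close>, whose reflection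
  symmetry reproduces \<open>(-1) ^ p L\<^sub>p (|y|\<^sup>2)\<close>.
  Finally \<open>(x \<and> y) g\<close> pairs with \<open>H\<close> as the angular operator \<open>- y \<and> \<partial>\<close>, for which \<open>M\<close> and \<open>x M\<close>
  are eigenfunctions.
\<close>

section \<open>Homogeneous polynomial functions\<close>

text \<open>Parity organises the case distinction. \<open>A_i\<close> contains only powers of s of
  the parity of i, so it pairs to zero with a harmonic H of the opposite parity. With d the degree
  of H, only \<open>f_hat\<close> contributes for i + d even, and only \<open>f_tilde\<close> and
  \<open>g_fun\<close> for i + d odd. The latter two carry the same quotient of double factorials
  and add up to l - i times it, where l is the eigenvalue of the angular operator: -k for M and m +
  k - 1 for x M. The number -(k + i) extends the double factorial in the numerator, while m + k - 1
  - i cancels the leading factor of the one in the denominator; this gives all formulas the same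
  shape. The bound i <= m - 2 with m even keeps every Bessel order in -1/2, 1/2, 3/2, and so on.
  There the values of 1/Gamma in the series are positive, and the series is dominated by that of
  cosh, which justifies exchanging it with the Gaussian integral. After that exchange only
  polynomials are paired.\<close>

definition pd :: "nat \<Rightarrow> ((nat \<Rightarrow> real) \<Rightarrow> real) \<Rightarrow> (nat \<Rightarrow> real) \<Rightarrow> real" where
  "pd j f x = deriv (\<lambda>h. f (x(j := h))) (x j)"

text \<open>Multiplication is only by coordinates, so that an induction can move a factor
  from the polynomial into an accompanying monomial.\<close>

inductive hpoly :: "nat \<Rightarrow> nat \<Rightarrow> ((nat \<Rightarrow> real) \<Rightarrow> real) \<Rightarrow> bool" for m where
  zero: "hpoly m d (\<lambda>_. 0)"
| const: "hpoly m 0 (\<lambda>_. c)"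
| add: "hpoly m d f \<Longrightarrow> hpoly m d g \<Longrightarrow> hpoly m d (\<lambda>x. f x + g x)"
| coord: "j < m \<Longrightarrow> hpoly m d f \<Longrightarrow> hpoly m (Suc d) (\<lambda>x. x j * f x)"

lemma hpoly_cong: "hpoly m d f \<Longrightarrow> d = d' \<Longrightarrow> (\<And>x. f x = g x) \<Longrightarrow> hpoly m d' g"
proof -
  assume "hpoly m d f" "d = d'" "\<And>x. f x = g x"
  moreover from this have "f = g" by (intro ext)
  ultimately show ?thesis by simp
qed

lemma hpoly_scale: "hpoly m d f \<Longrightarrow> hpoly m d (\<lambda>x. c * f x)"
proof (induction rule: hpoly.induct)
  case (zero d) show ?case by (simp add: hpoly.zero)
next
  case (const c) show ?case by (rule hpoly.const)
next
  case (add d f g)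
  show ?case by (rule hpoly_cong[OF hpoly.add[OF add.IH]]) (auto simp: algebra_simps)
next
  case (coord j d f)
  show ?case by (rule hpoly_cong[OF hpoly.coord[OF coord.hyps(1) coord.IH]]) auto
qed

lemma hpoly_mult: "hpoly m d f \<Longrightarrow> hpoly m e g \<Longrightarrow> hpoly m (d + e) (\<lambda>x. f x * g x)"
proof (induction rule: hpoly.induct)
  case (zero d) show ?case by (simp add: hpoly.zero)
next
  case (const c) thus ?case by (simp add: hpoly_scale)
next
  case (add d f f')
  from hpoly.add[OF add.IH(1)[OF add.prems] add.IH(2)[OF add.prems]]
  show ?case by (rule hpoly_cong) (auto simp: algebra_simps)
next
  case (coord j d f)
  from hpoly.coord[OF coord.hyps(1) coord.IH[OF coord.prems]]
  show ?case by (rule hpoly_cong) auto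
qed

lemma hpoly_var: "j < m \<Longrightarrow> hpoly m 1 (\<lambda>x. x j)"
  by (rule hpoly_cong[OF hpoly.coord[OF _ hpoly.const[of m 1]]]) auto

lemma hpoly_power: "hpoly m d f \<Longrightarrow> hpoly m (n * d) (\<lambda>x. f x ^ n)"
proof (induction n)
  case 0 show ?case using hpoly.const[of m 1] by simp
next
  case (Suc n) thus ?case using hpoly_mult[of m d f "n * d" "\<lambda>x. f x ^ n"] by simp
qed

lemma hpoly_sum: "(\<And>i. i \<in> I \<Longrightarrow> hpoly m d (f i)) \<Longrightarrow> hpoly m d (\<lambda>x. \<Sum>i\<in>I. f i x)"
  by (induction I rule: infinite_finite_induct) (auto intro: hpoly.zero hpoly.add)

lemma hpoly_diff: "hpoly m d f \<Longrightarrow> hpoly m d g \<Longrightarrow> hpoly m d (\<lambda>x. f x - g x)"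
  by (rule hpoly_cong[OF hpoly.add[OF _ hpoly_scale[of m d g "-1"]]]) auto

lemma hpoly_differentiable:
  assumes "hpoly m d f"
  shows "(\<lambda>h. f (x(j := h))) differentiable (at z)"
  using assms
proof (induction rule: hpoly.induct)
  case (coord i d f)
  have "(\<lambda>h. (x(j := h)) i) differentiable (at z)"
    by (cases "i = j") auto
  thus ?case using coord.IH by (rule differentiable_mult)
qed auto

lemma hpoly_DERIV:
  assumes "hpoly m d f"
  shows "((\<lambda>h. f (x(j := h))) has_real_derivative pd j f x) (at (x j))"
  unfolding pd_def using hpoly_differentiable[OF assms, of x j "x j"]
  by (simp add: DERIV_deriv_iff_real_differentiable)

lemma pd_eqI:
  assumes "((\<lambda>h. f (x(j := h))) has_real_derivative D) (at (x j))"
  shows "pd j f x = D"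
  unfolding pd_def using assms by (rule DERIV_imp_deriv)

lemma pd_const [simp]: "pd j (\<lambda>_. c) = (\<lambda>_. 0)"
  by (intro ext pd_eqI) auto

lemma pd_coord: "pd j (\<lambda>x. x i) = (\<lambda>_. if i = j then 1 else 0)"
  by (intro ext pd_eqI) (auto intro!: derivative_eq_intros)

lemma pd_add: "hpoly m d f \<Longrightarrow> hpoly m' d' g \<Longrightarrow> pd j (\<lambda>x. f x + g x) = (\<lambda>x. pd j f x + pd j g x)"
  by (intro ext pd_eqI DERIV_add hpoly_DERIV)

lemma pd_mult:
  assumes "hpoly m d f" "hpoly m' d' g"
  shows "pd j (\<lambda>x. f x * g x) = (\<lambda>x. pd j f x * g x + f x * pd j g x)"
proof (intro ext pd_eqI)
  fix x
  from DERIV_mult[OF hpoly_DERIV[OF assms(1), of x j] hpoly_DERIV[OF assms(2), of x j]]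
  show "((\<lambda>h. f (x(j := h)) * g (x(j := h))) has_real_derivative
      pd j f x * g x + f x * pd j g x) (at (x j))"
    by (simp add: algebra_simps)
qed

lemma pd_scale: "hpoly m d f \<Longrightarrow> pd j (\<lambda>x. c * f x) = (\<lambda>x. c * pd j f x)"
  using pd_mult[OF hpoly.const[of m c], of m d f j] by simp

lemma pd_diff: "hpoly m d f \<Longrightarrow> hpoly m d' g \<Longrightarrow> pd j (\<lambda>x. f x - g x) = (\<lambda>x. pd j f x - pd j g x)"
  by (intro ext pd_eqI DERIV_diff hpoly_DERIV)

lemma pd_sum:
  assumes "\<And>i. i \<in> I \<Longrightarrow> hpoly m d (f i)"
  shows "pd j (\<lambda>x. \<Sum>i\<in>I. f i x) = (\<lambda>x. \<Sum>i\<in>I. pd j (f i) x)"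
  by (intro ext pd_eqI DERIV_sum hpoly_DERIV[OF assms])

lemma pd_power:
  assumes "hpoly m d f"
  shows "pd j (\<lambda>x. f x ^ n) = (\<lambda>x. real n * f x ^ (n - 1) * pd j f x)"
proof (intro ext pd_eqI)
  fix x
  from DERIV_power[OF hpoly_DERIV[OF assms, of x j], of n]
  show "((\<lambda>h. f (x(j := h)) ^ n) has_real_derivative real n * f x ^ (n - 1) * pd j f x) (at (x j))"
    by (simp add: algebra_simps)
qed

text \<open>The product rule leaves \<open>x i * pd j f\<close>, of degree
  \<open>Suc (d - 1)\<close>. This is \<open>d\<close> unless \<open>d = 0\<close>, where the
  derivative vanishes; so both clauses go through one induction.\<close>

lemma hpoly_pd_aux:
  assumes "hpoly m d f"
  shows "(d = 0 \<longrightarrow> pd j f = (\<lambda>_. 0)) \<and> (\<forall>e. d = Suc e \<longrightarrow> hpoly m e (pd j f))"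
  using assms
proof (induction rule: hpoly.induct)
  case (zero d) show ?case by (simp add: hpoly.zero)
next
  case (const c) show ?case by simp
next
  case (add d f g)
  thus ?case by (auto simp: pd_add[OF add.hyps] intro: hpoly.add)
next
  case (coord i d f)
  have eq: "pd j (\<lambda>x. x i * f x) = (\<lambda>x. (if i = j then 1 else 0) * f x + x i * pd j f x)"
    using pd_mult[OF hpoly_var[OF coord.hyps(1)] coord.hyps(2), of j] by (simp add: pd_coord)
  have "hpoly m d (\<lambda>x. x i * pd j f x)"
  proof (cases d)
    case 0 thus ?thesis using coord.IH by (simp add: hpoly.zero)
  next
    case (Suc e) thus ?thesis using coord.IH coord.hyps by (auto intro: hpoly.coord)
  qed
  thus ?case unfolding eq using coord.hyps by (auto intro!: hpoly.add hpoly_scale)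
qed

lemma pd_hpoly_0: "hpoly m 0 f \<Longrightarrow> pd j f = (\<lambda>_. 0)"
  using hpoly_pd_aux by blast

lemma hpoly_pd_Suc: "hpoly m (Suc d) f \<Longrightarrow> hpoly m d (pd j f)"
  using hpoly_pd_aux by blast

text \<open>Truncated subtraction is harmless: in degree 0 the derivative is zero, and zero is
  homogeneous of every degree.\<close>

lemma hpoly_pd: "hpoly m d f \<Longrightarrow> hpoly m (d - 1) (pd j f)"
  by (cases d) (auto simp: pd_hpoly_0 hpoly_pd_Suc hpoly.zero)

lemma pd_commute: "hpoly m d f \<Longrightarrow> pd i (pd j f) = pd j (pd i f)"
proof (induction rule: hpoly.induct)
  case (add d f g)
  thus ?case by (simp add: pd_add[OF add.hyps] pd_add[OF hpoly_pd hpoly_pd])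
next
  case (coord l d f)
  note v = hpoly_var[OF coord.hyps(1)]
  have eq: "pd j (\<lambda>x. x l * f x) = (\<lambda>x. (if l = j then 1 else 0) * f x + x l * pd j f x)" for j
    using pd_mult[OF v coord.hyps(2), of j] by (simp add: pd_coord)
  have "pd i (\<lambda>x. x l * pd j f x) = (\<lambda>x. (if l = i then 1 else 0) * pd j f x + x l * pd i (pd j f) x)" for i j
    using pd_mult[OF v hpoly_pd[OF coord.hyps(2)], of i j] by (simp add: pd_coord)
  hence "pd i (pd j (\<lambda>x. x l * f x)) = (\<lambda>x. (if l = j then 1 else 0) * pd i f x +
      ((if l = i then 1 else 0) * pd j f x + x l * pd i (pd j f) x))" for i j
    unfolding eq using pd_add[OF hpoly_scale[OF coord.hyps(2)] hpoly_mult[OF v hpoly_pd[OF coord.hyps(2)]]]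
    by (simp add: pd_scale[OF coord.hyps(2)])
  thus ?case by (simp add: coord.IH fun_eq_iff)
qed auto

lemma euler: "hpoly m d f \<Longrightarrow> (\<Sum>j<m. x j * pd j f x) = real d * f x"
proof (induction rule: hpoly.induct)
  case (add d f g)
  have "(\<Sum>j<m. x j * pd j (\<lambda>x. f x + g x) x) = (\<Sum>j<m. x j * pd j f x) + (\<Sum>j<m. x j * pd j g x)"
    by (simp add: pd_add[OF add.hyps] sum.distrib distrib_left)
  thus ?case by (simp add: add.IH algebra_simps)
next
  case (coord l d f)
  have eq: "pd j (\<lambda>x. x l * f x) = (\<lambda>x. (if j = l then 1 else 0) * f x + x l * pd j f x)" for j
    using pd_mult[OF hpoly_var[OF coord.hyps(1)] coord.hyps(2), of j] by (simp add: pd_coord eq_commute)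
  have "(\<Sum>j<m. x j * pd j (\<lambda>x. x l * f x) x) =
    (\<Sum>j<m. if j = l then x j * f x else 0) + x l * (\<Sum>j<m. x j * pd j f x)"
    unfolding eq sum_distrib_left sum.distrib[symmetric] by (intro sum.cong) (auto simp: algebra_simps)
  thus ?case using coord.hyps by (simp add: coord.IH algebra_simps)
qed auto

section \<open>The Laplacian on homogeneous polynomials\<close>

definition lap :: "nat \<Rightarrow> ((nat \<Rightarrow> real) \<Rightarrow> real) \<Rightarrow> (nat \<Rightarrow> real) \<Rightarrow> real" where
  "lap m f x = (\<Sum>j<m. pd j (pd j f) x)"

lemma hpoly_lap: "hpoly m d f \<Longrightarrow> hpoly m (d - 2) (lap m f)"
  unfolding lap_def[abs_def] by (intro hpoly_sum) (metis hpoly_pd diff_diff_left nat_1_add_1)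

lemma lap_hpoly_le_1:
  assumes "hpoly m d f" "d \<le> 1" shows "lap m f = (\<lambda>_. 0)"
proof -
  have "pd j (pd j f) = (\<lambda>_. 0)" for j
    using pd_hpoly_0[OF hpoly_pd[OF assms(1), of j, THEN hpoly_cong[of _ _ _ 0]]] assms(2) by auto
  thus ?thesis by (simp add: lap_def fun_eq_iff)
qed

lemma lap_mult:
  assumes "hpoly m d f" "hpoly m e g"
  shows "lap m (\<lambda>x. f x * g x) x =
    lap m f x * g x + 2 * (\<Sum>j<m. pd j f x * pd j g x) + f x * lap m g x"
proof -
  note f' = hpoly_pd[OF assms(1)] and g' = hpoly_pd[OF assms(2)]
  have "pd j (pd j (\<lambda>x. f x * g x)) x = pd j (pd j f) x * g x + 2 * (pd j f x * pd j g x) + f x * pd j (pd j g) x"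
    for j
    by (simp add: pd_mult[OF assms] pd_mult[OF f' assms(2)] pd_mult[OF assms(1) g']
      pd_add[OF hpoly_mult[OF f' assms(2)] hpoly_mult[OF assms(1) g']])
  thus ?thesis
    by (simp add: lap_def sum.distrib sum_distrib_left sum_distrib_right)
qed

lemma lap_scale: "hpoly m d f \<Longrightarrow> lap m (\<lambda>x. c * f x) x = c * lap m f x"
  by (simp add: lap_def pd_scale pd_scale[OF hpoly_pd] sum_distrib_left)

lemma lap_power:
  assumes "hpoly m d f"
  shows "lap m (\<lambda>x. f x ^ n) x = real n * f x ^ (n - 1) * lap m f x
     + real n * real (n - 1) * f x ^ (n - 2) * (\<Sum>j<m. (pd j f x)\<^sup>2)"
proof -
  note f' = hpoly_pd[OF assms]
  have "pd j (pd j (\<lambda>x. f x ^ n)) x = real n * f x ^ (n - 1) * pd j (pd j f) x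
     + real n * real (n - 1) * f x ^ (n - 2) * (pd j f x)\<^sup>2" for j
    by (simp add: pd_power[OF assms] pd_mult[OF hpoly_scale[OF hpoly_power[OF assms]] f']
      pd_scale[OF hpoly_power[OF assms]] power2_eq_square)
      (simp add: diff_diff_left numeral_2_eq_2)
  thus ?thesis by (simp add: lap_def sum.distrib sum_distrib_left)
qed

section \<open>Gaussian expectation\<close>

text \<open>The constant is that of \<open>F_plus\<close> and the weight is that of
  \<open>psi_even\<close> and \<open>psi_odd\<close>, so their transforms are expectations of a
  kernel times a polynomial.\<close>

definition gauss_exp :: "nat \<Rightarrow> ((nat \<Rightarrow> real) \<Rightarrow> real) \<Rightarrow> real" where
  "gauss_exp m f = (2 * pi) powr (- real m / 2) *
     (\<integral>x. f x * exp (- normsq_m m x / 2) \<partial>lebesgue_m m)"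

definition coord_monom :: "nat \<Rightarrow> (nat \<Rightarrow> nat) \<Rightarrow> (nat \<Rightarrow> real) \<Rightarrow> real" where
  "coord_monom m \<alpha> x = (\<Prod>j<m. x j ^ \<alpha> j)"

lemma coord_monom_upd:
  assumes "j < m"
  shows "coord_monom m (\<alpha>(j := n)) x = x j ^ n * (\<Prod>i\<in>{..<m} - {j}. x i ^ \<alpha> i)"
proof -
  have "coord_monom m (\<alpha>(j := n)) x = (\<Prod>i\<in>insert j ({..<m} - {j}). x i ^ (\<alpha>(j := n)) i)"
    unfolding coord_monom_def using assms by (intro prod.cong) auto
  also have "\<dots> = x j ^ n * (\<Prod>i\<in>{..<m} - {j}. x i ^ (\<alpha>(j := n)) i)"
    by (subst prod.insert) auto
  also have "(\<Prod>i\<in>{..<m} - {j}. x i ^ (\<alpha>(j := n)) i) = (\<Prod>i\<in>{..<m} - {j}. x i ^ \<alpha> i)"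
    by (intro prod.cong) auto
  finally show ?thesis .
qed

lemma coord_monom_Suc: "j < m \<Longrightarrow> coord_monom m (\<alpha>(j := Suc n)) x = x j * coord_monom m (\<alpha>(j := n)) x"
  by (simp add: coord_monom_upd)

lemma coord_monom_remove: "j < m \<Longrightarrow> coord_monom m \<alpha> x = x j ^ \<alpha> j * (\<Prod>i\<in>{..<m} - {j}. x i ^ \<alpha> i)"
  using coord_monom_upd[of j m \<alpha> "\<alpha> j" x] by simp

lemma exp_normsq: "exp (- c * normsq_m m x) = (\<Prod>j<m. exp (- c * (x j)\<^sup>2))"
  by (simp add: normsq_m_def sum_distrib_left exp_sum flip: sum_negf)

lemma integrable_gauss_1d:
  assumes "c > 0" shows "integrable lborel (\<lambda>x::real. x ^ n * exp (- c * x\<^sup>2))"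
proof -
  define \<sigma> where "\<sigma> = 1 / sqrt (2 * c)"
  have s: "\<sigma> > 0" "2 * \<sigma>\<^sup>2 = 1 / c" using assms by (auto simp: \<sigma>_def power_divide)
  have "integrable lborel (\<lambda>x. sqrt (2 * pi * \<sigma>\<^sup>2) * (normal_density 0 \<sigma> x * (x - 0) ^ n))"
    by (intro integrable_mult_right integrable_normal_moment s)
  moreover have "sqrt (2 * pi * \<sigma>\<^sup>2) * (normal_density 0 \<sigma> x * (x - 0) ^ n) = x ^ n * exp (- c * x\<^sup>2)" for x
    using s assms by (simp add: normal_density_def mult.assoc)
  ultimately show ?thesis by (simp only:)
qed

definition gmoment :: "nat \<Rightarrow> real" where
  "gmoment n = (\<integral>x. x ^ n * exp (- (1 / 2) * x\<^sup>2) \<partial>lborel)"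

lemma gmoment_eq: "gmoment n = sqrt (2 * pi) * (\<integral>x. std_normal_density x * (x - 0) ^ n \<partial>lborel)"
  unfolding gmoment_def integral_mult_right_zero[symmetric]
  by (intro Bochner_Integration.integral_cong) (auto simp: normal_density_def)

lemma gmoment_even: "gmoment (2 * n) = sqrt (2 * pi) * (fact (2 * n) / (2 ^ n * fact n))"
  unfolding gmoment_eq by (subst integral_normal_moment_even) auto

lemma gmoment_odd: "odd n \<Longrightarrow> gmoment n = 0"
  unfolding gmoment_eq using integral_normal_moment_odd[of 1 0 "n div 2"] by simp

text \<open>Integration by parts in one variable, here read off the closed form of the moments. It
  is the base of Stein's identity below.\<close>

lemma gmoment_Suc: "gmoment (Suc n) = real n * gmoment (n - 1)"
proof (cases "even n")
  case True
  thus ?thesis by (cases "n = 0") (auto simp: gmoment_odd)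
next
  case False
  then obtain k where n: "n = 2 * k + 1" by (auto elim: oddE)
  have "fact (2 * Suc k) / (2 ^ Suc k * fact (Suc k)) =
      ((2 * (real k + 1)) * ((2 * real k + 1) * fact (2 * k))) / ((2 * (real k + 1)) * (2 ^ k * fact k))"
    by (simp add: algebra_simps)
  also have "\<dots> = (2 * real k + 1) * (fact (2 * k) / (2 ^ k * fact k))"
    by (subst mult_divide_mult_cancel_left) auto
  finally have "fact (2 * Suc k) / (2 ^ Suc k * fact (Suc k)) =
      (2 * real k + 1) * (fact (2 * k) / (2 ^ k * fact k))" .
  hence "gmoment (2 * Suc k) = (2 * real k + 1) * gmoment (2 * k)"
    unfolding gmoment_even by simp
  thus ?thesis unfolding n by simp
qed

interpretation lborel_product: product_sigma_finite "\<lambda>_::nat. lborel :: real measure" ..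

text \<open>The rate \<open>c\<close> is kept general because the weight has rate 1/2, whereas the
  dominating function in \<open>gauss_tJ_sums\<close> decays only with rate 1/4.\<close>

lemma integrable_monom_gauss:
  assumes "c > 0" shows "integrable (lebesgue_m m) (\<lambda>x. coord_monom m \<alpha> x * exp (- c * normsq_m m x))"
  unfolding coord_monom_def exp_normsq prod.distrib[symmetric] lebesgue_m_def
  by (intro lborel_product.product_integrable_prod integrable_gauss_1d assms) auto

lemma integral_mono_gauss:
  "(\<integral>x. coord_monom m \<alpha> x * exp (- (1 / 2) * normsq_m m x) \<partial>lebesgue_m m) = (\<Prod>j<m. gmoment (\<alpha> j))"
  unfolding coord_monom_def exp_normsq prod.distrib[symmetric] lebesgue_m_def gmoment_def
  by (intro lborel_product.product_integral_prod integrable_gauss_1d) auto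

lemma integrable_hpoly_mono:
  assumes "hpoly m d f" "c > 0"
  shows "integrable (lebesgue_m m) (\<lambda>x. f x * coord_monom m \<alpha> x * exp (- c * normsq_m m x))"
  using assms(1)
proof (induction arbitrary: \<alpha> rule: hpoly.induct)
  case (zero d \<alpha>) show ?case by simp
next
  case (const k \<alpha>)
  show ?case using integrable_mult_right[OF integrable_monom_gauss[OF assms(2), of m \<alpha>], of k]
    by (simp add: mult.assoc)
next
  case (add d f g \<alpha>)
  from Bochner_Integration.integrable_add[OF add.IH]
  show ?case by (simp add: distrib_right)
next
  case (coord j d f \<alpha>)
  from coord.IH[of "\<alpha>(j := Suc (\<alpha> j))"] show ?case
    by (simp add: coord_monom_Suc[OF coord.hyps(1)] mult_ac del: fun_upd_apply)
qed

lemma integrable_hpoly: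
  "hpoly m d f \<Longrightarrow> c > 0 \<Longrightarrow> integrable (lebesgue_m m) (\<lambda>x. f x * exp (- c * normsq_m m x))"
  using integrable_hpoly_mono[of m d f c "\<lambda>_. 0"] by (simp add: coord_monom_def)

lemma integrable_hpoly_half:
  "hpoly m d f \<Longrightarrow> integrable (lebesgue_m m) (\<lambda>x. f x * exp (- normsq_m m x / 2))"
  using integrable_hpoly[of m d f "1 / 2"] by simp

text \<open>The monomial absorbs the coordinates of \<open>f\<close> one by one until a constant is
  left. Then the integral factorises and the claim is \<open>gmoment_Suc\<close> in coordinate
  \<open>j\<close>. The factor \<open>real (\<alpha> j)\<close> protects the truncated
  exponent.\<close>

lemma stein_mono:
  assumes "hpoly m d f" "j < m"
  shows "(\<integral>x. x j * f x * coord_monom m \<alpha> x * exp (- (1 / 2) * normsq_m m x) \<partial>lebesgue_m m) =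
    (\<integral>x. (pd j f x * coord_monom m \<alpha> x + f x * (real (\<alpha> j) * coord_monom m (\<alpha>(j := \<alpha> j - 1)) x))
        * exp (- (1 / 2) * normsq_m m x) \<partial>lebesgue_m m)"
  using assms(1)
proof (induction arbitrary: \<alpha> rule: hpoly.induct)
  case (zero d \<alpha>) show ?case by simp
next
  case (const c \<alpha>)
  have *: "(\<Prod>i<m. gmoment ((\<alpha>(j := n)) i)) = gmoment n * (\<Prod>i\<in>{..<m}-{j}. gmoment (\<alpha> i))" for n
  proof -
    have "(\<Prod>i<m. gmoment ((\<alpha>(j := n)) i)) = (\<Prod>i\<in>insert j ({..<m} - {j}). gmoment ((\<alpha>(j := n)) i))"
      using assms(2) by (intro prod.cong) auto
    also have "\<dots> = gmoment n * (\<Prod>i\<in>{..<m} - {j}. gmoment ((\<alpha>(j := n)) i))"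
      by (subst prod.insert) auto
    also have "(\<Prod>i\<in>{..<m} - {j}. gmoment ((\<alpha>(j := n)) i)) = (\<Prod>i\<in>{..<m} - {j}. gmoment (\<alpha> i))"
      by (intro prod.cong) auto
    finally show ?thesis .
  qed
  have "(\<integral>x. x j * c * coord_monom m \<alpha> x * exp (- (1 / 2) * normsq_m m x) \<partial>lebesgue_m m) =
    (\<integral>x. c * (coord_monom m (\<alpha>(j := Suc (\<alpha> j))) x * exp (- (1 / 2) * normsq_m m x)) \<partial>lebesgue_m m)"
    by (simp add: coord_monom_Suc[OF assms(2)] mult_ac)
  also have "\<dots> = c * (gmoment (Suc (\<alpha> j)) * (\<Prod>i\<in>{..<m}-{j}. gmoment (\<alpha> i)))"
    unfolding integral_mult_right_zero integral_mono_gauss * ..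
  also have "\<dots> = c * real (\<alpha> j) * (gmoment (\<alpha> j - 1) * (\<Prod>i\<in>{..<m}-{j}. gmoment (\<alpha> i)))"
    by (simp add: gmoment_Suc)
  also have "\<dots> = (\<integral>x. c * real (\<alpha> j) * (coord_monom m (\<alpha>(j := \<alpha> j - 1)) x * exp (- (1 / 2) * normsq_m m x)) \<partial>lebesgue_m m)"
    unfolding integral_mult_right_zero integral_mono_gauss * ..
  finally show ?case by (simp add: mult_ac del: fun_upd_apply)
next
  case (add d f g \<alpha>)
  let ?w = "\<lambda>x. exp (- (1 / 2) * normsq_m m x)"
  have i1: "integrable (lebesgue_m m) (\<lambda>x. x j * h x * coord_monom m \<alpha> x * ?w x)" if "hpoly m d h" for h
    using integrable_hpoly_mono[OF hpoly.coord[OF assms(2) that], of "1/2" \<alpha>] by simp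
  have i2: "integrable (lebesgue_m m) (\<lambda>x. (pd j h x * coord_monom m \<alpha> x + h x * (real (\<alpha> j) * coord_monom m (\<alpha>(j := \<alpha> j - 1)) x)) * ?w x)"
    if "hpoly m d h" for h
    using Bochner_Integration.integrable_add[OF integrable_hpoly_mono[OF hpoly_pd[OF that, of j], of "1/2" \<alpha>]
       integrable_mult_right[OF integrable_hpoly_mono[OF that, of "1/2" "\<alpha>(j := \<alpha> j - 1)"], of "real (\<alpha> j)"]]
    by (simp add: algebra_simps)
  have "(\<integral>x. x j * (f x + g x) * coord_monom m \<alpha> x * ?w x \<partial>lebesgue_m m) =
     (\<integral>x. x j * f x * coord_monom m \<alpha> x * ?w x + x j * g x * coord_monom m \<alpha> x * ?w x \<partial>lebesgue_m m)"
    by (simp add: algebra_simps)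
  also have "\<dots> = (\<integral>x. (pd j f x * coord_monom m \<alpha> x + f x * (real (\<alpha> j) * coord_monom m (\<alpha>(j := \<alpha> j - 1)) x)) * ?w x
      + (pd j g x * coord_monom m \<alpha> x + g x * (real (\<alpha> j) * coord_monom m (\<alpha>(j := \<alpha> j - 1)) x)) * ?w x \<partial>lebesgue_m m)"
    using i1 i2 add.hyps by (simp only: Bochner_Integration.integral_add add.IH)
  finally show ?case by (simp add: pd_add[OF add.hyps] algebra_simps del: fun_upd_apply)
next
  case (coord i d f \<alpha>)
  have pd: "pd j (\<lambda>x. x i * f x) = (\<lambda>x. (if i = j then 1 else 0) * f x + x i * pd j f x)"
    using pd_mult[OF hpoly_var[OF coord.hyps(1)] coord.hyps(2), of j] by (simp add: pd_coord)
  \<comment> \<open>The coordinate \<open>x i\<close> moves into the monomial; \<open>m2\<close>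
    checks that the product rule gives the same result before and after the move.\<close>
  define \<beta> where "\<beta> = \<alpha>(i := Suc (\<alpha> i))"
  have m1: "coord_monom m \<beta> x = x i * coord_monom m \<alpha> x" for x
    unfolding \<beta>_def using coord_monom_Suc[OF coord.hyps(1), of \<alpha> "\<alpha> i"] by simp
  have m2: "pd j (\<lambda>x. x i * f x) x * coord_monom m \<alpha> x + x i * f x * (real (\<alpha> j) * coord_monom m (\<alpha>(j := \<alpha> j - 1)) x)
     = pd j f x * coord_monom m \<beta> x + f x * (real (\<beta> j) * coord_monom m (\<beta>(j := \<beta> j - 1)) x)" for x
  proof (cases "i = j")
    case True
    have "real (\<alpha> j) * coord_monom m \<alpha> x = real (\<alpha> j) * (x j * coord_monom m (\<alpha>(j := \<alpha> j - 1)) x)"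
      by (cases "\<alpha> j") (auto simp: coord_monom_remove[OF assms(2), of \<alpha>] coord_monom_upd[OF assms(2)] simp del: fun_upd_apply)
    moreover have "\<beta>(j := \<beta> j - 1) = \<alpha>" "\<beta> j = Suc (\<alpha> j)" by (auto simp: \<beta>_def True)
    ultimately show ?thesis using m1 pd True by (auto simp: algebra_simps simp del: fun_upd_apply)
  next
    case False
    have "\<beta>(j := \<beta> j - 1) = (\<alpha>(j := \<alpha> j - 1))(i := Suc ((\<alpha>(j := \<alpha> j - 1)) i))" "\<beta> j = \<alpha> j"
      using False by (auto simp: \<beta>_def fun_eq_iff)
    hence "coord_monom m (\<beta>(j := \<beta> j - 1)) x = x i * coord_monom m (\<alpha>(j := \<alpha> j - 1)) x"
      using coord_monom_Suc[OF coord.hyps(1), of "\<alpha>(j := \<alpha> j - 1)" "(\<alpha>(j := \<alpha> j - 1)) i"]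
      by (simp only: fun_upd_triv)
    thus ?thesis unfolding pd m1 using False \<open>\<beta> j = \<alpha> j\<close> by (simp add: algebra_simps)
  qed
  show ?case using coord.IH[of \<beta>] unfolding m2 m1 by (simp add: mult_ac del: fun_upd_apply)
qed

lemma stein:
  assumes "hpoly m d f" "j < m"
  shows "gauss_exp m (\<lambda>x. x j * f x) = gauss_exp m (pd j f)"
  using stein_mono[OF assms, of "\<lambda>_. 0"] by (simp add: gauss_exp_def coord_monom_def)

lemma gauss_exp_add:
  assumes "hpoly m d f" "hpoly m e g"
  shows "gauss_exp m (\<lambda>x. f x + g x) = gauss_exp m f + gauss_exp m g"
  unfolding gauss_exp_def distrib_right
  by (subst Bochner_Integration.integral_add)
     (simp_all only: integrable_hpoly_half[OF assms(1)] integrable_hpoly_half[OF assms(2)] distrib_left)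

lemma gauss_exp_scale: "gauss_exp m (\<lambda>x. c * f x) = c * gauss_exp m f"
  unfolding gauss_exp_def mult.assoc integral_mult_right_zero by simp

lemma gauss_exp_zero [simp]: "gauss_exp m (\<lambda>_. 0) = 0"
  by (simp add: gauss_exp_def)

lemma gauss_exp_sum:
  assumes "\<And>i. i \<in> I \<Longrightarrow> hpoly m d (f i)"
  shows "gauss_exp m (\<lambda>x. \<Sum>i\<in>I. f i x) = (\<Sum>i\<in>I. gauss_exp m (f i))"
  using assms
proof (induction I rule: infinite_finite_induct)
  case (insert i I)
  from insert.hyps have "(\<lambda>x. \<Sum>i\<in>insert i I. f i x) = (\<lambda>x. f i x + (\<Sum>i\<in>I. f i x))" by simp
  thus ?case using insert gauss_exp_add[of m d "f i" d "\<lambda>x. \<Sum>i\<in>I. f i x"]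
    by (auto simp: hpoly_sum)
qed auto

lemma gauss_exp_const: "gauss_exp m (\<lambda>_. c) = c"
proof -
  have "(\<Prod>j<m. gmoment 0) = (2 * pi) powr (real m / 2)"
    using gmoment_even[of 0] by (simp add: powr_half_sqrt[symmetric] powr_realpow[symmetric] powr_powr)
  hence "(\<integral>x. exp (- normsq_m m x / 2) \<partial>lebesgue_m m) = (2 * pi) powr (real m / 2)"
    using integral_mono_gauss[of m "\<lambda>_. 0"] by (simp add: coord_monom_def)
  thus ?thesis
    by (simp add: gauss_exp_def powr_add[symmetric])
qed

section \<open>Pairing with harmonic polynomials\<close>

definition harmonic_poly :: "nat \<Rightarrow> nat \<Rightarrow> ((nat \<Rightarrow> real) \<Rightarrow> real) \<Rightarrow> bool" where
  "harmonic_poly m d H \<longleftrightarrow> hpoly m d H \<and> (\<forall>x. lap m H x = 0)"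

lemma harmonic_hpoly: "harmonic_poly m d H \<Longrightarrow> hpoly m d H"
  by (simp add: harmonic_poly_def)

lemma harmonic_lap: "harmonic_poly m d H \<Longrightarrow> lap m H x = 0"
  by (simp add: harmonic_poly_def)

lemma harmonic_pd:
  assumes "harmonic_poly m (Suc d) H" shows "harmonic_poly m d (pd j H)"
proof -
  note H = harmonic_hpoly[OF assms]
  have "lap m (pd j H) x = 0" for x
  proof -
    have eq: "pd i (pd i (pd j H)) = pd j (pd i (pd i H))" for i
      by (simp add: pd_commute[OF H, of i j] pd_commute[OF hpoly_pd[OF H, of i], of i j])
    have "lap m (pd j H) x = (\<Sum>i<m. pd j (pd i (pd i H)) x)" by (simp add: lap_def eq)
    also have "\<dots> = pd j (lap m H) x"
      unfolding lap_def[abs_def] by (subst pd_sum[OF hpoly_pd[OF hpoly_pd[OF H]]]) simp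
    also have "lap m H = (\<lambda>_. 0)" using harmonic_lap[OF assms] by auto
    finally show ?thesis by simp
  qed
  thus ?thesis using hpoly_pd_Suc[OF H] by (simp add: harmonic_poly_def)
qed

lemma harmonic_const: "harmonic_poly m 0 (\<lambda>_. c)"
  by (simp add: harmonic_poly_def hpoly.const lap_def)

text \<open>Both sides come from applying Stein's identity to Euler's identity, once for
  the first and once for the second factor; the mixed terms cancel.\<close>

lemma gauss_exp_harmonic:
  assumes P: "hpoly m D P" and H: "harmonic_poly m d H"
  shows "(real D - real d) * gauss_exp m (\<lambda>x. P x * H x) = gauss_exp m (\<lambda>x. lap m P x * H x)"
proof -
  note h = harmonic_hpoly[OF H]
  let ?G = "\<Sum>j<m. gauss_exp m (\<lambda>x. pd j P x * pd j H x)"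
  have st: "(\<Sum>j<m. gauss_exp m (\<lambda>x. x j * (f j x * g j x))) =
      (\<Sum>j<m. gauss_exp m (\<lambda>x. pd j (f j) x * g j x)) + (\<Sum>j<m. gauss_exp m (\<lambda>x. f j x * pd j (g j) x))"
    if "\<And>j. hpoly m a (f j)" "\<And>j. hpoly m b (g j)" for f g a b
  proof -
    have "gauss_exp m (\<lambda>x. x j * (f j x * g j x)) =
      gauss_exp m (\<lambda>x. pd j (f j) x * g j x) + gauss_exp m (\<lambda>x. f j x * pd j (g j) x)" if "j < m" for j
      using stein[OF hpoly_mult[OF \<open>hpoly m a (f j)\<close> \<open>hpoly m b (g j)\<close>] that]
        gauss_exp_add[OF hpoly_mult[OF hpoly_pd[OF \<open>hpoly m a (f j)\<close>, of j] \<open>hpoly m b (g j)\<close>]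
          hpoly_mult[OF \<open>hpoly m a (f j)\<close> hpoly_pd[OF \<open>hpoly m b (g j)\<close>, of j]]]
      by (simp add: pd_mult[OF \<open>hpoly m a (f j)\<close> \<open>hpoly m b (g j)\<close>])
    thus ?thesis by (simp add: sum.distrib)
  qed
  have "real D * gauss_exp m (\<lambda>x. P x * H x) = gauss_exp m (\<lambda>x. \<Sum>j<m. x j * (pd j P x * H x))"
    unfolding gauss_exp_scale[symmetric]
    by (simp add: mult.assoc[symmetric] euler[OF P, symmetric] sum_distrib_right)
  also have "\<dots> = (\<Sum>j<m. gauss_exp m (\<lambda>x. x j * (pd j P x * H x)))"
    by (rule gauss_exp_sum, rule hpoly.coord[OF _ hpoly_mult[OF hpoly_pd[OF P] h]], simp)
  also have "\<dots> = (\<Sum>j<m. gauss_exp m (\<lambda>x. pd j (pd j P) x * H x)) + ?G"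
    by (rule st[OF hpoly_pd[OF P] h])
  also have "(\<Sum>j<m. gauss_exp m (\<lambda>x. pd j (pd j P) x * H x)) = gauss_exp m (\<lambda>x. lap m P x * H x)"
    unfolding lap_def sum_distrib_right
    by (rule gauss_exp_sum[symmetric], rule hpoly_mult[OF hpoly_pd[OF hpoly_pd[OF P]] h])
  finally have 1: "real D * gauss_exp m (\<lambda>x. P x * H x) = gauss_exp m (\<lambda>x. lap m P x * H x) + ?G" .
  have "real d * gauss_exp m (\<lambda>x. P x * H x) = gauss_exp m (\<lambda>x. \<Sum>j<m. x j * (P x * pd j H x))"
    unfolding gauss_exp_scale[symmetric]
    by (simp add: mult.left_commute[of _ "P _"] euler[OF h, symmetric] sum_distrib_left)
  also have "\<dots> = (\<Sum>j<m. gauss_exp m (\<lambda>x. x j * (P x * pd j H x)))"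
    by (rule gauss_exp_sum, rule hpoly.coord[OF _ hpoly_mult[OF P hpoly_pd[OF h]]], simp)
  also have "\<dots> = ?G + (\<Sum>j<m. gauss_exp m (\<lambda>x. P x * pd j (pd j H) x))"
    by (rule st[OF P hpoly_pd[OF h]])
  also have "(\<Sum>j<m. gauss_exp m (\<lambda>x. P x * pd j (pd j H) x)) = gauss_exp m (\<lambda>x. P x * lap m H x)"
    unfolding lap_def sum_distrib_left
    by (rule gauss_exp_sum[symmetric], rule hpoly_mult[OF P hpoly_pd[OF hpoly_pd[OF h]]])
  finally have "real d * gauss_exp m (\<lambda>x. P x * H x) = ?G"
    by (simp add: harmonic_lap[OF H])
  with 1 show ?thesis by (simp add: algebra_simps)
qed

text \<open>The factor D - d in \<open>gauss_exp_harmonic\<close> is nonzero here, and the Laplacian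
  lowers the degree by two, so the pairing descends to degree at most 1, where the Laplacian is
  zero.\<close>

lemma gauss_exp_harmonic_low:
  assumes "hpoly m D P" "harmonic_poly m d H" "D < d"
  shows "gauss_exp m (\<lambda>x. P x * H x) = 0"
  using assms(1,3)
proof (induction D arbitrary: P rule: less_induct)
  case (less D)
  have "gauss_exp m (\<lambda>x. lap m P x * H x) = 0"
  proof (cases "D \<le> 1")
    case True thus ?thesis using lap_hpoly_le_1[OF less.prems(1)] by simp
  next
    case False thus ?thesis using less.IH[of "D - 2" "lap m P"] less.prems hpoly_lap by auto
  qed
  with gauss_exp_harmonic[OF less.prems(1) assms(2)] less.prems(2) show ?case by simp
qed

text \<open>The same descent with H = 1, of degree 0: an odd D never makes the factor D - 0
  vanish.\<close>

lemma gauss_exp_odd: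
  assumes "hpoly m D f" "odd D" shows "gauss_exp m f = 0"
  using assms
proof (induction D arbitrary: f rule: less_induct)
  case (less D)
  have "gauss_exp m (lap m f) = 0"
  proof (cases "D \<le> 1")
    case True thus ?thesis using lap_hpoly_le_1[OF less.prems(1)] by simp
  next
    case False thus ?thesis using less.IH[of "D - 2" "lap m f"] less.prems hpoly_lap by auto
  qed
  moreover have "D \<noteq> 0" using less.prems(2) by (cases D) auto
  ultimately show ?case using gauss_exp_harmonic[OF less.prems(1) harmonic_const[of m 1]] by simp
qed

lemma hpoly_normsq: "hpoly m 2 (normsq_m m)"
  unfolding normsq_m_def[abs_def]
  by (intro hpoly_sum) (use hpoly_power[OF hpoly_var, of _ m 2] in auto)

text \<open>Stein's identity applied to x_j (x_j f) gives f + x_j times the derivative of f. Summing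
  over j, the first part counts dimensions and the second is Euler's identity.\<close>

lemma gauss_exp_normsq:
  assumes "hpoly m D f"
  shows "gauss_exp m (\<lambda>x. normsq_m m x * f x) = (real m + real D) * gauss_exp m f"
proof -
  have "gauss_exp m (\<lambda>x. normsq_m m x * f x) = gauss_exp m (\<lambda>x. \<Sum>j<m. x j * (x j * f x))"
    by (simp add: normsq_m_def sum_distrib_right power2_eq_square mult.assoc)
  also have "\<dots> = (\<Sum>j<m. gauss_exp m (\<lambda>x. x j * (x j * f x)))"
    by (rule gauss_exp_sum, rule hpoly.coord[OF _ hpoly.coord[OF _ assms]]) auto
  also have "\<dots> = (\<Sum>j<m. gauss_exp m (\<lambda>x. f x + x j * pd j f x))"
  proof (intro sum.cong refl)
    fix j assume "j \<in> {..<m}" hence j: "j < m" by simp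
    have "pd j (\<lambda>x. x j * f x) = (\<lambda>x. f x + x j * pd j f x)"
      using pd_mult[OF hpoly_var[OF j] assms, of j] by (simp add: pd_coord)
    with stein[OF hpoly.coord[OF j assms] j]
    show "gauss_exp m (\<lambda>x. x j * (x j * f x)) = gauss_exp m (\<lambda>x. f x + x j * pd j f x)" by simp
  qed
  also have "\<dots> = (\<Sum>j<m. gauss_exp m f + gauss_exp m (\<lambda>x. x j * pd j f x))"
    by (intro sum.cong refl, rule gauss_exp_add[OF assms hpoly.coord[OF _ hpoly_pd[OF assms]]], simp)
  also have "\<dots> = real m * gauss_exp m f + gauss_exp m (\<lambda>x. \<Sum>j<m. x j * pd j f x)"
    by (subst gauss_exp_sum[where d = "Suc (D - 1)"]) (auto simp: sum.distrib intro!: hpoly.coord hpoly_pd[OF assms, unfolded One_nat_def])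
  finally show ?thesis by (simp add: euler[OF assms] gauss_exp_scale distrib_right)
qed

text \<open>Under the expectation a power of |x|^2 is just a number depending on the degree. This
  turns a Laguerre factor into a polynomial in the degree.\<close>

lemma gauss_exp_normsq_power:
  assumes "hpoly m D f"
  shows "gauss_exp m (\<lambda>x. normsq_m m x ^ j * f x) =
    2 ^ j * pochhammer ((real m + real D) / 2) j * gauss_exp m f"
proof (induction j)
  case (Suc j)
  have "gauss_exp m (\<lambda>x. normsq_m m x ^ Suc j * f x) =
    gauss_exp m (\<lambda>x. normsq_m m x * (normsq_m m x ^ j * f x))" by (simp add: mult.assoc)
  also have "\<dots> = (real m + real (j * 2 + D)) * gauss_exp m (\<lambda>x. normsq_m m x ^ j * f x)"
    by (intro gauss_exp_normsq hpoly_mult hpoly_power hpoly_normsq assms)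
  finally show ?case unfolding Suc.IH by (simp add: pochhammer_Suc field_simps)
qed simp

text \<open>The square of t, which unlike t is a polynomial; the Bessel series contains only even
  powers of t. The argument \<open>y\<close> comes first so that \<open>wedge_sq m y\<close> is a
  function of x.\<close>

definition wedge_sq :: "nat \<Rightarrow> (nat \<Rightarrow> real) \<Rightarrow> (nat \<Rightarrow> real) \<Rightarrow> real" where
  "wedge_sq m y x = normsq_m m x * normsq_m m y - (inner_m m x y)\<^sup>2"

lemma hpoly_inner: "hpoly m 1 (\<lambda>x. inner_m m x y)"
  unfolding inner_m_def
  by (intro hpoly_sum) (use hpoly_scale[OF hpoly_var] in \<open>auto simp: mult.commute[of _ "y _"]\<close>)

lemma hpoly_wedge_sq: "hpoly m 2 (wedge_sq m y)"
  unfolding wedge_sq_def[abs_def]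
  using hpoly_diff[OF hpoly_scale[OF hpoly_normsq, of m "normsq_m m y"] hpoly_power[OF hpoly_inner[of m y], of 2, simplified]]
  by (simp add: mult.commute)

lemma hpoly_kernel_term: "hpoly m (a + 2 * n) (\<lambda>x. inner_m m x y ^ a * wedge_sq m y x ^ n)"
  using hpoly_mult[OF hpoly_power[OF hpoly_inner[of m y], of a] hpoly_power[OF hpoly_wedge_sq[of m y], of n]]
  by (simp add: mult.commute)

lemma pd_inner: "j < m \<Longrightarrow> pd j (\<lambda>x. inner_m m x y) = (\<lambda>_. y j)"
proof -
  assume j: "j < m"
  have "pd j (\<lambda>x. inner_m m x y) = (\<lambda>x. \<Sum>i<m. pd j (\<lambda>x. y i * x i) x)"
    unfolding inner_m_def mult.commute[of _ "y _"] by (rule pd_sum, rule hpoly_scale[OF hpoly_var], simp)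
  also have "\<dots> = (\<lambda>x. \<Sum>i<m. if i = j then y i else 0)"
    by (intro ext sum.cong refl) (auto simp: pd_scale[OF hpoly_var] pd_coord)
  finally show ?thesis using j by simp
qed

lemma pd_normsq: "j < m \<Longrightarrow> pd j (normsq_m m) = (\<lambda>x. 2 * x j)"
proof -
  assume j: "j < m"
  have "pd j (normsq_m m) = (\<lambda>x. \<Sum>i<m. pd j (\<lambda>x. (x i)\<^sup>2) x)"
    unfolding normsq_m_def[abs_def] by (rule pd_sum, rule hpoly_power[OF hpoly_var], simp)
  also have "\<dots> = (\<lambda>x. \<Sum>i<m. if i = j then 2 * x i else 0)"
    by (intro ext sum.cong refl) (auto simp: pd_power[OF hpoly_var] pd_coord)
  finally show ?thesis using j by simp
qed

lemma pd_wedge_sq: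
  assumes "j < m"
  shows "pd j (wedge_sq m y) = (\<lambda>x. 2 * (normsq_m m y * x j - inner_m m x y * y j))"
proof -
  have "pd j (wedge_sq m y) = pd j (\<lambda>x. normsq_m m y * normsq_m m x - inner_m m x y ^ 2)"
    by (simp add: wedge_sq_def[abs_def] mult.commute)
  also have "\<dots> = (\<lambda>x. pd j (\<lambda>x. normsq_m m y * normsq_m m x) x - pd j (\<lambda>x. inner_m m x y ^ 2) x)"
    by (rule pd_diff[OF hpoly_scale[OF hpoly_normsq] hpoly_power[OF hpoly_inner]])
  finally show ?thesis
    unfolding pd_scale[OF hpoly_normsq] pd_normsq[OF assms] pd_power[OF hpoly_inner] pd_inner[OF assms]
    by (simp add: fun_eq_iff algebra_simps)
qed

lemma lap_inner: "lap m (\<lambda>x. inner_m m x y) x = 0"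
  by (simp add: lap_def pd_inner)

lemma inner_self: "(\<Sum>j<m. y j * y j) = normsq_m m y"
  by (simp add: normsq_m_def power2_eq_square)

lemma lap_wedge_sq: "lap m (wedge_sq m y) x = 2 * (real m - 1) * normsq_m m y"
proof -
  have "pd j (pd j (wedge_sq m y)) x = 2 * normsq_m m y - 2 * (y j * y j)" if "j < m" for j
  proof -
    have "pd j (wedge_sq m y) = (\<lambda>x. (2 * normsq_m m y) * x j - (2 * y j) * inner_m m x y)"
      by (simp add: pd_wedge_sq[OF that] fun_eq_iff algebra_simps)
    thus ?thesis
      by (simp only: pd_diff[OF hpoly_scale[OF hpoly_var[OF that]] hpoly_scale[OF hpoly_inner]]
        pd_scale[OF hpoly_var[OF that]] pd_coord pd_scale[OF hpoly_inner] pd_inner[OF that]) simp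
  qed
  hence "lap m (wedge_sq m y) x = (\<Sum>j<m. 2 * normsq_m m y - 2 * (y j * y j))"
    by (simp add: lap_def)
  thus ?thesis
    unfolding sum_subtractf sum_distrib_left[symmetric] inner_self by (simp add: algebra_simps)
qed

text \<open>The gradient of t^2 is 2 (|y|^2 x - s y), a multiple of the component of x orthogonal to
  y, whereas the gradient of s is y. Hence the mixed term in the Laplacian of a product
  vanishes.\<close>

lemma grad_inner_wedge_sq: "(\<Sum>j<m. y j * pd j (wedge_sq m y) x) = 0"
proof -
  have "(\<Sum>j<m. y j * pd j (wedge_sq m y) x) =
     2 * (normsq_m m y * (\<Sum>j<m. x j * y j) - inner_m m x y * (\<Sum>j<m. y j * y j))"
    unfolding sum_distrib_left sum_subtractf[symmetric]
    by (intro sum.cong) (auto simp: pd_wedge_sq algebra_simps)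
  thus ?thesis by (simp add: inner_self inner_m_def)
qed

lemma grad_wedge_sq: "(\<Sum>j<m. (pd j (wedge_sq m y) x)\<^sup>2) = 4 * normsq_m m y * wedge_sq m y x"
proof -
  let ?Y = "normsq_m m y" and ?s = "inner_m m x y"
  have "(\<Sum>j<m. (pd j (wedge_sq m y) x)\<^sup>2) = (\<Sum>j<m. 4 * ?Y\<^sup>2 * (x j * x j) - 8 * ?Y * ?s * (x j * y j) + 4 * ?s\<^sup>2 * (y j * y j))"
    by (intro sum.cong) (auto simp: pd_wedge_sq power2_eq_square algebra_simps)
  also have "\<dots> = 4 * ?Y\<^sup>2 * normsq_m m x - 8 * ?Y * ?s * ?s + 4 * ?s\<^sup>2 * ?Y"
    by (simp only: sum.distrib sum_subtractf sum_distrib_left[symmetric] inner_self)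
       (simp only: inner_m_def)
  finally show ?thesis by (simp add: wedge_sq_def power2_eq_square algebra_simps)
qed

text \<open>Up to scaling by |y|, s is the coordinate along y and t is the radius in the orthogonal
  complement, of dimension m - 1. So the first term is a second derivative in s and the second is
  the radial Laplacian of t^(2 n) in m - 1 dimensions.\<close>

lemma lap_kernel_term:
  "lap m (\<lambda>x. inner_m m x y ^ a * wedge_sq m y x ^ n) x = normsq_m m y *
    (real a * real (a - 1) * (inner_m m x y ^ (a - 2) * wedge_sq m y x ^ n)
      + 2 * real n * (2 * real n + real m - 3) * (inner_m m x y ^ a * wedge_sq m y x ^ (n - 1)))"
proof -
  let ?Y = "normsq_m m y" and ?s = "inner_m m x y" and ?t = "wedge_sq m y x"
  have s2: "(\<Sum>j<m. (pd j (\<lambda>x. inner_m m x y) x)\<^sup>2) = ?Y"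
    unfolding inner_self[symmetric] by (intro sum.cong) (auto simp: pd_inner power2_eq_square)
  have cross: "(\<Sum>j<m. pd j (\<lambda>x. inner_m m x y ^ a) x * pd j (\<lambda>x. wedge_sq m y x ^ n) x) = 0"
  proof -
    have "(\<Sum>j<m. pd j (\<lambda>x. inner_m m x y ^ a) x * pd j (\<lambda>x. wedge_sq m y x ^ n) x) =
      real a * ?s ^ (a - 1) * (real n * ?t ^ (n - 1)) * (\<Sum>j<m. y j * pd j (wedge_sq m y) x)"
      unfolding sum_distrib_left
      by (intro sum.cong) (auto simp: pd_power[OF hpoly_inner] pd_power[OF hpoly_wedge_sq] pd_inner)
    thus ?thesis by (simp add: grad_inner_wedge_sq)
  qed
  have t: "lap m (\<lambda>x. wedge_sq m y x ^ n) x = ?Y * (2 * real n * (2 * real n + real m - 3) * ?t ^ (n - 1))"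
  proof -
    consider "n = 0" | "n = 1" | k where "n = Suc (Suc k)"
      by (metis One_nat_def not0_implies_Suc)
    thus ?thesis
      unfolding lap_power[OF hpoly_wedge_sq] lap_wedge_sq grad_wedge_sq
      by cases (auto simp: algebra_simps)
  qed
  show ?thesis
    unfolding lap_mult[OF hpoly_power[OF hpoly_inner] hpoly_power[OF hpoly_wedge_sq]] cross t
      lap_power[OF hpoly_inner] lap_inner s2
    by (simp add: algebra_simps)
qed

text \<open>The bivector coordinates behave like two additional dimensions.\<close>

lemma lap_bivector_kernel_term:
  fixes y :: "nat \<Rightarrow> real"
  assumes "j < m" "k < m"
  defines "b \<equiv> \<lambda>x :: nat \<Rightarrow> real. x j * y k - x k * y j"
  shows "lap m (\<lambda>x. b x * (inner_m m x y ^ a * wedge_sq m y x ^ n)) x = normsq_m m y *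
    (real a * real (a - 1) * (b x * (inner_m m x y ^ (a - 2) * wedge_sq m y x ^ n))
      + 2 * real n * (2 * real n + real (m + 2) - 3) * (b x * (inner_m m x y ^ a * wedge_sq m y x ^ (n - 1))))"
proof -
  let ?Y = "normsq_m m y" and ?s = "inner_m m x y" and ?t = "wedge_sq m y x"
  have b: "b = (\<lambda>x. y k * x j - y j * x k)" by (simp add: b_def mult.commute)
  have hj: "hpoly m 1 (\<lambda>x. y k * x j)" and hk: "hpoly m 1 (\<lambda>x. y j * x k)"
    using hpoly_scale[OF hpoly_var[OF assms(1)]] hpoly_scale[OF hpoly_var[OF assms(2)]] by auto
  have hb: "hpoly m 1 b" unfolding b by (rule hpoly_diff[OF hj hk])
  have pb: "pd i b x = (if i = j then y k else 0) - (if i = k then y j else 0)" for i x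
    unfolding b pd_diff[OF hj hk] pd_scale[OF hpoly_var[OF assms(1)]] pd_scale[OF hpoly_var[OF assms(2)]]
    by (auto simp: pd_coord)
  have lb: "lap m b x = 0" using lap_hpoly_le_1[OF hb] by simp
  have sumb: "(\<Sum>i<m. pd i b x * c i) = y k * c j - y j * c k" for c
  proof -
    have "(\<Sum>i<m. pd i b x * c i) = (\<Sum>i<m. (if i = j then y k * c i else 0) - (if i = k then y j * c i else 0))"
      unfolding pb by (intro sum.cong) (auto simp: algebra_simps)
    thus ?thesis using assms by (simp add: sum_subtractf)
  qed
  have g: "pd i (\<lambda>x. inner_m m x y ^ a * wedge_sq m y x ^ n) x =
     real a * ?s ^ (a - 1) * y i * ?t ^ n + ?s ^ a * (real n * ?t ^ (n - 1) * (2 * (?Y * x i - ?s * y i)))"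
    if "i < m" for i
    by (simp add: pd_mult[OF hpoly_power[OF hpoly_inner] hpoly_power[OF hpoly_wedge_sq]]
      pd_power[OF hpoly_inner] pd_power[OF hpoly_wedge_sq] pd_inner[OF that] pd_wedge_sq[OF that])
  show ?thesis
    unfolding lap_mult[OF hb hpoly_kernel_term] lb sumb g[OF assms(1)] g[OF assms(2)] lap_kernel_term
    by (simp add: b_def algebra_simps)
qed

section \<open>Pairings in the lowest degree\<close>

lemma hpoly_0_const: "hpoly m 0 f \<Longrightarrow> \<exists>c. f = (\<lambda>_. c)"
  by (induction "0 :: nat" f rule: hpoly.induct) auto

text \<open>The reproducing property of s^d on harmonic polynomials, and its derivative. The two
  claims feed each other: the first in degree d + 1 follows from the second for d by Euler's
  identity, and the second for d + 1 follows by Stein's identity from the first applied to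
  \<open>pd j H\<close>.\<close>

lemma gauss_exp_inner_power:
  "harmonic_poly m d H \<Longrightarrow> gauss_exp m (\<lambda>x. inner_m m x y ^ d * H x) = fact d * H y"
  "harmonic_poly m (Suc d) H \<Longrightarrow> j < m \<Longrightarrow>
     gauss_exp m (\<lambda>x. x j * (inner_m m x y ^ d * H x)) = fact d * pd j H y"
proof (induction d arbitrary: H j)
  case 0
  {
    case 1
    then obtain c where "H = (\<lambda>_. c)" using hpoly_0_const harmonic_hpoly by blast
    thus ?case by (simp add: gauss_exp_const)
  next
    case 2
    obtain c where c: "pd j H = (\<lambda>_. c)"
      using hpoly_0_const hpoly_pd_Suc[OF harmonic_hpoly[OF 2(1)]] by blast
    show ?case using stein[OF harmonic_hpoly[OF 2(1)] 2(2)] by (simp add: c gauss_exp_const)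
  }
next
  case (Suc d)
  have *: "gauss_exp m (\<lambda>x. inner_m m x y ^ Suc d * H x) = fact (Suc d) * H y"
    if H: "harmonic_poly m (Suc d) H" for H
  proof -
    have "gauss_exp m (\<lambda>x. inner_m m x y ^ Suc d * H x) =
      gauss_exp m (\<lambda>x. \<Sum>j<m. y j * (x j * (inner_m m x y ^ d * H x)))"
      by (simp add: inner_m_def sum_distrib_left sum_distrib_right mult_ac)
    also have "\<dots> = (\<Sum>j<m. gauss_exp m (\<lambda>x. y j * (x j * (inner_m m x y ^ d * H x))))"
      by (rule gauss_exp_sum, rule hpoly_scale[OF hpoly.coord[OF _ hpoly_mult[OF
        hpoly_power[OF hpoly_inner] harmonic_hpoly[OF H]]]]) simp
    also have "\<dots> = (\<Sum>j<m. fact d * (y j * pd j H y))"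
      by (intro sum.cong refl) (simp add: gauss_exp_scale Suc.IH(2)[OF H])
    finally show ?thesis
      unfolding sum_distrib_left[symmetric] euler[OF harmonic_hpoly[OF H]] by simp
  qed
  {
    case 1 thus ?case by (rule *)
  next
    case 2
    note H = harmonic_hpoly[OF 2(1)]
    have hs: "hpoly m (Suc d) (\<lambda>x. inner_m m x y ^ Suc d)"
      using hpoly_power[OF hpoly_inner[of m y], of "Suc d"] by simp
    have hs': "hpoly m d (\<lambda>x. inner_m m x y ^ d)"
      using hpoly_power[OF hpoly_inner[of m y], of d] by simp
    have "gauss_exp m (\<lambda>x. x j * (inner_m m x y ^ Suc d * H x)) =
      gauss_exp m (pd j (\<lambda>x. inner_m m x y ^ Suc d * H x))"
      by (rule stein[OF hpoly_mult[OF hs H] 2(2)])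
    also have "pd j (\<lambda>x. inner_m m x y ^ Suc d * H x) =
      (\<lambda>x. (real (Suc d) * y j) * (inner_m m x y ^ d * H x) + inner_m m x y ^ Suc d * pd j H x)"
      unfolding pd_mult[OF hs H] pd_power[OF hpoly_inner] pd_inner[OF 2(2)]
      by (simp add: fun_eq_iff algebra_simps)
    also have "gauss_exp m \<dots> = gauss_exp m (\<lambda>x. (real (Suc d) * y j) * (inner_m m x y ^ d * H x))
       + gauss_exp m (\<lambda>x. inner_m m x y ^ Suc d * pd j H x)"
      by (rule gauss_exp_add[OF hpoly_scale[OF hpoly_mult[OF hs' H]] hpoly_mult[OF hs hpoly_pd[OF H]]])
    \<comment> \<open>The power of s left here has degree d, two below the degree of
      \<open>H\<close>.\<close>
    also have "gauss_exp m (\<lambda>x. (real (Suc d) * y j) * (inner_m m x y ^ d * H x)) = 0"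
      unfolding gauss_exp_scale using gauss_exp_harmonic_low[OF hs' 2(1)] by simp
    also have "gauss_exp m (\<lambda>x. inner_m m x y ^ Suc d * pd j H x) = fact (Suc d) * pd j H y"
      by (rule *[OF harmonic_pd[OF 2(1)]])
    finally show ?case by simp
  }
qed

text \<open>When the degrees match, t^2 may be replaced by -s^2: the part |x|^2 |y|^2 of t^2 becomes
  a number by \<open>gauss_exp_normsq\<close>, and what is left has degree d - 2 and pairs to zero.
  The free factor \<open>Q\<close> collects the powers of s during the induction.\<close>

lemma gauss_exp_wedge_sq_top:
  assumes "hpoly m e Q" "harmonic_poly m d H" "e + 2 * n = d"
  shows "gauss_exp m (\<lambda>x. Q x * wedge_sq m y x ^ n * H x) =
    (-1) ^ n * gauss_exp m (\<lambda>x. Q x * inner_m m x y ^ (2 * n) * H x)"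
  using assms(1,3)
proof (induction n arbitrary: e Q)
  case (Suc n)
  note H = harmonic_hpoly[OF assms(2)]
  let ?P = "\<lambda>x. Q x * wedge_sq m y x ^ n" and ?Q = "\<lambda>x. inner_m m x y ^ 2 * Q x"
  have P: "hpoly m (e + n * 2) ?P" by (intro hpoly_mult Suc.prems hpoly_power hpoly_wedge_sq)
  have Q: "hpoly m (2 * 1 + e) ?Q" by (intro hpoly_mult Suc.prems hpoly_power hpoly_inner)
  have "gauss_exp m (\<lambda>x. Q x * wedge_sq m y x ^ Suc n * H x) = gauss_exp m (\<lambda>x.
     normsq_m m y * (normsq_m m x * (?P x * H x)) + (-1) * (?Q x * wedge_sq m y x ^ n * H x))"
    by (rule arg_cong[of _ _ "gauss_exp m"]) (simp add: fun_eq_iff wedge_sq_def algebra_simps)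
  also have "\<dots> = gauss_exp m (\<lambda>x. normsq_m m y * (normsq_m m x * (?P x * H x)))
     + gauss_exp m (\<lambda>x. (-1) * (?Q x * wedge_sq m y x ^ n * H x))"
    by (rule gauss_exp_add[OF hpoly_scale[OF hpoly_mult[OF hpoly_normsq hpoly_mult[OF P H]]]
      hpoly_scale[OF hpoly_mult[OF hpoly_mult[OF Q hpoly_power[OF hpoly_wedge_sq]] H]]])
  also have "gauss_exp m (\<lambda>x. normsq_m m y * (normsq_m m x * (?P x * H x))) = 0"
    unfolding gauss_exp_scale gauss_exp_normsq[OF hpoly_mult[OF P H]]
    using gauss_exp_harmonic_low[OF P assms(2)] Suc.prems by simp
  also have "gauss_exp m (\<lambda>x. (-1) * (?Q x * wedge_sq m y x ^ n * H x)) =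
     - ((-1) ^ n * gauss_exp m (\<lambda>x. ?Q x * inner_m m x y ^ (2 * n) * H x))"
    unfolding gauss_exp_scale using Suc.IH[OF Q] Suc.prems by simp
  finally show ?case by (simp add: mult_ac power2_eq_square)
qed simp

section \<open>Binomial sums and Laguerre polynomials\<close>

text \<open>After multiplication by \<open>pochhammer c r\<close>, the reciprocal of
  \<open>fact (r - q) * pochhammer c q\<close> is the binomial coefficient of r + c - 1 over r - q,
  so the sum is a Vandermonde convolution.\<close>

lemma sum_choose_div_pochhammer:
  fixes c :: real assumes "c > 0"
  shows "(\<Sum>q\<le>r. real (h choose q) / (fact (r - q) * pochhammer c q)) =
    pochhammer (c + real h) r / (fact r * pochhammer c r)"
proof -
  have pos: "pochhammer c n > 0" for n using assms by (rule pochhammer_pos)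
  have "(\<Sum>q\<le>r. real (h choose q) / (fact (r - q) * pochhammer c q)) =
    (\<Sum>q\<le>r. (real h gchoose q) * ((real r + c - 1) gchoose (r - q)) / pochhammer c r)"
  proof (intro sum.cong refl)
    fix q assume "q \<in> {..r}"
    hence q: "q \<le> r" by simp
    have "(real r + c - 1) gchoose (r - q) = pochhammer (c + real q) (r - q) / fact (r - q)"
      using q by (simp add: gbinomial_pochhammer' of_nat_diff algebra_simps)
    moreover have "pochhammer c r = pochhammer c q * pochhammer (c + real q) (r - q)"
      using q by (rule pochhammer_product)
    moreover have "pochhammer (c + real q) (r - q) > 0" using assms by (intro pochhammer_pos) auto
    ultimately show "real (h choose q) / (fact (r - q) * pochhammer c q) =
      (real h gchoose q) * ((real r + c - 1) gchoose (r - q)) / pochhammer c r"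
      using pos[of q] by (simp add: binomial_gbinomial)
  qed
  also have "\<dots> = ((real h + (real r + c - 1)) gchoose r) / pochhammer c r"
    by (simp only: sum_divide_distrib[symmetric] gbinomial_Vandermonde[unfolded atLeast0AtMost])
  also have "(real h + (real r + c - 1)) gchoose r = pochhammer (c + real h) r / fact r"
    by (simp add: gbinomial_pochhammer' algebra_simps)
  finally show ?thesis by simp
qed

text \<open>The symmetric form makes the reflection \<open>N \<mapsto> - a - 1 - N\<close> below evident.\<close>

lemma sum_gbinomial_two_power:
  fixes a N :: real
  shows "(\<Sum>j\<le>p. ((real p + a) gchoose (p - j)) * 2 ^ j * (N gchoose j)) =
    (\<Sum>i\<le>p. (-1) ^ (p - i) * (N gchoose i) * ((- a - 1 - N) gchoose (p - i)))"
proof -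
  let ?b = "real p + a"
  \<comment> \<open>Writing 2^j as a row sum of binomials and exchanging the sums leaves an inner
    Vandermonde convolution; upper negation then produces - a - 1 - N.\<close>
  have two: "2 ^ j * (N gchoose j) = (\<Sum>i\<le>j. (N gchoose i) * ((N - real i) gchoose (j - i)))" for j
  proof -
    have "(\<Sum>i\<le>j. real (j choose i)) = 2 ^ j"
      using choose_row_sum[of j] by (metis of_nat_sum of_nat_numeral of_nat_power)
    hence "2 ^ j * (N gchoose j) = (\<Sum>i\<le>j. (N gchoose j) * (real j gchoose i))"
      by (simp add: binomial_gbinomial sum_distrib_left[symmetric] mult.commute)
    also have "\<dots> = (\<Sum>i\<le>j. (N gchoose i) * ((N - real i) gchoose (j - i)))"
      by (intro sum.cong refl gbinomial_trinomial_revision) simp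
    finally show ?thesis .
  qed
  have "(\<Sum>j\<le>p. (?b gchoose (p - j)) * 2 ^ j * (N gchoose j)) =
    (\<Sum>j\<le>p. \<Sum>i\<le>j. (?b gchoose (p - j)) * ((N gchoose i) * ((N - real i) gchoose (j - i))))"
    by (simp add: mult.assoc two sum_distrib_left)
  also have "\<dots> = (\<Sum>i\<le>p. \<Sum>j=i..p. (?b gchoose (p - j)) * ((N gchoose i) * ((N - real i) gchoose (j - i))))"
    by (simp add: sum.Sigma) (rule sum.reindex_bij_witness[of _ prod.swap prod.swap]; auto)
  also have "\<dots> = (\<Sum>i\<le>p. (N gchoose i) * ((N - real i + ?b) gchoose (p - i)))"
  proof (intro sum.cong refl)
    fix i assume "i \<in> {..p}"
    hence i: "i \<le> p" by simp
    have "(\<Sum>j=i..p. (?b gchoose (p - j)) * ((N gchoose i) * ((N - real i) gchoose (j - i)))) =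
      (\<Sum>k=0..p - i. (N gchoose i) * (((N - real i) gchoose k) * (?b gchoose (p - i - k))))"
      using i by (intro sum.reindex_bij_witness[of _ "\<lambda>k. k + i" "\<lambda>j. j - i"]) auto
    thus "(\<Sum>j=i..p. (?b gchoose (p - j)) * ((N gchoose i) * ((N - real i) gchoose (j - i)))) =
      (N gchoose i) * ((N - real i + ?b) gchoose (p - i))"
      by (simp only: sum_distrib_left[symmetric] gbinomial_Vandermonde)
  qed
  also have "\<dots> = (\<Sum>i\<le>p. (-1) ^ (p - i) * (N gchoose i) * ((- a - 1 - N) gchoose (p - i)))"
  proof (intro sum.cong refl)
    fix i assume "i \<in> {..p}"
    hence "real (p - i) - (N - real i + ?b) - 1 = - a - 1 - N" by (simp add: of_nat_diff)
    hence "(N - real i + ?b) gchoose (p - i) = (-1) ^ (p - i) * ((- a - 1 - N) gchoose (p - i))"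
      by (subst gbinomial_negated_upper) (simp only:)
    thus "(N gchoose i) * ((N - real i + ?b) gchoose (p - i)) =
      (-1) ^ (p - i) * (N gchoose i) * ((- a - 1 - N) gchoose (p - i))" by (simp only: mult_ac)
  qed
  finally show ?thesis .
qed

text \<open>In the symmetric form the reflection only swaps the two binomials, which reversing the
  summation index undoes up to the sign (-1)^p.\<close>

lemma sum_gbinomial_reflect:
  fixes a N :: real
  shows "(\<Sum>j\<le>p. ((real p + a) gchoose (p - j)) * 2 ^ j * ((- a - 1 - N) gchoose j)) =
    (-1) ^ p * (\<Sum>j\<le>p. ((real p + a) gchoose (p - j)) * 2 ^ j * (N gchoose j))"
proof -
  have "(\<Sum>i\<le>p. (-1) ^ (p - i) * ((- a - 1 - N) gchoose i) * (N gchoose (p - i))) =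
    (\<Sum>i\<le>p. (-1) ^ i * ((- a - 1 - N) gchoose (p - i)) * (N gchoose i))"
    by (intro sum.reindex_bij_witness[of _ "\<lambda>i. p - i" "\<lambda>i. p - i"]) auto
  also have "\<dots> = (\<Sum>i\<le>p. (-1) ^ p * ((-1) ^ (p - i) * (N gchoose i) * ((- a - 1 - N) gchoose (p - i))))"
  proof (intro sum.cong refl)
    fix i assume "i \<in> {..p}"
    hence "(-1 :: real) ^ p * (-1) ^ (p - i) = (-1) ^ i"
      by (simp add: power_add[symmetric] minus_one_power_iff)
    thus "(-1) ^ i * ((- a - 1 - N) gchoose (p - i)) * (N gchoose i) =
      (-1) ^ p * ((-1) ^ (p - i) * (N gchoose i) * ((- a - 1 - N) gchoose (p - i)))"
      by (simp add: mult_ac)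
  qed
  finally show ?thesis
    by (simp only: sum_gbinomial_two_power sum_distrib_left) (simp add: algebra_simps)
qed

section \<open>Laguerre polynomials against the exponential series\<close>

definition laguerre_coeff :: "nat \<Rightarrow> real \<Rightarrow> nat \<Rightarrow> real" where
  "laguerre_coeff p a j = (-1) ^ j * ((real p + a) gchoose (p - j)) / fact j"

lemma laguerre_altdef: "laguerre p a x = (\<Sum>j\<le>p. laguerre_coeff p a j * x ^ j)"
  by (simp add: laguerre_def laguerre_coeff_def)

lemma binomial_exp_sums:
  fixes u :: real
  shows "(\<lambda>N. real (N choose j) * (u ^ N / fact N)) sums (u ^ j / fact j * exp u)"
proof -
  have "(\<lambda>n. u ^ n /\<^sub>R fact n) sums exp u" by (rule exp_converges)
  hence "(\<lambda>n. u ^ j / fact j * (u ^ n / fact n)) sums (u ^ j / fact j * exp u)"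
    by (intro sums_mult) (simp add: divide_inverse mult.commute)
  moreover have "real (n + j choose j) * (u ^ (n + j) / fact (n + j)) = u ^ j / fact j * (u ^ n / fact n)" for n
    by (simp add: binomial_fact power_add field_simps)
  ultimately have "(\<lambda>n. real (n + j choose j) * (u ^ (n + j) / fact (n + j))) sums (u ^ j / fact j * exp u)"
    by simp
  thus ?thesis by (subst (asm) sums_iff_shift) (simp add: binomial_eq_0)
qed

text \<open>Up to sign and \<open>fact j\<close>, the rising factorial of a + 1 + N is the binomial
  coefficient of - a - 1 - N. Reflection turns it into N over j, and summing that against the
  exponential series gives (- Y / 2)^j; the powers of 2 cancel and the Laguerre polynomial
  reappears. This is the source of the eigenvalue factor (-1)^p.\<close>

lemma laguerre_reflection_sums:
  "(\<lambda>N. (\<Sum>j\<le>p. laguerre_coeff p a j * (2 ^ j * pochhammer (a + 1 + real N) j)) * ((- Y / 2) ^ N / fact N))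
     sums ((-1) ^ p * laguerre p a Y * exp (- Y / 2))"
proof -
  have eq: "(\<Sum>j\<le>p. laguerre_coeff p a j * (2 ^ j * pochhammer (a + 1 + real N) j)) =
     (-1) ^ p * (\<Sum>j\<le>p. ((real p + a) gchoose (p - j)) * 2 ^ j * real (N choose j))" for N
  proof -
    have "(\<Sum>j\<le>p. laguerre_coeff p a j * (2 ^ j * pochhammer (a + 1 + real N) j)) =
      (\<Sum>j\<le>p. ((real p + a) gchoose (p - j)) * 2 ^ j * ((- a - 1 - real N) gchoose j))"
      by (intro sum.cong refl)
        (simp add: laguerre_coeff_def gbinomial_pochhammer[of "- a - 1 - real N"],
         auto simp: algebra_simps)
    thus ?thesis by (simp add: sum_gbinomial_reflect binomial_gbinomial)
  qed
  have "(\<lambda>N. \<Sum>j\<le>p. ((real p + a) gchoose (p - j)) * 2 ^ j * (real (N choose j) * ((- Y / 2) ^ N / fact N)))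
    sums (\<Sum>j\<le>p. ((real p + a) gchoose (p - j)) * 2 ^ j * ((- Y / 2) ^ j / fact j * exp (- Y / 2)))"
    by (intro sums_sum sums_mult binomial_exp_sums)
  moreover have "(- Y / 2) ^ j * 2 ^ j = (-1) ^ j * Y ^ j" for j
    by (simp add: power_mult_distrib[symmetric])
  hence "(\<Sum>j\<le>p. ((real p + a) gchoose (p - j)) * 2 ^ j * ((- Y / 2) ^ j / fact j * exp (- Y / 2)))
     = laguerre p a Y * exp (- Y / 2)"
    unfolding laguerre_def sum_distrib_right
    by (intro sum.cong refl) (simp add: mult_ac)
  ultimately have "(\<lambda>N. \<Sum>j\<le>p. ((real p + a) gchoose (p - j)) * 2 ^ j * (real (N choose j) * ((- Y / 2) ^ N / fact N)))
    sums (laguerre p a Y * exp (- Y / 2))" by simp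
  from sums_mult[OF this, of "(-1) ^ p"] show ?thesis
    unfolding eq by (simp only: sum_distrib_right mult.assoc)
qed

text \<open>The coefficient of \<open>s ^ (\<epsilon> + 2 q) t ^ (2 n)\<close> in the kernel of index \<open>2 h + \<epsilon>\<close>
  in dimension \<open>\<mu>\<close>, without the factor \<open>sqrt (pi / 2)\<close>.\<close>

definition kcoeff :: "real \<Rightarrow> nat \<Rightarrow> nat \<Rightarrow> nat \<Rightarrow> nat \<Rightarrow> real" where
  "kcoeff \<mu> \<epsilon> h q n = (if q \<le> h then
     fact (2 * h + \<epsilon>) * 2 powr (- (\<mu> - 3) / 2) * (-1) ^ n
       * rGamma (real n + (\<mu> - 3) / 2 - real (h - q) + 1)
       / (4 ^ n * fact (h - q) * fact n * fact (\<epsilon> + 2 * q)) else 0)"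

text \<open>Comparison of coefficients in the eigenvalue equation of the Laplacian, with the common
  factor |y|^2 removed: the two summands come from the two terms of
  \<open>lap_kernel_term\<close>.\<close>

lemma kcoeff_rec:
  "kcoeff \<mu> \<epsilon> h (Suc q) n * ((real \<epsilon> + 2 * real q + 2) * (real \<epsilon> + 2 * real q + 1))
    + kcoeff \<mu> \<epsilon> h q (Suc n) * (2 * real (Suc n) * (2 * real (Suc n) + \<mu> - 3))
   = - kcoeff \<mu> \<epsilon> h q n"
proof (cases "q \<le> h")
  case False thus ?thesis by (simp add: kcoeff_def)
next
  case q: True
  \<comment> \<open>Raising either n or q by one raises the argument of \<open>rGamma\<close> from z
    to z + 1, so by \<open>rGamma z = z * rGamma (z + 1)\<close> all three coefficients are
    multiples of \<open>rGamma (z + 1)\<close>.\<close>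
  define z where "z = real n + (\<mu> - 3) / 2 - real (h - q) + 1"
  define K where "K = fact (2 * h + \<epsilon>) * 2 powr (- (\<mu> - 3) / 2) * (-1) ^ n / (4 ^ n * fact (h - q) * fact n * fact (\<epsilon> + 2 * q))"
  have z: "real (Suc n) + (\<mu> - 3) / 2 - real (h - q) + 1 = z + 1" by (simp add: z_def)
  have A: "kcoeff \<mu> \<epsilon> h q n = K * (z * rGamma (z + 1))"
    unfolding rGamma_plus1 using q by (simp add: kcoeff_def K_def z_def)
  have B: "kcoeff \<mu> \<epsilon> h q (Suc n) * (2 * real (Suc n) * (2 * real (Suc n) + \<mu> - 3)) =
    - K * ((2 * real n + \<mu> - 1) / 2) * rGamma (z + 1)"
  proof -
    have "kcoeff \<mu> \<epsilon> h q (Suc n) * (4 * real (Suc n)) = - K * rGamma (z + 1)"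
      using q unfolding kcoeff_def z K_def power_Suc fact_Suc
      by (simp add: divide_simps del: of_nat_Suc)
    hence "kcoeff \<mu> \<epsilon> h q (Suc n) * (4 * real (Suc n)) * ((2 * real (Suc n) + \<mu> - 3) / 2) =
       - K * rGamma (z + 1) * ((2 * real (Suc n) + \<mu> - 3) / 2)" by simp
    moreover have "a * (2 * S * w) = a * (4 * S) * (w / 2)" for a S w :: real by simp
    ultimately show ?thesis by (simp only:) (simp add: field_simps)
  qed
  have C: "kcoeff \<mu> \<epsilon> h (Suc q) n * ((real \<epsilon> + 2 * real q + 2) * (real \<epsilon> + 2 * real q + 1)) =
    K * real (h - q) * rGamma (z + 1)"
  proof (cases "q = h")
    case True thus ?thesis by (simp add: kcoeff_def)
  next
    case False
    then obtain d where d: "h - q = Suc d" "h - Suc q = d" "Suc q \<le> h" using q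
      by (metis Suc_diff_Suc diff_Suc_Suc le_neq_implies_less Suc_leI)
    have "real n + (\<mu> - 3) / 2 - real d + 1 = z + 1" by (simp add: z_def d)
    moreover have "fact (\<epsilon> + 2 * Suc q) = (real \<epsilon> + 2 * real q + 2) * (real \<epsilon> + 2 * real q + 1) * (fact (\<epsilon> + 2 * q) :: real)"
      by (simp add: algebra_simps)
    moreover have "(real \<epsilon> + 2 * real q + 2) * (real \<epsilon> + 2 * real q + 1) > 0"
      by (intro mult_pos_pos) auto
    ultimately show ?thesis
      using d(3) unfolding kcoeff_def K_def d by (simp add: divide_simps) (simp add: mult_ac add_divide_distrib add.commute)
  qed
  have "K * real (h - q) * rGamma (z + 1) + - K * ((2 * real n + \<mu> - 1) / 2) * rGamma (z + 1)
     = - (K * (z * rGamma (z + 1)))"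
    by (simp add: z_def field_simps)
  thus ?thesis unfolding A B C .
qed

text \<open>A duplication formula covering both parities, so that even and odd kernel indices share
  one computation.\<close>

lemma fact_double:
  assumes "\<epsilon> \<le> 1"
  shows "fact (2 * n + \<epsilon>) = (4 ^ n * fact n * pochhammer (real \<epsilon> + 1 / 2) n :: real)"
proof (induction n)
  case 0 show ?case using assms by (cases \<epsilon>) auto
next
  case (Suc n)
  have "fact (2 * Suc n + \<epsilon>) = (2 * real n + \<epsilon> + 2) * (2 * real n + \<epsilon> + 1) * (fact (2 * n + \<epsilon>) :: real)"
    by (simp add: algebra_simps)
  also have "(2 * real n + \<epsilon> + 2) * (2 * real n + \<epsilon> + 1) = 4 * (real n + 1) * (real \<epsilon> + 1 / 2 + real n)"
    using assms by (cases \<epsilon>) (auto simp: algebra_simps)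
  finally show ?case unfolding Suc.IH by (simp add: pochhammer_Suc algebra_simps)
qed

text \<open>\<open>T q n\<close> stands for the pairing of \<open>s ^ (\<epsilon> + 2 q) t ^ (2 n)\<close> with a harmonic polynomial of
  degree \<open>2 r0 + \<epsilon>\<close>, and \<open>Y\<close> for the squared norm of the second variable.\<close>

locale harmonic_pairing =
  fixes \<mu> Y \<tau> :: real and \<epsilon> h r0 :: nat and T :: "nat \<Rightarrow> nat \<Rightarrow> real"
  assumes eps: "\<epsilon> \<le> 1"
    and T_rec: "2 * (real q + real n - real r0) * T q n = Y *
      ((real \<epsilon> + 2 * real q) * (real \<epsilon> + 2 * real q - 1) * T (q - 1) n
       + 2 * real n * (2 * real n + \<mu> - 3) * T q (n - 1))"
    and T_low: "q + n < r0 \<Longrightarrow> T q n = 0"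
    and T_top: "q + n = r0 \<Longrightarrow> T q n = (-1) ^ n * fact (2 * r0 + \<epsilon>) * \<tau>"
begin

text \<open>The pairing with the part of the kernel of degree \<open>\<epsilon> + 2 r\<close> in x,
  again without the factor sqrt (pi / 2).\<close>

definition X :: "nat \<Rightarrow> real" where
  "X r = (\<Sum>q\<le>r. kcoeff \<mu> \<epsilon> h q (r - q) * T q (r - q))"

lemma X_low: "r < r0 \<Longrightarrow> X r = 0"
  unfolding X_def by (intro sum.neutral) (auto simp: T_low)

text \<open>\<open>T_rec\<close> lowers either q or n by one. Shifting the summation index back
  collects, for each pair (q, n) with q + n = r, exactly the left-hand side of
  \<open>kcoeff_rec\<close>.\<close>

lemma X_rec: "2 * (real (Suc r) - real r0) * X (Suc r) = - Y * X r"
proof -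
  have "2 * (real (Suc r) - real r0) * X (Suc r) =
    (\<Sum>q\<le>Suc r. kcoeff \<mu> \<epsilon> h q (Suc r - q) * (2 * (real q + real (Suc r - q) - real r0) * T q (Suc r - q)))"
    unfolding X_def sum_distrib_left by (intro sum.cong refl) (simp add: of_nat_diff algebra_simps)
  also have "\<dots> = Y * ((\<Sum>q\<le>Suc r. kcoeff \<mu> \<epsilon> h q (Suc r - q) * ((real \<epsilon> + 2 * real q) * (real \<epsilon> + 2 * real q - 1)) * T (q - 1) (Suc r - q))
     + (\<Sum>q\<le>Suc r. kcoeff \<mu> \<epsilon> h q (Suc r - q) * (2 * real (Suc r - q) * (2 * real (Suc r - q) + \<mu> - 3)) * T q (Suc r - q - 1)))"
    unfolding T_rec sum_distrib_left sum.distrib[symmetric] distrib_left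
    by (intro sum.cong refl) (simp add: algebra_simps)
  also have "(\<Sum>q\<le>Suc r. kcoeff \<mu> \<epsilon> h q (Suc r - q) * ((real \<epsilon> + 2 * real q) * (real \<epsilon> + 2 * real q - 1)) * T (q - 1) (Suc r - q))
     = (\<Sum>q\<le>r. kcoeff \<mu> \<epsilon> h (Suc q) (r - q) * ((real \<epsilon> + 2 * real q + 2) * (real \<epsilon> + 2 * real q + 1)) * T q (r - q))"
  proof -
    \<comment> \<open>The summand q = 0 has no predecessor; it carries this factor and drops
      out.\<close>
    have "real \<epsilon> * (real \<epsilon> - 1) = 0" using eps by (cases \<epsilon>) auto
    thus ?thesis by (subst sum.atMost_Suc_shift) (auto simp: algebra_simps)
  qed
  also have "(\<Sum>q\<le>Suc r. kcoeff \<mu> \<epsilon> h q (Suc r - q) * (2 * real (Suc r - q) * (2 * real (Suc r - q) + \<mu> - 3)) * T q (Suc r - q - 1))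
     = (\<Sum>q\<le>r. kcoeff \<mu> \<epsilon> h q (Suc (r - q)) * (2 * real (Suc (r - q)) * (2 * real (Suc (r - q)) + \<mu> - 3)) * T q (r - q))"
    by (auto simp: Suc_diff_le intro!: sum.cong)
  also have "(\<Sum>q\<le>r. kcoeff \<mu> \<epsilon> h (Suc q) (r - q) * ((real \<epsilon> + 2 * real q + 2) * (real \<epsilon> + 2 * real q + 1)) * T q (r - q)) + \<dots>
    = - X r"
    unfolding X_def sum.distrib[symmetric] distrib_right[symmetric] kcoeff_rec by (simp add: sum_negf)
  finally show ?thesis by simp
qed

text \<open>In the lowest degree \<open>T_top\<close> gives all pairings the same value up to a
  sign, which cancels the sign in \<open>kcoeff\<close>. What remains of the sum over q is
  \<open>sum_choose_div_pochhammer\<close>.\<close>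

lemma X_r0:
  "X r0 = \<tau> * 2 powr (- (\<mu> - 3) / 2) * 4 ^ h * rGamma (real r0 - real h + (\<mu> - 3) / 2 + 1)
     * pochhammer (real \<epsilon> + 1 / 2) (h + r0)"
proof -
  define c where "c = real \<epsilon> + 1 / 2"
  \<comment> \<open>With n = r0 - q the argument n - (h - q) does not depend on q, so this factor
    leaves the sum.\<close>
  define R where "R = rGamma (real r0 - real h + (\<mu> - 3) / 2 + 1)"
  define Z where "Z = (fact (2 * h + \<epsilon>) :: real) * 2 powr (- (\<mu> - 3) / 2) * R * fact (2 * r0 + \<epsilon>) * \<tau> / (4 ^ r0 * fact h)"
  have c: "c > 0" by (simp add: c_def)
  have p: "pochhammer c n > 0" for n by (intro pochhammer_pos c)
  have "kcoeff \<mu> \<epsilon> h q (r0 - q) * T q (r0 - q) = Z * (real (h choose q) / (fact (r0 - q) * pochhammer c q))"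
    if "q \<le> r0" for q
  proof (cases "q \<le> h")
    case False thus ?thesis by (simp add: kcoeff_def)
  next
    case True
    have f: "fact (\<epsilon> + 2 * q) = (4 ^ q * fact q * pochhammer c q :: real)"
      using fact_double[OF eps, of q] by (simp add: c_def add.commute)
    have R: "rGamma (real (r0 - q) + (\<mu> - 3) / 2 - real (h - q) + 1) = R"
      unfolding R_def using True that by (intro arg_cong[of _ _ rGamma]) (simp add: of_nat_diff)
    have s: "(-1 :: real) ^ (r0 - q) * (-1) ^ (r0 - q) = 1" by (simp add: power_mult_distrib[symmetric])
    have b: "real (h choose q) = fact h / (fact q * fact (h - q))"
      using True by (simp add: binomial_fact)
    have "4 ^ r0 = (4 ^ (r0 - q) * 4 ^ q :: real)" using that by (simp add: power_add[symmetric])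
    thus ?thesis
      using True that p[of q] unfolding kcoeff_def R Z_def b f
      by (simp add: T_top divide_simps mult.assoc s)
  qed
  hence "X r0 = Z * (\<Sum>q\<le>r0. real (h choose q) / (fact (r0 - q) * pochhammer c q))"
    by (simp add: X_def sum_distrib_left)
  also have "\<dots> = Z * (pochhammer (c + real h) r0 / (fact r0 * pochhammer c r0))"
    by (simp only: sum_choose_div_pochhammer[OF c])
  also have "\<dots> = \<tau> * 2 powr (- (\<mu> - 3) / 2) * 4 ^ h * R * (pochhammer c h * pochhammer (c + real h) r0)"
    unfolding Z_def fact_double[OF eps] c_def[symmetric] using p[of r0] by (simp add: field_simps)
  also have "pochhammer c h * pochhammer (c + real h) r0 = pochhammer c (h + r0)"
    by (rule pochhammer_product'[symmetric])
  finally show ?thesis by (simp add: c_def R_def)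
qed

lemma X_high: "X (r0 + N) = X r0 * ((- Y / 2) ^ N / fact N)"
proof (induction N)
  case (Suc N)
  have "2 * real (Suc N) * X (r0 + Suc N) = - Y * X (r0 + N)"
    using X_rec[of "r0 + N"] by (simp add: algebra_simps)
  hence "X (r0 + Suc N) = (- Y / 2) / real (Suc N) * X (r0 + N)" by (simp add: field_simps)
  moreover define u where "u = - Y / 2"
  ultimately have "X (r0 + Suc N) = u / real (Suc N) * X (r0 + N)" by simp
  thus ?case unfolding Suc.IH power_Suc fact_Suc u_def[symmetric] by (simp del: of_nat_Suc)
qed simp

text \<open>Here \<open>W\<close> will carry the Laguerre factor. The series are regrouped by r = q
  + n; as q ranges over a finite set, this is only a finite sum of shifted series.\<close>

lemma pairing_sum:
  assumes S: "\<And>q. q \<le> h \<Longrightarrow> (\<lambda>n. kcoeff \<mu> \<epsilon> h q n * (W (q + n) * T q n)) sums S q"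
    and W: "(\<lambda>N. W (r0 + N) * ((- Y / 2) ^ N / fact N)) sums Z"
  shows "(\<Sum>q\<le>h. S q) = X r0 * Z"
proof -
  have "(\<lambda>r. if q \<le> r then kcoeff \<mu> \<epsilon> h q (r - q) * (W r * T q (r - q)) else 0) sums S q"
    if "q \<le> h" for q
  proof -
    let ?f = "\<lambda>r. if q \<le> r then kcoeff \<mu> \<epsilon> h q (r - q) * (W r * T q (r - q)) else 0"
    have "(\<lambda>n. ?f (n + q)) sums S q" using S[OF that] by (simp add: add.commute)
    thus ?thesis by (subst (asm) sums_iff_shift) simp
  qed
  hence "(\<lambda>r. \<Sum>q\<le>h. if q \<le> r then kcoeff \<mu> \<epsilon> h q (r - q) * (W r * T q (r - q)) else 0) sums (\<Sum>q\<le>h. S q)"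
    by (intro sums_sum) auto
  moreover have "(\<Sum>q\<le>h. if q \<le> r then kcoeff \<mu> \<epsilon> h q (r - q) * (W r * T q (r - q)) else 0) = W r * X r" for r
  proof -
    have "(\<Sum>q\<le>h. if q \<le> r then kcoeff \<mu> \<epsilon> h q (r - q) * (W r * T q (r - q)) else 0) =
      (\<Sum>q\<in>{..h} \<inter> {..r}. kcoeff \<mu> \<epsilon> h q (r - q) * (W r * T q (r - q)))"
      by (subst sum.inter_restrict) auto
    also have "\<dots> = (\<Sum>q\<le>r. kcoeff \<mu> \<epsilon> h q (r - q) * (W r * T q (r - q)))"
      by (intro sum.mono_neutral_left) (auto simp: kcoeff_def)
    finally show ?thesis by (simp add: X_def sum_distrib_left mult_ac)
  qed
  ultimately have "(\<lambda>r. W r * X r) sums (\<Sum>q\<le>h. S q)" by simp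
  hence "(\<lambda>N. W (r0 + N) * X (r0 + N)) sums (\<Sum>q\<le>h. S q)"
    using sums_iff_shift[of "\<lambda>r. W r * X r" r0] by (simp add: X_low add.commute)
  moreover have "(\<lambda>N. W (r0 + N) * X (r0 + N)) sums (X r0 * Z)"
    using sums_mult[OF W, of "X r0"] by (simp add: X_high mult_ac)
  ultimately show ?thesis by (rule sums_unique2)
qed

end

section \<open>Double factorials and the value of the lowest pairing\<close>

lemma dfact_odd_Suc: "dfact (2 * int n + 1) = (2 * real n + 1) * dfact (2 * int n - 1)"
proof (cases n)
  case (Suc k)
  have "nat (2 * int n + 1) = Suc (Suc (2 * k + 1))" "nat (2 * int n - 1) = 2 * k + 1"
    using Suc by auto
  thus ?thesis using Suc by (simp add: dfact_def del: dfact_nat.simps(3)) (simp add: algebra_simps)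
qed (simp add: dfact_def)

lemma pochhammer_half: "pochhammer (1 / 2) n = dfact (2 * int n - 1) / 2 ^ n"
proof (induction n)
  case (Suc n)
  have "2 * int (Suc n) - 1 = 2 * int n + 1" by simp
  thus ?case by (simp only: dfact_odd_Suc pochhammer_Suc Suc.IH) (simp add: field_simps)
qed (simp add: dfact_def)

lemma dfact_pos: "dfact z > 0"
proof -
  have "dfact_nat n > 0" for n by (induction n rule: dfact_nat.induct) auto
  thus ?thesis by (simp add: dfact_def)
qed

lemma pochhammer_three_halves: "pochhammer (3 / 2) n = dfact (2 * int n + 1) / 2 ^ n"
proof -
  have "pochhammer (1 / 2) (Suc n) = 1 / 2 * pochhammer (3 / 2 :: real) n" by (simp add: pochhammer_rec)
  moreover have "2 * int (Suc n) - 1 = 2 * int n + 1" by simp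
  ultimately show ?thesis using pochhammer_half[of "Suc n"] by (simp add: field_simps)
qed

lemma rGamma_half: "rGamma (real z + 1 / 2) = 2 ^ z / (sqrt pi * dfact (2 * int z - 1))"
proof -
  have "pochhammer (1 / 2) z = Gamma (1 / 2 + real z) / sqrt pi"
    using pochhammer_Gamma[of "1 / 2 :: real" z] nonpos_Ints_nonpos[of "1 / 2 :: real"]
    by (auto simp: Gamma_one_half_real)
  hence "Gamma (real z + 1 / 2) = sqrt pi * dfact (2 * int z - 1) / 2 ^ z"
    by (simp add: pochhammer_half field_simps)
  thus ?thesis by (simp add: rGamma_inverse_Gamma)
qed

text \<open>The rising factorial at 1/2 or 3/2 gives the numerator and 1/Gamma at a half-integer the
  denominator; sqrt pi and all powers of 2 cancel.\<close>

lemma pairing_constant: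
  assumes "\<epsilon> \<le> 1" "even m" "m \<ge> 2" "2 * h + \<epsilon> \<le> m - 2"
  shows "sqrt (pi / 2) * (2 powr (- (real m - 3) / 2) * 4 ^ h
       * rGamma (real r0 - real h + (real m - 3) / 2 + 1) * pochhammer (real \<epsilon> + 1 / 2) (h + r0))
     = dfact (int (2 * r0 + \<epsilon>) + int (2 * h + \<epsilon>) - 1) / dfact (int (2 * r0 + \<epsilon>) + int m - int (2 * h + \<epsilon>) - 3)"
proof -
  obtain M where M: "m = 2 * M" using assms(2) by (auto elim: evenE)
  define z where "z = r0 + M - 1 - h"
  have hM: "h + 1 \<le> M" using assms M by auto
  have zr: "real r0 - real h + (real m - 3) / 2 + 1 = real z + 1 / 2"
    using hM by (simp add: z_def M of_nat_diff field_simps)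
  have zi: "int (2 * r0 + \<epsilon>) + int m - int (2 * h + \<epsilon>) - 3 = 2 * int z - 1"
    using hM by (simp add: z_def M of_nat_diff)
  have p: "pochhammer (real \<epsilon> + 1 / 2) (h + r0) = dfact (int (2 * r0 + \<epsilon>) + int (2 * h + \<epsilon>) - 1) / 2 ^ (h + r0)"
  proof (cases "\<epsilon> = 0")
    case True
    thus ?thesis using pochhammer_half[of "h + r0"] by (simp add: algebra_simps)
  next
    case False
    hence e: "\<epsilon> = 1" using assms by simp
    show ?thesis using pochhammer_three_halves[of "h + r0"] unfolding e by (simp add: algebra_simps)
  qed
  have "sqrt (pi / 2) * (2 powr (- (real m - 3) / 2) * 4 ^ h * 2 ^ z / sqrt pi) / 2 ^ (h + r0) =
    2 powr (- 1 / 2) * 2 powr (- (real m - 3) / 2) * 2 powr (2 * real h) * 2 powr (real z) * 2 powr (- real (h + r0))"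
  proof -
    have "2 powr (- 1 / 2) = 1 / sqrt (2 :: real)" by (simp add: powr_minus_divide powr_half_sqrt)
    moreover have "2 powr (2 * real h) = (4 :: real) ^ h"
      by (simp add: powr_powr[symmetric] powr_realpow)
    moreover have "2 powr real z = (2 :: real) ^ z" by (simp add: powr_realpow)
    moreover have "2 powr (- real (h + r0)) = 1 / (2 :: real) ^ (h + r0)"
      by (simp only: powr_minus_divide powr_realpow)
    ultimately show ?thesis by (simp add: real_sqrt_divide)
  qed
  \<comment> \<open>The exponents of 2 add up to zero by the choice of \<open>z\<close>, whose
    truncated subtraction is exact because h + 1 <= M.\<close>
  also have "\<dots> = 2 powr 0"
    unfolding powr_add[symmetric] using hM by (simp add: z_def M of_nat_diff field_simps)
  finally have "sqrt (pi / 2) * (2 powr (- (real m - 3) / 2) * 4 ^ h * 2 ^ z / sqrt pi) / 2 ^ (h + r0) = 1"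
    by simp
  hence eq: "sqrt (pi / 2) * 2 powr (- (real m - 3) / 2) * 4 ^ h * 2 ^ z = sqrt pi * 2 ^ (h + r0)"
    by (simp add: field_simps)
  show ?thesis
    unfolding zr rGamma_half p zi
    using eq dfact_pos[of "2 * int z - 1"] by (simp add: field_simps)
qed

section \<open>The Bessel series under the Gaussian integral\<close>

lemma wedge_sq_nonneg: "wedge_sq m y x \<ge> 0"
proof -
  have "(\<Sum>j<m. x j * y j)\<^sup>2 \<le> (\<Sum>j<m. (x j)\<^sup>2) * (\<Sum>j<m. (y j)\<^sup>2)"
    by (rule Cauchy_Schwarz_ineq_sum)
  thus ?thesis by (simp add: wedge_sq_def inner_m_def normsq_m_def)
qed

lemma wedge_abs_altdef: "wedge_abs m x y = sqrt (wedge_sq m y x)"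
  by (simp add: wedge_abs_def wedge_sq_def)

lemma normsq_nonneg: "normsq_m m x \<ge> 0"
  unfolding normsq_m_def by (intro sum_nonneg) auto

text \<open>The growth estimate that makes the kernel integrable against a Gaussian: \<open>t \<le> |x| |y|\<close>.\<close>

lemma wedge_abs_le: "wedge_abs m x y \<le> normsq_m m x / 4 + normsq_m m y"
proof -
  have "wedge_sq m y x \<le> normsq_m m x * normsq_m m y" by (simp add: wedge_sq_def)
  also have "\<dots> \<le> (normsq_m m x / 4 + normsq_m m y)\<^sup>2"
    using zero_le_power2[of "normsq_m m x / 4 - normsq_m m y"] by (simp add: power2_eq_square algebra_simps)
  finally show ?thesis
    unfolding wedge_abs_altdef using normsq_nonneg[of m x] normsq_nonneg[of m y]
    by (intro real_le_lsqrt) auto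
qed

definition tJ_coeff :: "real \<Rightarrow> nat \<Rightarrow> real" where
  "tJ_coeff a n = 2 powr (- a) * (-1) ^ n * rGamma (real n + a + 1) / (4 ^ n * fact n)"

text \<open>On half-integers 1/Gamma decreases from 3/2 on, while from 1/2 to 3/2 it doubles; hence
  the constant 2.\<close>

lemma rGamma_half_integer_bound: "0 < rGamma (real n + 1 / 2) \<and> rGamma (real n + real q + 1 / 2) \<le> 2 * rGamma (real n + 1 / 2)"
proof -
  have pos: "rGamma (real n + 1 / 2) > 0" for n
    by (simp add: rGamma_inverse_Gamma Gamma_real_pos)
  have step: "rGamma (real n + 1 + 1 / 2) * (real n + 1 / 2) = rGamma (real n + 1 / 2)" for n
    using rGamma_plus1[of "real n + 1 / 2"] by (simp add: add_ac mult.commute)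
  have mono: "rGamma (real n + 1 / 2) \<le> rGamma (real k + 1 / 2)" if "1 \<le> k" "k \<le> n" for k n
    using that(2)
  proof (induction n rule: dec_induct)
    case (step n)
    have "rGamma (real n + 1 + 1 / 2) * 1 \<le> rGamma (real n + 1 + 1 / 2) * (real n + 1 / 2)"
      using that(1) step.hyps pos[of "Suc n"] by (intro mult_left_mono) (auto simp: add_ac)
    thus ?case using step.IH \<open>\<And>n. rGamma (real n + 1 + 1 / 2) * (real n + 1 / 2) = rGamma (real n + 1 / 2)\<close>[of n]
      by (simp add: add_ac)
  qed simp
  have "rGamma (real (n + q) + 1 / 2) \<le> 2 * rGamma (real n + 1 / 2)"
  proof (cases "n = 0")
    case False
    hence "rGamma (real (n + q) + 1 / 2) \<le> rGamma (real n + 1 / 2)" by (intro mono) auto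
    thus ?thesis using pos[of n] by linarith
  next
    case n: True
    show ?thesis
    proof (cases "q = 0")
      case True thus ?thesis using n pos[of 0] by simp
    next
      case False
      hence "rGamma (real q + 1 / 2) \<le> rGamma (real 1 + 1 / 2)" by (intro mono) auto
      also have "\<dots> = 2 * rGamma (1 / 2)" using step[of 0] by simp
      finally show ?thesis using n by simp
    qed
  qed
  thus ?thesis using pos by simp
qed

text \<open>For order -1/2 the product 4^n n! Gamma (n + 1/2) is Gamma (1/2) (2 n)!, so that series
  is a multiple of the cosine series. All higher orders are compared with it.\<close>

lemma tJ_coeff_bound:
  "\<bar>tJ_coeff (real q - 1 / 2) n\<bar> \<le> (2 * 2 powr (1 / 2 - real q) * rGamma (1 / 2)) * (1 / fact (2 * n))"
proof -
  have pos: "rGamma (real n + 1 / 2) > 0" for n using rGamma_half_integer_bound by blast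
  have f: "rGamma (real n + 1 / 2) / (4 ^ n * fact n) = rGamma (1 / 2) / fact (2 * n)"
  proof (induction n)
    case (Suc n)
    define R G where "R = rGamma (real (Suc n) + 1 / 2)" and "G = rGamma (real n + 1 / 2)"
    have G: "G = R * (real n + 1 / 2)"
      using rGamma_plus1[of "real n + 1 / 2"] by (simp add: R_def G_def add_ac mult.commute)
    have "R / (4 ^ Suc n * fact (Suc n)) = (G / (4 ^ n * fact n)) / ((2 * real n + 1) * (2 * real n + 2))"
      unfolding G by (simp add: divide_simps) (simp add: algebra_simps)
    hence "rGamma (real (Suc n) + 1 / 2) / (4 ^ Suc n * fact (Suc n)) =
      (rGamma (real n + 1 / 2) / (4 ^ n * fact n)) / ((2 * real n + 1) * (2 * real n + 2))"
      by (simp only: R_def G_def)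
    also have "\<dots> = rGamma (1 / 2) / fact (2 * Suc n)" unfolding Suc.IH
      by (simp add: divide_simps) (simp add: algebra_simps)
    finally show ?case .
  qed simp
  have r: "real n + (real q - 1 / 2) + 1 = real (n + q) + 1 / 2" by simp
  have "\<bar>tJ_coeff (real q - 1 / 2) n\<bar> = 2 powr (1 / 2 - real q) * rGamma (real (n + q) + 1 / 2) / (4 ^ n * fact n)"
    using pos[of "n + q"] unfolding tJ_coeff_def r by (simp add: abs_mult power_abs)
  also have "\<dots> \<le> 2 powr (1 / 2 - real q) * (2 * rGamma (real n + 1 / 2)) / (4 ^ n * fact n)"
    using rGamma_half_integer_bound[of n q]
    by (intro divide_right_mono mult_left_mono) auto
  also have "\<dots> = 2 * 2 powr (1 / 2 - real q) * (rGamma (real n + 1 / 2) / (4 ^ n * fact n))" by simp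
  finally show ?thesis unfolding f by simp
qed

lemma exp_even_sum_le:
  fixes t :: real assumes "t \<ge> 0"
  shows "(\<Sum>n<N. t ^ (2 * n) / fact (2 * n)) \<le> exp t"
proof -
  have "(\<Sum>n<N. t ^ (2 * n) / fact (2 * n)) = (\<Sum>k\<in>(\<lambda>n. 2 * n) ` {..<N}. t ^ k / fact k)"
    by (subst sum.reindex) (auto simp: inj_on_def)
  also have "\<dots> \<le> (\<Sum>k. t ^ k / fact k)"
    using summable_exp_generic[of t] assms
    by (intro sum_le_suminf) (auto simp: divide_inverse mult.commute)
  also have "\<dots> = exp t" by (simp add: exp_def divide_inverse mult.commute)
  finally show ?thesis .
qed

text \<open>Here \<open>t\<close> is the square of the Bessel argument; \<open>wedge_sq\<close>, a
  polynomial, will be substituted for it.\<close>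

lemma tJ_sums:
  assumes "t \<ge> 0"
  shows "(\<lambda>n. tJ_coeff (real q - 1 / 2) n * t ^ n) sums tJ (real q - 1 / 2) (sqrt t)"
proof -
  define C where "C = 2 * 2 powr (1 / 2 - real q) * rGamma (1 / 2)"
  have C: "C \<ge> 0" using rGamma_half_integer_bound[of 0 0] by (simp add: C_def)
  have t: "sqrt t ^ (2 * n) = t ^ n" for n using assms by (simp add: power_mult)
  have "summable (\<lambda>n. sqrt t ^ (2 * n) / fact (2 * n))"
    using exp_even_sum_le[of "sqrt t"] assms
    by (intro bounded_imp_summable[of _ "exp (sqrt t)"]) (auto simp: lessThan_Suc_atMost[symmetric] simp del: sum.lessThan_Suc)
  hence "summable (\<lambda>n. C * (t ^ n / fact (2 * n)))" unfolding t by (intro summable_mult)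
  hence "summable (\<lambda>n. tJ_coeff (real q - 1 / 2) n * t ^ n)"
  proof (rule summable_comparison_test'[where N = 0])
    fix n
    show "norm (tJ_coeff (real q - 1 / 2) n * t ^ n) \<le> C * (t ^ n / fact (2 * n))"
      using mult_right_mono[OF tJ_coeff_bound[of q n], of "t ^ n"] assms
      by (simp add: abs_mult C_def)
  qed
  hence 1: "(\<lambda>n. tJ_coeff (real q - 1 / 2) n * t ^ n) sums (\<Sum>n. tJ_coeff (real q - 1 / 2) n * t ^ n)"
    by (rule summable_sums)
  have eq: "tJ_coeff (real q - 1 / 2) n * t ^ n = 2 powr (- (real q - 1 / 2)) *
    ((-1) ^ n * (sqrt t / 2) ^ (2 * n) * rGamma (real n + (real q - 1 / 2) + 1) / fact n)" for n
    unfolding tJ_coeff_def power_divide t by (simp add: power_mult)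
  have s: "summable (\<lambda>n. (-1) ^ n * (sqrt t / 2) ^ (2 * n) * rGamma (real n + (real q - 1 / 2) + 1) / fact n)"
    using sums_summable[OF 1] unfolding eq by (subst (asm) summable_cmult_iff) auto
  have "(\<Sum>n. tJ_coeff (real q - 1 / 2) n * t ^ n) = tJ (real q - 1 / 2) (sqrt t)"
    unfolding eq tJ_def by (rule suminf_mult[OF s])
  with 1 show ?thesis by simp
qed

text \<open>Dominated convergence for the partial sums of the Bessel series.\<close>

lemma gauss_tJ_sums:
  fixes q :: nat and y :: "nat \<Rightarrow> real"
  assumes P: "hpoly m d P"
  defines "f \<equiv> \<lambda>x. P x * tJ (real q - 1 / 2) (wedge_abs m x y)"
  shows "integrable (lebesgue_m m) (\<lambda>x. f x * exp (- normsq_m m x / 2))"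
    and "(\<lambda>n. tJ_coeff (real q - 1 / 2) n * gauss_exp m (\<lambda>x. P x * wedge_sq m y x ^ n)) sums gauss_exp m f"
proof -
  let ?w = "\<lambda>x. exp (- normsq_m m x / 2)"
  let ?c = "tJ_coeff (real q - 1 / 2)"
  define C where "C = 2 * 2 powr (1 / 2 - real q) * rGamma (1 / 2)"
  have C: "C \<ge> 0" using rGamma_half_integer_bound[of 0 0] by (simp add: C_def)
  define s where "s = (\<lambda>N x. \<Sum>n<N. ?c n * (P x * wedge_sq m y x ^ n * ?w x))"
  \<comment> \<open>The series is at most C exp t, and \<open>wedge_abs_le\<close> costs half of the
    Gaussian decay: |x|^2 / 4 out of |x|^2 / 2.\<close>
  define D where "D = (\<lambda>x. C * exp (normsq_m m y) * \<bar>P x * exp (- (1 / 4) * normsq_m m x)\<bar>)"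
  have term_int: "integrable (lebesgue_m m) (\<lambda>x. P x * wedge_sq m y x ^ n * ?w x)" for n
    by (rule integrable_hpoly_half[OF hpoly_mult[OF P hpoly_power[OF hpoly_wedge_sq]]])
  have s_int: "integrable (lebesgue_m m) (s N)" for N
    unfolding s_def by (intro Bochner_Integration.integrable_sum integrable_mult_right term_int)
  have lim: "(\<lambda>N. s N x) \<longlonglongrightarrow> f x * ?w x" for x
  proof -
    have "(\<lambda>n. ?c n * wedge_sq m y x ^ n) sums tJ (real q - 1 / 2) (wedge_abs m x y)"
      unfolding wedge_abs_altdef by (rule tJ_sums[OF wedge_sq_nonneg])
    from sums_mult[OF this, of "P x * ?w x"] show ?thesis
      unfolding sums_def s_def f_def by (simp add: mult_ac)
  qed
  have bound: "norm (s N x) \<le> D x" for N x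
  proof -
    let ?t = "wedge_abs m x y"
    have t: "?t \<ge> 0" "?t ^ (2 * n) = wedge_sq m y x ^ n" for n
      using wedge_sq_nonneg[of m y x] by (auto simp: wedge_abs_altdef power_mult)
    have "norm (s N x) \<le> (\<Sum>n<N. \<bar>P x\<bar> * ?w x * (\<bar>?c n\<bar> * ?t ^ (2 * n)))"
      unfolding s_def real_norm_def
      by (rule order_trans[OF sum_abs]) (auto intro!: sum_mono simp: abs_mult t wedge_sq_nonneg power_abs)
    also have "\<dots> \<le> (\<Sum>n<N. \<bar>P x\<bar> * ?w x * (C * (1 / fact (2 * n)) * ?t ^ (2 * n)))"
      unfolding C_def by (intro sum_mono mult_left_mono mult_right_mono tJ_coeff_bound) (auto simp: t wedge_sq_nonneg)
    also have "\<dots> = \<bar>P x\<bar> * ?w x * C * (\<Sum>n<N. ?t ^ (2 * n) / fact (2 * n))"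
      by (simp add: sum_distrib_left mult_ac)
    also have "\<dots> \<le> \<bar>P x\<bar> * ?w x * C * exp ?t"
      using C t by (intro mult_left_mono exp_even_sum_le) auto
    also have "\<dots> \<le> \<bar>P x\<bar> * ?w x * C * exp (normsq_m m x / 4 + normsq_m m y)"
      using C wedge_abs_le[of m x y] by (intro mult_left_mono) auto
    also have "\<dots> = C * exp (normsq_m m y) * \<bar>P x\<bar> * (?w x * exp (normsq_m m x / 4))"
      by (simp add: exp_add)
    also have "?w x * exp (normsq_m m x / 4) = exp (- (1 / 4) * normsq_m m x)"
      by (simp add: exp_add[symmetric])
    finally show ?thesis by (simp add: D_def abs_mult)
  qed
  have D_int: "integrable (lebesgue_m m) D"
    unfolding D_def by (intro integrable_mult_right integrable_abs integrable_hpoly[OF P]) simp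
  have meas: "(\<lambda>x. f x * ?w x) \<in> borel_measurable (lebesgue_m m)"
    by (rule borel_measurable_LIMSEQ_real[OF lim]) (use s_int in auto)
  note dc = borel_measurable_integrable[OF s_int] D_int AE_I2[OF lim] AE_I2[OF bound]
  show "integrable (lebesgue_m m) (\<lambda>x. f x * ?w x)"
    by (rule integrable_dominated_convergence[OF meas dc])
  have "(\<lambda>N. integral\<^sup>L (lebesgue_m m) (s N)) \<longlonglongrightarrow> integral\<^sup>L (lebesgue_m m) (\<lambda>x. f x * ?w x)"
    by (rule integral_dominated_convergence[OF meas dc])
  moreover have "integral\<^sup>L (lebesgue_m m) (s N) = (\<Sum>n<N. ?c n * (\<integral>x. P x * wedge_sq m y x ^ n * ?w x \<partial>lebesgue_m m))" for N
    unfolding s_def by (subst Bochner_Integration.integral_sum) (intro integrable_mult_right term_int, simp)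
  ultimately have "(\<lambda>n. ?c n * (\<integral>x. P x * wedge_sq m y x ^ n * ?w x \<partial>lebesgue_m m)) sums
    integral\<^sup>L (lebesgue_m m) (\<lambda>x. f x * ?w x)" by (simp add: sums_def)
  from sums_mult[OF this, of "(2 * pi) powr (- real m / 2)"]
  show "(\<lambda>n. ?c n * gauss_exp m (\<lambda>x. P x * wedge_sq m y x ^ n)) sums gauss_exp m f"
    by (simp add: gauss_exp_def mult_ac)
qed

section \<open>The kernels as finite sums of Bessel series\<close>

definition kern :: "nat \<Rightarrow> nat \<Rightarrow> real \<Rightarrow> real \<Rightarrow> real" where
  "kern m i s t = sqrt (pi / 2) * (\<Sum>l\<le>i div 2.
        s ^ (i - 2 * l) * (1 / (2 ^ l * fact l)) * (fact i / fact (i - 2 * l))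
        * tJ ((real m - 2 * real l - 3) / 2) t)"

lemma f_hat_kern: "f_hat m i s t = (-1) ^ (m div 2 + i) * kern m i s t"
  by (simp add: f_hat_def kern_def)

lemma g_fun_kern: "g_fun m i s t = kern (m + 2) i s t"
  by (simp add: g_fun_def kern_def algebra_simps)

text \<open>The factor i comes from i! = i (i - 1)!; for i = 0 it also reproduces the separate
  convention for \<open>f_tilde\<close>.\<close>

lemma f_tilde_kern: "f_tilde m i s t = - real i * kern m (i - 1) s t"
proof (cases i)
  case (Suc n)
  have eq: "s ^ (i - 1 - 2 * l) * (1 / (2 ^ l * fact l)) * (fact i / fact (i - 1 - 2 * l)) * z =
    real i * (s ^ (n - 2 * l) * (1 / (2 ^ l * fact l)) * (fact n / fact (n - 2 * l)) * z)" for l z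
    using Suc by (simp add: mult_ac)
  show ?thesis unfolding f_tilde_def kern_def eq sum_distrib_left[symmetric] using Suc by (simp del: of_nat_Suc)
qed (simp add: f_tilde_def)

lemma kern_coeff:
  assumes "q \<le> h"
  shows "fact (2 * h + \<epsilon>) / (2 ^ (h - q) * fact (h - q) * fact (\<epsilon> + 2 * q))
      * tJ_coeff ((\<mu> - 2 * real (h - q) - 3) / 2) n = kcoeff \<mu> \<epsilon> h q n"
proof -
  have 1: "(\<mu> - 2 * real (h - q) - 3) / 2 = (\<mu> - 3) / 2 - real (h - q)" by (simp add: field_simps)
  have 2: "2 powr (- ((\<mu> - 3) / 2 - real (h - q))) = 2 powr (- (\<mu> - 3) / 2) * 2 ^ (h - q)"
  proof -
    have "- ((\<mu> - 3) / 2 - real (h - q)) = - (\<mu> - 3) / 2 + real (h - q)" by (simp add: field_simps)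
    thus ?thesis by (simp only: powr_add powr_realpow)
  qed
  show ?thesis using assms
    unfolding kcoeff_def tJ_coeff_def 1 2 by (simp add: add_diff_eq mult_ac del: of_nat_diff)
qed

text \<open>Counting from the other end, q = h - l, puts the power of s in the form
  \<open>\<epsilon> + 2 * q\<close> that \<open>kcoeff\<close> and the recursion for
  \<open>T\<close> use.\<close>

lemma kern_altdef:
  "kern m (2 * h + \<epsilon>) s t = (\<Sum>q\<le>h. sqrt (pi / 2) *
     (fact (2 * h + \<epsilon>) / (2 ^ (h - q) * fact (h - q) * fact (\<epsilon> + 2 * q)))
      * (s ^ (\<epsilon> + 2 * q) * tJ ((real m - 2 * real (h - q) - 3) / 2) t))"
  if "\<epsilon> \<le> 1"
proof -
  have d: "(2 * h + \<epsilon>) div 2 = h" using that by linarith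
  show ?thesis
    unfolding kern_def d sum_distrib_left
  proof (intro sum.reindex_bij_witness[of _ "\<lambda>q. h - q" "\<lambda>l. h - l"], goal_cases)
    case (5 l)
    hence "2 * h + \<epsilon> - 2 * l = \<epsilon> + 2 * (h - l)" "h - (h - l) = l" by auto
    thus ?case by (simp only:) (simp add: mult_ac)
  qed auto
qed

text \<open>The exchange of series and integral for the whole kernel. The dimension m' governing the
  Bessel orders is separate from the dimension m of integration, and \<open>B\<close> need not be
  harmonic: the bivector case takes m' = m + 2 and a bivector coordinate times H. The weight
  \<open>W\<close> is the Laguerre polynomial after \<open>gauss_exp_normsq_power\<close>.\<close>

lemma kernel_transform:
  fixes y :: "nat \<Rightarrow> real" and m e m' h \<epsilon> p :: nat and a :: real and B :: "(nat \<Rightarrow> real) \<Rightarrow> real"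
  assumes B: "hpoly m e B" and m': "even m'" "2 * h + \<epsilon> + 2 \<le> m'" and eps: "\<epsilon> \<le> 1"
  defines "T \<equiv> \<lambda>q n. gauss_exp m (\<lambda>x. inner_m m x y ^ (\<epsilon> + 2 * q) * wedge_sq m y x ^ n * B x)"
    and "W \<equiv> \<lambda>r. \<Sum>j\<le>p. laguerre_coeff p a j * (2 ^ j * pochhammer ((real m + real e + real \<epsilon>) / 2 + real r) j)"
    and "F \<equiv> \<lambda>x. kern m' (2 * h + \<epsilon>) (inner_m m x y) (wedge_abs m x y) * (laguerre p a (normsq_m m x) * B x)"
  shows "integrable (lebesgue_m m) (\<lambda>x. F x * exp (- normsq_m m x / 2))"
    and "\<exists>S. (\<forall>q\<le>h. (\<lambda>n. kcoeff (real m') \<epsilon> h q n * (W (q + n) * T q n)) sums S q) \<and>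
      gauss_exp m F = sqrt (pi / 2) * (\<Sum>q\<le>h. S q)"
proof -
  let ?w = "\<lambda>x. exp (- normsq_m m x / 2)"
  define P where "P = (\<lambda>q j x. normsq_m m x ^ j * (inner_m m x y ^ (\<epsilon> + 2 * q) * B x))"
  define c where "c = (\<lambda>q. fact (2 * h + \<epsilon>) / (2 ^ (h - q) * fact (h - q) * fact (\<epsilon> + 2 * q)) :: real)"
  define J where "J = (\<lambda>q x. tJ ((real m' - 2 * real (h - q) - 3) / 2) (wedge_abs m x y))"
  have Ph: "hpoly m (j * 2 + ((\<epsilon> + 2 * q) * 1 + e)) (P q j)" for q j
    unfolding P_def by (intro hpoly_mult hpoly_power hpoly_normsq hpoly_inner B)
  \<comment> \<open>The parity of m' and the bound on the kernel index make every order a natural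
    number minus 1/2.\<close>
  have ord: "(real m' - 2 * real (h - q) - 3) / 2 = real (m' div 2 - 1 - (h - q)) - 1 / 2" if "q \<le> h" for q
  proof -
    obtain M where M: "m' = 2 * M" using m' by (auto elim: evenE)
    thus ?thesis using m'(2) that by (simp add: of_nat_diff field_simps)
  qed
  have Pint: "integrable (lebesgue_m m) (\<lambda>x. P q j x * J q x * ?w x)" if "q \<le> h" for q j
    unfolding J_def ord[OF that] by (rule gauss_tJ_sums(1)[OF Ph])
  have Psums: "(\<lambda>n. tJ_coeff ((real m' - 2 * real (h - q) - 3) / 2) n *
      (2 ^ j * pochhammer ((real m + real e + real \<epsilon>) / 2 + real (q + n)) j * T q n))
      sums gauss_exp m (\<lambda>x. P q j x * J q x)" if "q \<le> h" for q j
  proof -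
    have "gauss_exp m (\<lambda>x. P q j x * wedge_sq m y x ^ n) =
      2 ^ j * pochhammer ((real m + real e + real \<epsilon>) / 2 + real (q + n)) j * T q n" for n
    proof -
      have h: "hpoly m ((\<epsilon> + 2 * q) * 1 + n * 2 + e) (\<lambda>x. inner_m m x y ^ (\<epsilon> + 2 * q) * wedge_sq m y x ^ n * B x)"
        by (intro hpoly_mult hpoly_power hpoly_inner hpoly_wedge_sq B)
      have eq: "(real m + real ((\<epsilon> + 2 * q) * 1 + n * 2 + e)) / 2 = (real m + real e + real \<epsilon>) / 2 + real (q + n)"
        by (simp add: field_simps)
      have "P q j x * wedge_sq m y x ^ n = normsq_m m x ^ j * (inner_m m x y ^ (\<epsilon> + 2 * q) * wedge_sq m y x ^ n * B x)" for x
        by (simp add: P_def mult_ac)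
      thus ?thesis by (simp only: gauss_exp_normsq_power[OF h] eq T_def)
    qed
    with gauss_tJ_sums(2)[OF Ph[of j q], of "m' div 2 - 1 - (h - q)" y] show ?thesis
      unfolding J_def ord[OF that] by simp
  qed
  have F: "F x = (\<Sum>q\<le>h. \<Sum>j\<le>p. (sqrt (pi / 2) * c q * laguerre_coeff p a j) * (P q j x * J q x))" for x
  proof -
    have "F x = (\<Sum>q\<le>h. sqrt (pi / 2) * c q * (inner_m m x y ^ (\<epsilon> + 2 * q) * J q x)) *
      (\<Sum>j\<le>p. laguerre_coeff p a j * normsq_m m x ^ j) * B x"
      unfolding F_def kern_altdef[OF eps] laguerre_altdef c_def J_def by (simp only: mult.assoc)
    thus ?thesis
      unfolding sum_product unfolding sum_distrib_right P_def by (simp only: mult_ac)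
  qed
  have term_int: "integrable (lebesgue_m m) (\<lambda>x. K * (P q j x * J q x * ?w x))" if "q \<le> h" for K q j
    by (intro integrable_mult_right Pint that)
  have Fw: "F x * ?w x = (\<Sum>q\<le>h. \<Sum>j\<le>p. (sqrt (pi / 2) * c q * laguerre_coeff p a j) * (P q j x * J q x * ?w x))" for x
    unfolding F sum_distrib_right by (simp only: mult.assoc)
  show "integrable (lebesgue_m m) (\<lambda>x. F x * ?w x)"
    unfolding Fw by (intro Bochner_Integration.integrable_sum term_int) auto
  have "gauss_exp m F = (2 * pi) powr (- real m / 2) *
    (\<Sum>q\<le>h. \<Sum>j\<le>p. (sqrt (pi / 2) * c q * laguerre_coeff p a j) * (\<integral>x. P q j x * J q x * ?w x \<partial>lebesgue_m m))"
    unfolding gauss_exp_def Fw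
    by (subst Bochner_Integration.integral_sum, intro Bochner_Integration.integrable_sum term_int, simp,
        intro arg_cong2[of _ _ _ _ "(*)"] refl sum.cong,
        subst Bochner_Integration.integral_sum, intro term_int, simp, simp)
  also have "\<dots> = sqrt (pi / 2) * (\<Sum>q\<le>h. \<Sum>j\<le>p. c q * laguerre_coeff p a j * gauss_exp m (\<lambda>x. P q j x * J q x))"
    unfolding gauss_exp_def sum_distrib_left
  proof (intro sum.cong refl, goal_cases)
    case (1 q j)
    have "A * (s * c * l * I) = s * (c * l * (A * I))" for A s c l I :: real by simp
    thus ?case .
  qed
  finally have E: "gauss_exp m F = sqrt (pi / 2) *
    (\<Sum>q\<le>h. \<Sum>j\<le>p. c q * laguerre_coeff p a j * gauss_exp m (\<lambda>x. P q j x * J q x))" .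
  have "(\<lambda>n. kcoeff (real m') \<epsilon> h q n * (W (q + n) * T q n)) sums
     (\<Sum>j\<le>p. c q * laguerre_coeff p a j * gauss_exp m (\<lambda>x. P q j x * J q x))" if "q \<le> h" for q
  proof -
    have "(\<lambda>n. \<Sum>j\<le>p. c q * laguerre_coeff p a j * (tJ_coeff ((real m' - 2 * real (h - q) - 3) / 2) n *
      (2 ^ j * pochhammer ((real m + real e + real \<epsilon>) / 2 + real (q + n)) j * T q n))) sums
      (\<Sum>j\<le>p. c q * laguerre_coeff p a j * gauss_exp m (\<lambda>x. P q j x * J q x))"
      by (intro sums_sum sums_mult Psums that)
    moreover have eq: "(\<Sum>j\<le>p. c q * laguerre_coeff p a j * (tJ_coeff ((real m' - 2 * real (h - q) - 3) / 2) n *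
      (2 ^ j * pochhammer ((real m + real e + real \<epsilon>) / 2 + real (q + n)) j * T q n)))
      = kcoeff (real m') \<epsilon> h q n * (W (q + n) * T q n)" for n
      unfolding kern_coeff[OF that, symmetric] W_def c_def sum_distrib_left sum_distrib_right
    proof (intro sum.cong refl, goal_cases)
      case (1 j)
      have "c * l * (t * (b * T)) = c * t * (l * b * T)" for c l t b T :: real by simp
      thus ?case .
    qed
    ultimately show ?thesis by (simp only: eq)
  qed
  hence "\<forall>q\<le>h. (\<lambda>n. kcoeff (real m') \<epsilon> h q n * (W (q + n) * T q n)) sums
     (\<Sum>j\<le>p. c q * laguerre_coeff p a j * gauss_exp m (\<lambda>x. P q j x * J q x))" by simp
  with E show "\<exists>S. (\<forall>q\<le>h. (\<lambda>n. kcoeff (real m') \<epsilon> h q n * (W (q + n) * T q n)) sums S q) \<and>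
      gauss_exp m F = sqrt (pi / 2) * (\<Sum>q\<le>h. S q)"
    by (intro exI[of _ "\<lambda>q. \<Sum>j\<le>p. c q * laguerre_coeff p a j * gauss_exp m (\<lambda>x. P q j x * J q x)"] conjI)
qed

lemma kernel_transform_zero:
  assumes B: "hpoly m e B" and m': "even m'" "i + 2 \<le> m'"
    and T: "\<And>q n. gauss_exp m (\<lambda>x. inner_m m x y ^ (i mod 2 + 2 * q) * wedge_sq m y x ^ n * B x) = 0"
  shows "gauss_exp m (\<lambda>x. kern m' i (inner_m m x y) (wedge_abs m x y) * (laguerre p a (normsq_m m x) * B x)) = 0"
proof -
  have i: "2 * (i div 2) + i mod 2 = i" by simp
  have le: "2 * (i div 2) + i mod 2 + 2 \<le> m'" "i mod 2 \<le> 1" using m'(2) by auto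
  from kernel_transform(2)[where h = "i div 2" and \<epsilon> = "i mod 2" and y = y and p = p and a = a, OF B m'(1) le, unfolded T i]
  obtain S where S: "\<forall>q\<le>i div 2. (\<lambda>n. 0) sums S q"
    and E: "gauss_exp m (\<lambda>x. kern m' i (inner_m m x y) (wedge_abs m x y) * (laguerre p a (normsq_m m x) * B x)) =
      sqrt (pi / 2) * (\<Sum>q\<le>i div 2. S q)"
    by auto
  have "S q = 0" if "q \<le> i div 2" for q using S that sums_unique2[OF _ sums_zero] by blast
  thus ?thesis unfolding E by simp
qed

text \<open>The assumption on \<open>a\<close> makes \<open>W (r0 + N)\<close> the polynomial in
  \<open>laguerre_reflection_sums\<close>. Both applications satisfy it with a = m / 2 + d - 1: in
  the bivector case e is larger by one and the lowest degree smaller by one.\<close>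

lemma kernel_transform_pairing:
  fixes y :: "nat \<Rightarrow> real" and m :: nat
  defines "T \<equiv> \<lambda>\<epsilon> B q n. gauss_exp m (\<lambda>x. inner_m m x y ^ (\<epsilon> + 2 * q) * wedge_sq m y x ^ n * B x)"
  assumes B: "hpoly m e B" and m': "even m'" "i + 2 \<le> m'"
    and pairing: "harmonic_pairing (real m') (normsq_m m y) \<tau> (i mod 2) r0 (T (i mod 2) B)"
    and a: "real m + real e + real (2 * r0 + i mod 2) = 2 * (a + 1)"
  shows "gauss_exp m (\<lambda>x. kern m' i (inner_m m x y) (wedge_abs m x y) * (laguerre p a (normsq_m m x) * B x)) =
    dfact (int (2 * r0 + i mod 2) + int i - 1) / dfact (int (2 * r0 + i mod 2) + int m' - int i - 3) * \<tau> *
      ((-1) ^ p * laguerre p a (normsq_m m y) * exp (- normsq_m m y / 2))"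
proof -
  let ?h = "i div 2" and ?e = "i mod 2"
  interpret harmonic_pairing "real m'" "normsq_m m y" \<tau> ?e ?h r0 "T ?e B" by (rule pairing)
  have i: "2 * ?h + ?e = i" by simp
  have le: "2 * ?h + ?e + 2 \<le> m'" "?e \<le> 1" using m'(2) by auto
  define W where "W = (\<lambda>r. \<Sum>j\<le>p. laguerre_coeff p a j * (2 ^ j * pochhammer ((real m + real e + real ?e) / 2 + real r) j))"
  obtain S where S: "\<And>q. q \<le> ?h \<Longrightarrow> (\<lambda>n. kcoeff (real m') ?e ?h q n * (W (q + n) * T ?e B q n)) sums S q"
    and E: "gauss_exp m (\<lambda>x. kern m' i (inner_m m x y) (wedge_abs m x y) * (laguerre p a (normsq_m m x) * B x)) =
      sqrt (pi / 2) * (\<Sum>q\<le>?h. S q)"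
    using kernel_transform(2)[where h = ?h and \<epsilon> = ?e and y = y and p = p and a = a, OF B m'(1) le, unfolded i]
    unfolding W_def T_def by auto
  have "(real m + real e + real ?e) / 2 + real (r0 + N) = a + 1 + real N" for N
    using a by (simp add: field_simps)
  hence W: "(\<lambda>N. W (r0 + N) * ((- normsq_m m y / 2) ^ N / fact N)) sums
    ((-1) ^ p * laguerre p a (normsq_m m y) * exp (- normsq_m m y / 2))"
    unfolding W_def using laguerre_reflection_sums[of p a "normsq_m m y"] by (simp only:)
  have "sqrt (pi / 2) * X r0 = \<tau> * (dfact (int (2 * r0 + ?e) + int (2 * ?h + ?e) - 1) / dfact (int (2 * r0 + ?e) + int m' - int (2 * ?h + ?e) - 3))"
    unfolding X_r0 by (subst pairing_constant[OF eps m'(1), symmetric]) (use m'(2) i in \<open>simp_all add: mult_ac\<close>)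
  hence c: "sqrt (pi / 2) * X r0 = dfact (int (2 * r0 + ?e) + int i - 1) / dfact (int (2 * r0 + ?e) + int m' - int i - 3) * \<tau>"
    unfolding i by (simp only: mult.commute)
  have "(\<Sum>q\<le>?h. S q) = X r0 * ((-1) ^ p * laguerre p a (normsq_m m y) * exp (- normsq_m m y / 2))"
    by (rule pairing_sum[OF S W])
  thus ?thesis unfolding E c[symmetric] by (simp only: mult.assoc)
qed

text \<open>The recursion is \<open>gauss_exp_harmonic\<close> with \<open>lap_kernel_term\<close>;
  the initial value combines \<open>gauss_exp_wedge_sq_top\<close> with the reproducing
  property.\<close>

lemma harmonic_pairing_scalar:
  assumes H: "harmonic_poly m d H" and d: "d = 2 * r0 + \<epsilon>" and eps: "\<epsilon> \<le> 1"
  shows "harmonic_pairing (real m) (normsq_m m y) (H y) \<epsilon> r0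
    (\<lambda>q n. gauss_exp m (\<lambda>x. inner_m m x y ^ (\<epsilon> + 2 * q) * wedge_sq m y x ^ n * H x))"
proof
  note h = harmonic_hpoly[OF H]
  show "\<epsilon> \<le> 1" by (rule eps)
  fix q n
  let ?Y = "normsq_m m y" and ?a = "\<epsilon> + 2 * q"
  let ?T = "\<lambda>a n. gauss_exp m (\<lambda>x. inner_m m x y ^ a * wedge_sq m y x ^ n * H x)"
  {
    have "(real (?a + 2 * n) - real d) * ?T ?a n =
      gauss_exp m (\<lambda>x. lap m (\<lambda>x. inner_m m x y ^ ?a * wedge_sq m y x ^ n) x * H x)"
      by (rule gauss_exp_harmonic[OF hpoly_kernel_term H])
    also have "\<dots> = gauss_exp m (\<lambda>x. (?Y * (real ?a * real (?a - 1))) * (inner_m m x y ^ (?a - 2) * wedge_sq m y x ^ n * H x)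
       + (?Y * (2 * real n * (2 * real n + real m - 3))) * (inner_m m x y ^ ?a * wedge_sq m y x ^ (n - 1) * H x))"
      unfolding lap_kernel_term by (intro arg_cong[of _ _ "gauss_exp m"] ext) (simp only: distrib_left distrib_right mult.assoc)
    also have "\<dots> = (?Y * (real ?a * real (?a - 1))) * ?T (?a - 2) n
       + (?Y * (2 * real n * (2 * real n + real m - 3))) * ?T ?a (n - 1)"
      unfolding gauss_exp_scale[symmetric]
      by (rule gauss_exp_add[OF hpoly_scale[OF hpoly_mult[OF hpoly_kernel_term h]]
        hpoly_scale[OF hpoly_mult[OF hpoly_kernel_term h]]])
    \<comment> \<open>For q = 0 the exponent is at most 1, so both coefficients vanish and the
      truncated exponents do not matter.\<close>
    also have "(?Y * (real ?a * real (?a - 1))) * ?T (?a - 2) n =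
      ?Y * ((real \<epsilon> + 2 * real q) * (real \<epsilon> + 2 * real q - 1)) * ?T (\<epsilon> + 2 * (q - 1)) n"
      using eps by (cases q; cases \<epsilon>) auto
    finally show "2 * (real q + real n - real r0) * ?T ?a n = ?Y *
      ((real \<epsilon> + 2 * real q) * (real \<epsilon> + 2 * real q - 1) * ?T (\<epsilon> + 2 * (q - 1)) n
       + 2 * real n * (2 * real n + real m - 3) * ?T ?a (n - 1))"
      by (simp add: d algebra_simps)
  next
    assume "q + n < r0"
    thus "?T ?a n = 0"
      using gauss_exp_harmonic_low[OF hpoly_kernel_term H] by (simp add: d)
  next
    assume r0: "q + n = r0"
    hence e: "?a * 1 + 2 * n = d" by (simp add: d)
    have "?T ?a n = (-1) ^ n * gauss_exp m (\<lambda>x. inner_m m x y ^ ?a * inner_m m x y ^ (2 * n) * H x)"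
      by (rule gauss_exp_wedge_sq_top[OF hpoly_power[OF hpoly_inner] H e])
    also have "(\<lambda>x. inner_m m x y ^ ?a * inner_m m x y ^ (2 * n) * H x) = (\<lambda>x. inner_m m x y ^ d * H x)"
      using e by (simp add: power_add[symmetric])
    finally show "?T ?a n = (-1) ^ n * fact (2 * r0 + \<epsilon>) * H y"
      using gauss_exp_inner_power(1)[OF H] by (simp add: d mult.assoc)
  }
qed

lemma hpoly_bivector:
  assumes "j < m" "k < m"
  shows "hpoly m 1 (\<lambda>x. x j * y k - x k * y j)"
  using hpoly_diff[OF hpoly_scale[OF hpoly_var[OF assms(1)], of "y k"] hpoly_scale[OF hpoly_var[OF assms(2)], of "y j"]]
  by (simp add: mult.commute)

lemma bivector_moment_rec:
  fixes y :: "nat \<Rightarrow> real"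
  assumes H: "harmonic_poly m d H" and jk: "j < m" "k < m"
  defines "T \<equiv> \<lambda>a n. gauss_exp m (\<lambda>x. inner_m m x y ^ a * wedge_sq m y x ^ n * ((x j * y k - x k * y j) * H x))"
  shows "(real (1 + (a + 2 * n)) - real d) * T a n =
      (normsq_m m y * (real a * real (a - 1))) * T (a - 2) n
    + (normsq_m m y * (2 * real n * (2 * real n + real (m + 2) - 3))) * T a (n - 1)"
proof -
  note h = harmonic_hpoly[OF H]
  let ?b = "\<lambda>x. x j * y k - x k * y j" and ?Y = "normsq_m m y"
  let ?K = "\<lambda>a n x. inner_m m x y ^ a * wedge_sq m y x ^ n"
  have bK: "hpoly m (1 + (a + 2 * n)) (\<lambda>x. ?b x * ?K a n x)" for a n
    by (intro hpoly_mult hpoly_bivector jk hpoly_kernel_term)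
  have T: "T a n = gauss_exp m (\<lambda>x. ?b x * ?K a n x * H x)" for a n
    unfolding T_def by (simp only: mult_ac)
  have "(real (1 + (a + 2 * n)) - real d) * T a n =
    gauss_exp m (\<lambda>x. lap m (\<lambda>x. ?b x * ?K a n x) x * H x)"
    unfolding T by (rule gauss_exp_harmonic[OF bK H])
  also have "\<dots> = gauss_exp m (\<lambda>x. (?Y * (real a * real (a - 1))) * (?b x * ?K (a - 2) n x * H x)
     + (?Y * (2 * real n * (2 * real n + real (m + 2) - 3))) * (?b x * ?K a (n - 1) x * H x))"
    unfolding lap_bivector_kernel_term[OF jk]
    by (intro arg_cong[of _ _ "gauss_exp m"] ext) (simp only: distrib_left distrib_right mult.assoc)
  also have "\<dots> = (?Y * (real a * real (a - 1))) * T (a - 2) n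
     + (?Y * (2 * real n * (2 * real n + real (m + 2) - 3))) * T a (n - 1)"
    unfolding T gauss_exp_scale[symmetric]
    by (rule gauss_exp_add[OF hpoly_scale[OF hpoly_mult[OF bK h]] hpoly_scale[OF hpoly_mult[OF bK h]]])
  finally show ?thesis .
qed

text \<open>The bivector coordinate takes up one degree of H, hence the \<open>Suc\<close>. Its
  factors x_j and x_k turn the reproducing property into derivatives of H.\<close>

lemma harmonic_pairing_bivector:
  fixes y :: "nat \<Rightarrow> real"
  assumes H: "harmonic_poly m d H" and d: "d = Suc (2 * r0 + \<epsilon>)" and eps: "\<epsilon> \<le> 1"
    and jk: "j < m" "k < m"
  shows "harmonic_pairing (real (m + 2)) (normsq_m m y) (y k * pd j H y - y j * pd k H y) \<epsilon> r0
    (\<lambda>q n. gauss_exp m (\<lambda>x. inner_m m x y ^ (\<epsilon> + 2 * q) * wedge_sq m y x ^ n * ((x j * y k - x k * y j) * H x)))"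
proof
  note h = harmonic_hpoly[OF H]
  show "\<epsilon> \<le> 1" by (rule eps)
  fix q n
  let ?Y = "normsq_m m y" and ?a = "\<epsilon> + 2 * q" and ?b = "\<lambda>x. x j * y k - x k * y j"
  let ?K = "\<lambda>a n x. inner_m m x y ^ a * wedge_sq m y x ^ n"
  let ?T = "\<lambda>a n. gauss_exp m (\<lambda>x. ?K a n x * (?b x * H x))"
  have T: "?T a n = gauss_exp m (\<lambda>x. ?b x * ?K a n x * H x)" for a n
    by (simp only: mult_ac)
  {
    have "real (1 + (?a + 2 * n)) - real d = 2 * (real q + real n - real r0)" by (simp add: d)
    moreover have "(?Y * (real ?a * real (?a - 1))) * ?T (?a - 2) n =
      ?Y * ((real \<epsilon> + 2 * real q) * (real \<epsilon> + 2 * real q - 1)) * ?T (\<epsilon> + 2 * (q - 1)) n"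
      using eps by (cases q; cases \<epsilon>) auto
    ultimately show "2 * (real q + real n - real r0) * ?T ?a n = ?Y *
      ((real \<epsilon> + 2 * real q) * (real \<epsilon> + 2 * real q - 1) * ?T (\<epsilon> + 2 * (q - 1)) n
       + 2 * real n * (2 * real n + real (m + 2) - 3) * ?T ?a (n - 1))"
      using bivector_moment_rec[OF H jk, of ?a n y] by (simp only: distrib_left mult.assoc)
  next
    assume "q + n < r0"
    hence "1 + (?a + 2 * n) < d" by (simp add: d)
    from gauss_exp_harmonic_low[OF hpoly_mult[OF hpoly_bivector[OF jk] hpoly_kernel_term] H this]
    show "?T ?a n = 0" unfolding T .
  next
    assume r0: "q + n = r0"
    hence e: "(1 + ?a * 1) + 2 * n = d" and e': "?a + 2 * n = 2 * r0 + \<epsilon>" by (simp_all add: d)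
    let ?d = "2 * r0 + \<epsilon>"
    have H': "harmonic_poly m (Suc ?d) H" using H d by simp
    have "?T ?a n = gauss_exp m (\<lambda>x. (?b x * inner_m m x y ^ ?a) * wedge_sq m y x ^ n * H x)"
      by (simp only: mult_ac)
    also have "\<dots> = (-1) ^ n * gauss_exp m (\<lambda>x. (?b x * inner_m m x y ^ ?a) * inner_m m x y ^ (2 * n) * H x)"
      by (rule gauss_exp_wedge_sq_top[OF hpoly_mult[OF hpoly_bivector[OF jk] hpoly_power[OF hpoly_inner]] H e])
    also have "(\<lambda>x. (?b x * inner_m m x y ^ ?a) * inner_m m x y ^ (2 * n) * H x) =
      (\<lambda>x. y k * (x j * (inner_m m x y ^ ?d * H x)) + (- y j) * (x k * (inner_m m x y ^ ?d * H x)))"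
      unfolding e'[symmetric] by (simp add: power_add fun_eq_iff algebra_simps)
    also have "gauss_exp m \<dots> = gauss_exp m (\<lambda>x. y k * (x j * (inner_m m x y ^ ?d * H x)))
      + gauss_exp m (\<lambda>x. (- y j) * (x k * (inner_m m x y ^ ?d * H x)))"
      by (rule gauss_exp_add[OF hpoly_scale[OF hpoly.coord[OF jk(1) hpoly_mult[OF hpoly_power[OF hpoly_inner] h]]]
        hpoly_scale[OF hpoly.coord[OF jk(2) hpoly_mult[OF hpoly_power[OF hpoly_inner] h]]]])
    also have "\<dots> = fact ?d * (y k * pd j H y - y j * pd k H y)"
      unfolding gauss_exp_scale gauss_exp_inner_power(2)[OF H' jk(1)] gauss_exp_inner_power(2)[OF H' jk(2)]
      by (simp add: algebra_simps)
    finally show "?T ?a n = (-1) ^ n * fact ?d * (y k * pd j H y - y j * pd k H y)"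
      by (simp only: mult.assoc)
  }
qed

text \<open>A constant H has no degree to spare for the bivector coordinate and escapes the previous
  lemma. The factor 1 + a + 2 n of the recursion is then positive throughout, so all moments vanish
  by induction.\<close>

lemma bivector_moment_degree_0:
  fixes y :: "nat \<Rightarrow> real"
  assumes H: "harmonic_poly m 0 H" and jk: "j < m" "k < m"
  shows "gauss_exp m (\<lambda>x. inner_m m x y ^ a * wedge_sq m y x ^ n * ((x j * y k - x k * y j) * H x)) = 0"
proof (induction "a + 2 * n" arbitrary: a n rule: less_induct)
  case less
  let ?T = "\<lambda>a n. gauss_exp m (\<lambda>x. inner_m m x y ^ a * wedge_sq m y x ^ n * ((x j * y k - x k * y j) * H x))"
  have "real a * real (a - 1) * ?T (a - 2) n = 0"
  proof (cases "a \<ge> 2")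
    case True thus ?thesis using less.hyps[of "a - 2" n] by simp
  next
    case False
    hence "a = 0 \<or> a = 1" by auto
    thus ?thesis by auto
  qed
  moreover have "real n * ?T a (n - 1) = 0"
    using less.hyps[of a "n - 1"] by (cases n) auto
  ultimately have "(real (1 + (a + 2 * n)) - real 0) * ?T a n = 0"
    unfolding bivector_moment_rec[OF H jk] by auto
  thus ?case by auto
qed

lemma scalar_kernel_transform:
  fixes y :: "nat \<Rightarrow> real" and p :: nat
  assumes H: "harmonic_poly m d H" and m: "even m" "i + 2 \<le> m"
  defines "F \<equiv> \<lambda>x. kern m i (inner_m m x y) (wedge_abs m x y) * (laguerre p (real m / 2 + real d - 1) (normsq_m m x) * H x)"
  shows "gauss_exp m F = (if even (i + d) then
      dfact (int d + int i - 1) / dfact (int d + int m - int i - 3) * H y *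
      ((-1) ^ p * laguerre p (real m / 2 + real d - 1) (normsq_m m y) * exp (- normsq_m m y / 2)) else 0)"
proof (cases "even (i + d)")
  case True
  hence md: "i mod 2 = d mod 2" by presburger
  have d: "d = 2 * (d div 2) + i mod 2" unfolding md by simp
  have "gauss_exp m F = dfact (int (2 * (d div 2) + i mod 2) + int i - 1) / dfact (int (2 * (d div 2) + i mod 2) + int m - int i - 3) * H y *
      ((-1) ^ p * laguerre p (real m / 2 + real d - 1) (normsq_m m y) * exp (- normsq_m m y / 2))"
    unfolding F_def
    by (rule kernel_transform_pairing[OF harmonic_hpoly[OF H] m harmonic_pairing_scalar[OF H d]])
       (simp_all add: d[symmetric])
  thus ?thesis using True unfolding d[symmetric] by simp
next
  case False
  have "gauss_exp m F = 0" unfolding F_def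
  proof (rule kernel_transform_zero[OF harmonic_hpoly[OF H] m])
    fix q n
    have "odd (i mod 2 + 2 * q + 2 * n + d)" using False by presburger
    thus "gauss_exp m (\<lambda>x. inner_m m x y ^ (i mod 2 + 2 * q) * wedge_sq m y x ^ n * H x) = 0"
      by (rule gauss_exp_odd[OF hpoly_mult[OF hpoly_kernel_term harmonic_hpoly[OF H]]])
  qed
  thus ?thesis using False by simp
qed

text \<open>The double factorials are those of the scalar case with d - 1 for d and m + 2 for
  m.\<close>

lemma bivector_kernel_transform:
  fixes y :: "nat \<Rightarrow> real" and p :: nat
  assumes H: "harmonic_poly m d H" and m: "even m" "i \<le> m" and jk: "j < m" "k < m"
  defines "F \<equiv> \<lambda>x. kern (m + 2) i (inner_m m x y) (wedge_abs m x y) *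
    (laguerre p (real m / 2 + real d - 1) (normsq_m m x) * ((x j * y k - x k * y j) * H x))"
  shows "gauss_exp m F = (if odd (i + d) then
      dfact (int d + int i - 2) / dfact (int d + int m - int i - 2) * (y k * pd j H y - y j * pd k H y) *
      ((-1) ^ p * laguerre p (real m / 2 + real d - 1) (normsq_m m y) * exp (- normsq_m m y / 2)) else 0)"
proof -
  have B: "hpoly m (1 + d) (\<lambda>x. (x j * y k - x k * y j) * H x)"
    by (intro hpoly_mult hpoly_bivector jk harmonic_hpoly[OF H])
  have m2: "even (m + 2)" "i + 2 \<le> m + 2" using m by auto
  show ?thesis
  proof (cases "odd (i + d)")
    case False
    have "gauss_exp m F = 0" unfolding F_def
    proof (rule kernel_transform_zero[OF B m2])
      fix q n
      have "odd (i mod 2 + 2 * q + 2 * n + (1 + d))" using False by presburger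
      thus "gauss_exp m (\<lambda>x. inner_m m x y ^ (i mod 2 + 2 * q) * wedge_sq m y x ^ n * ((x j * y k - x k * y j) * H x)) = 0"
        by (rule gauss_exp_odd[OF hpoly_mult[OF hpoly_kernel_term B]])
    qed
    thus ?thesis using False by simp
  next
    case odd: True
    show ?thesis
    proof (cases d)
      case 0
      have "gauss_exp m F = 0" unfolding F_def
        by (rule kernel_transform_zero[OF B m2]) (use bivector_moment_degree_0[OF _ jk] H 0 in simp)
      moreover have "pd l H = (\<lambda>_. 0)" for l using pd_hpoly_0 harmonic_hpoly[OF H] 0 by simp
      ultimately show ?thesis by simp
    next
      case (Suc d')
      have md: "i mod 2 = d' mod 2" using odd Suc by presburger
      have d': "2 * (d' div 2) + i mod 2 = d'" unfolding md by simp
      have d: "d = Suc (2 * (d' div 2) + i mod 2)" unfolding d' Suc ..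
      have "gauss_exp m F = dfact (int (2 * (d' div 2) + i mod 2) + int i - 1) /
        dfact (int (2 * (d' div 2) + i mod 2) + int (m + 2) - int i - 3) * (y k * pd j H y - y j * pd k H y) *
        ((-1) ^ p * laguerre p (real m / 2 + real d - 1) (normsq_m m y) * exp (- normsq_m m y / 2))"
        unfolding F_def
        by (rule kernel_transform_pairing[OF B m2 harmonic_pairing_bivector[OF H d _ jk]])
           (simp_all add: d' Suc)
      moreover have "int d' + int i - 1 = int d + int i - 2" "int d' + int (m + 2) - int i - 3 = int d + int m - int i - 2"
        using Suc by auto
      ultimately show ?thesis using odd unfolding d' by (simp only: simp_thms if_True)
    qed
  qed
qed

section \<open>Clifford multiplication and monogenics\<close>

definition toggle :: "nat \<Rightarrow> nat set \<Rightarrow> nat set" where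
  "toggle j C = (C - {j}) \<union> ({j} - C)"

text \<open>Counting b = j along with b < j folds the square e_j^2 = -1 into the reordering
  sign.\<close>

definition gen_sign :: "nat \<Rightarrow> nat set \<Rightarrow> real" where
  "gen_sign j B = (-1) ^ card {b \<in> B. b \<le> j}"

definition gen_mult :: "nat \<Rightarrow> cl \<Rightarrow> cl" where
  "gen_mult j u = (\<lambda>C. gen_sign j (toggle j C) * u (toggle j C))"

lemma toggle_toggle [simp]: "toggle j (toggle j C) = C"
  by (auto simp: toggle_def)

lemma toggle_commute: "toggle j (toggle k C) = toggle k (toggle j C)"
  by (auto simp: toggle_def)

lemma finite_toggle [simp]: "finite (toggle j C) = finite C"
  by (auto simp: toggle_def)

lemma toggle_subset: "j < m \<Longrightarrow> toggle j C \<subseteq> {..<m} \<longleftrightarrow> C \<subseteq> {..<m}"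
  by (auto simp: toggle_def)

lemma gen_sign_square: "gen_sign j B * gen_sign j B = 1"
  by (simp add: gen_sign_def power_mult_distrib[symmetric])

lemma gen_sign_toggle:
  assumes "finite C"
  shows "gen_sign j (toggle k C) = (if k \<le> j then - gen_sign j C else gen_sign j C)"
proof -
  consider "k > j" | "k \<le> j" "k \<in> C" | "k \<le> j" "k \<notin> C" by linarith
  thus ?thesis
  proof cases
    case 1
    hence "{b \<in> toggle k C. b \<le> j} = {b \<in> C. b \<le> j}" by (auto simp: toggle_def)
    thus ?thesis using 1 by (simp add: gen_sign_def)
  next
    case 2
    hence "{b \<in> C. b \<le> j} = insert k {b \<in> toggle k C. b \<le> j}" by (auto simp: toggle_def)
    moreover have "k \<notin> {b \<in> toggle k C. b \<le> j}" using 2 by (auto simp: toggle_def)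
    ultimately have "card {b \<in> C. b \<le> j} = Suc (card {b \<in> toggle k C. b \<le> j})"
      using assms by simp
    thus ?thesis using 2 by (simp add: gen_sign_def)
  next
    case 3
    hence "{b \<in> toggle k C. b \<le> j} = insert k {b \<in> C. b \<le> j}" by (auto simp: toggle_def)
    moreover have "k \<notin> {b \<in> C. b \<le> j}" using 3 by auto
    ultimately have "card {b \<in> toggle k C. b \<le> j} = Suc (card {b \<in> C. b \<le> j})"
      using assms by simp
    thus ?thesis using 3 by (simp add: gen_sign_def)
  qed
qed

lemma gen_mult_self: "finite C \<Longrightarrow> gen_mult j (gen_mult j u) C = - u C"
  using gen_sign_square[of j C] by (simp add: gen_mult_def gen_sign_toggle)

lemma gen_mult_anticommute:
  "finite C \<Longrightarrow> j \<noteq> k \<Longrightarrow> gen_mult j (gen_mult k u) C = - gen_mult k (gen_mult j u) C"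
  by (auto simp: gen_mult_def gen_sign_toggle toggle_commute[of k j])

lemma gen_mult_anticommutator:
  "finite C \<Longrightarrow> gen_mult j (gen_mult k u) C + gen_mult k (gen_mult j u) C = (if j = k then - 2 * u C else 0)"
  by (auto simp: gen_mult_self gen_mult_anticommute[of C j k])

lemma gen_mult_sum: "gen_mult j (\<lambda>C. \<Sum>i\<in>I. u i C) C = (\<Sum>i\<in>I. gen_mult j (u i) C)"
  by (simp add: gen_mult_def sum_distrib_left)

lemma gen_mult_scale: "gen_mult j (\<lambda>C. r * u C) C = r * gen_mult j u C"
  by (simp add: gen_mult_def)

lemma gen_mult_cong:
  "(\<And>C. C \<subseteq> {..<m} \<Longrightarrow> u C = v C) \<Longrightarrow> j < m \<Longrightarrow> C \<subseteq> {..<m} \<Longrightarrow> gen_mult j u C = gen_mult j v C"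
  by (simp add: gen_mult_def toggle_subset)

definition blade_xor :: "nat set \<Rightarrow> nat set \<Rightarrow> nat set" where
  "blade_xor A B = (A - B) \<union> (B - A)"

lemma cl_mult_left:
  "cl_mult m u v C = (if C \<subseteq> {..<m} then
     \<Sum>A\<in>Pow {..<m}. u A * (cl_sign A (blade_xor A C) * v (blade_xor A C)) else 0)"
proof -
  have "(\<Sum>B\<in>Pow {..<m}. if (A - B) \<union> (B - A) = C then cl_sign A B * u A * v B else 0) =
    (if C \<subseteq> {..<m} then u A * (cl_sign A (blade_xor A C) * v (blade_xor A C)) else 0)"
    if "A \<in> Pow {..<m}" for A
  proof -
    have eq: "((A - B) \<union> (B - A) = C) = (B = blade_xor A C)" for B by (auto simp: blade_xor_def)
    have mem: "blade_xor A C \<in> Pow {..<m} \<longleftrightarrow> C \<subseteq> {..<m}" using that by (auto simp: blade_xor_def)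
    show ?thesis unfolding eq using mem
      by (auto simp: sum.delta mult_ac)
  qed
  thus ?thesis by (auto simp: cl_mult_def)
qed

lemma cl_mult_scalar: "C \<subseteq> {..<m} \<Longrightarrow> cl_mult m (cl_scalar r) v C = r * v C"
proof -
  assume C: "C \<subseteq> {..<m}"
  have "cl_mult m (cl_scalar r) v C =
    (\<Sum>A\<in>Pow {..<m}. if A = {} then r * (cl_sign A (blade_xor A C) * v (blade_xor A C)) else 0)"
    unfolding cl_mult_left cl_scalar_def if_P[OF C] by (intro sum.cong refl) simp
  also have "\<dots> = r * v C" by (simp add: sum.delta cl_sign_def blade_xor_def)
  finally show ?thesis .
qed

lemma cl_mult_add_left: "cl_mult m (cl_add u w) v C = cl_mult m u v C + cl_mult m w v C"
  by (simp add: cl_mult_left cl_add_def sum.distrib distrib_right)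

lemma cl_mult_scale_left: "cl_mult m (cl_scale r u) v C = r * cl_mult m u v C"
  by (simp add: cl_mult_left cl_scale_def sum_distrib_left mult_ac)

lemma cl_sign_single: "cl_sign {j} B = gen_sign j B" if "finite B"
proof -
  have eq: "{(a, b). a \<in> {j} \<and> b \<in> B \<and> b < a} = Pair j ` {b \<in> B. b < j}" by auto
  have c1: "card {(a, b). a \<in> {j} \<and> b \<in> B \<and> b < a} = card {b \<in> B. b < j}"
    unfolding eq by (intro card_image) (auto simp: inj_on_def)
  have "{b \<in> B. b \<le> j} = {b \<in> B. b < j} \<union> ({j} \<inter> B)" by auto
  moreover have "card ({b \<in> B. b < j} \<union> ({j} \<inter> B)) = card {b \<in> B. b < j} + card ({j} \<inter> B)"
    using that by (intro card_Un_disjoint) auto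
  ultimately show ?thesis unfolding cl_sign_def gen_sign_def c1 by simp
qed

lemma cl_sign_pair: "cl_sign {j, k} B = gen_sign j B * gen_sign k B" if "finite B" "j < k"
proof -
  let ?S = "\<lambda>A. {(a, b). a \<in> A \<and> b \<in> B \<and> b < a}"
  have fin: "finite (?S A)" if "finite A" for A
    by (rule finite_subset[of _ "A \<times> B"]) (use that \<open>finite B\<close> in auto)
  have "?S {j, k} = ?S {j} \<union> ?S {k}" by auto
  moreover have "card (?S {j} \<union> ?S {k}) = card (?S {j}) + card (?S {k})"
    using that by (intro card_Un_disjoint fin) auto
  moreover have "{j, k} \<inter> B = ({j} \<inter> B) \<union> ({k} \<inter> B)" by auto
  moreover have "card (({j} \<inter> B) \<union> ({k} \<inter> B)) = card ({j} \<inter> B) + card ({k} \<inter> B)"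
    using that by (intro card_Un_disjoint) auto
  ultimately have "cl_sign {j, k} B = cl_sign {j} B * cl_sign {k} B"
    unfolding cl_sign_def by (simp add: power_add)
  thus ?thesis by (simp add: cl_sign_single that)
qed

lemma cl_sign_single_mult:
  "finite C \<Longrightarrow> cl_sign {j} (blade_xor {j} C) * v (blade_xor {j} C) = gen_mult j v C"
proof -
  assume "finite C"
  moreover have "blade_xor {j} C = toggle j C" by (auto simp: blade_xor_def toggle_def)
  ultimately show ?thesis by (simp add: cl_sign_single gen_mult_def)
qed

lemma cl_sign_pair_mult:
  assumes "finite C" "j < k"
  shows "cl_sign {j, k} (blade_xor {j, k} C) * v (blade_xor {j, k} C) = gen_mult j (gen_mult k v) C"
proof -
  define B where "B = toggle k (toggle j C)"
  have "blade_xor {j, k} C = B" using assms by (auto simp: blade_xor_def toggle_def B_def)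
  \<comment> \<open>As j < k, toggling k does not affect the sign of e_j, so the two generator signs
    multiply to that of the blade {j, k}.\<close>
  moreover have "toggle j C = toggle k B" by (simp add: B_def)
  moreover have "finite B" using assms by (simp add: B_def)
  ultimately show ?thesis using assms
    by (simp add: cl_sign_pair gen_mult_def gen_sign_toggle)
qed

lemma cl_mult_sum_left:
  assumes "finite J" "C \<subseteq> {..<m}" "\<And>j. j \<in> J \<Longrightarrow> S j \<subseteq> {..<m}"
  shows "cl_mult m (\<lambda>A. \<Sum>j\<in>J. if A = S j then c j else 0) v C =
    (\<Sum>j\<in>J. c j * (cl_sign (S j) (blade_xor (S j) C) * v (blade_xor (S j) C)))"
proof -
  have "cl_mult m (\<lambda>A. \<Sum>j\<in>J. if A = S j then c j else 0) v C =
    (\<Sum>A\<in>Pow {..<m}. \<Sum>j\<in>J. if A = S j then c j * (cl_sign A (blade_xor A C) * v (blade_xor A C)) else 0)"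
    unfolding cl_mult_left using assms(2) by (auto simp: sum_distrib_right intro!: sum.cong)
  also have "\<dots> = (\<Sum>j\<in>J. \<Sum>A\<in>Pow {..<m}. if A = S j then c j * (cl_sign A (blade_xor A C) * v (blade_xor A C)) else 0)"
    by (rule sum.swap)
  also have "\<dots> = (\<Sum>j\<in>J. c j * (cl_sign (S j) (blade_xor (S j) C) * v (blade_xor (S j) C)))"
    using assms(3) by (intro sum.cong refl) (auto simp: sum.delta)
  finally show ?thesis .
qed

lemma cl_mult_gen:
  assumes "j < m" "C \<subseteq> {..<m}" shows "cl_mult m (cl_e j) v C = gen_mult j v C"
  using cl_mult_sum_left[of "{j}" C m "\<lambda>j. {j}" "\<lambda>_. 1" v] assms
    cl_sign_single_mult[OF finite_subset[OF assms(2)]]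
  by (simp add: cl_e_def)

lemma cl_mult_vec:
  assumes "C \<subseteq> {..<m}" shows "cl_mult m (cl_vec m x) v C = (\<Sum>j<m. x j * gen_mult j v C)"
  unfolding cl_vec_def using assms
  by (subst cl_mult_sum_left) (auto simp: cl_sign_single_mult[OF finite_subset[OF assms]])

lemma cl_mult_wedge:
  assumes "C \<subseteq> {..<m}"
  shows "cl_mult m (cl_wedge m x y) v C =
    (\<Sum>(j, k)\<in>{(j, k). j < k \<and> k < m}. (x j * y k - x k * y j) * gen_mult j (gen_mult k v) C)"
proof -
  let ?J = "{(j, k). j < k \<and> k < m}"
  have fin: "finite ?J" by (rule finite_subset[of _ "{..<m} \<times> {..<m}"]) auto
  have "cl_wedge m x y A = (\<Sum>j\<in>?J. if A = {fst j, snd j} then x (fst j) * y (snd j) - x (snd j) * y (fst j) else 0)" for A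
  proof -
    have "cl_wedge m x y A = (\<Sum>j\<in>{..<m} \<times> {..<m}. if j \<in> ?J then
       (if A = {fst j, snd j} then x (fst j) * y (snd j) - x (snd j) * y (fst j) else 0) else 0)"
      unfolding cl_wedge_def sum.cartesian_product by (intro sum.cong refl, simp split: prod.splits, auto)
    also have "\<dots> = (\<Sum>j\<in>({..<m} \<times> {..<m}) \<inter> ?J. if A = {fst j, snd j} then x (fst j) * y (snd j) - x (snd j) * y (fst j) else 0)"
      by (rule sum.inter_restrict[symmetric]) auto
    also have "({..<m} \<times> {..<m}) \<inter> ?J = ?J" by auto
    finally show ?thesis .
  qed
  hence "cl_wedge m x y = (\<lambda>A. \<Sum>j\<in>?J. if A = {fst j, snd j} then x (fst j) * y (snd j) - x (snd j) * y (fst j) else 0)"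
    by (rule ext)
  hence "cl_mult m (cl_wedge m x y) v C = (\<Sum>j\<in>?J. (x (fst j) * y (snd j) - x (snd j) * y (fst j)) *
     (cl_sign {fst j, snd j} (blade_xor {fst j, snd j} C) * v (blade_xor {fst j, snd j} C)))"
    by (simp only:) (rule cl_mult_sum_left[OF fin assms], auto)
  also have "\<dots> = (\<Sum>(j, k)\<in>?J. (x j * y k - x k * y j) * gen_mult j (gen_mult k v) C)"
    by (intro sum.cong refl) (auto simp: cl_sign_pair_mult[OF finite_subset[OF assms]])
  finally show ?thesis .
qed

section \<open>Clifford-valued polynomials and the Dirac operator\<close>

definition cl_pd :: "nat \<Rightarrow> ((nat \<Rightarrow> real) \<Rightarrow> cl) \<Rightarrow> (nat \<Rightarrow> real) \<Rightarrow> cl" where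
  "cl_pd j H x = (\<lambda>C. pd j (\<lambda>x. H x C) x)"

text \<open>The support condition lets identities between functions be checked on genuine blades
  only: at all other index sets both H and every Clifford product are zero.\<close>

definition cl_hpoly :: "nat \<Rightarrow> nat \<Rightarrow> ((nat \<Rightarrow> real) \<Rightarrow> cl) \<Rightarrow> bool" where
  "cl_hpoly m d H \<longleftrightarrow> (\<forall>C. hpoly m d (\<lambda>x. H x C)) \<and> (\<forall>x C. \<not> C \<subseteq> {..<m} \<longrightarrow> H x C = 0)"

lemma cl_hpolyD: "cl_hpoly m d H \<Longrightarrow> hpoly m d (\<lambda>x. H x C)"
  by (simp add: cl_hpoly_def)

lemma pd_gen_mult: "cl_hpoly m d H \<Longrightarrow> pd k (\<lambda>x. gen_mult j (H x) C) x = gen_mult j (cl_pd k H x) C"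
  unfolding gen_mult_def cl_pd_def by (simp add: pd_scale[OF cl_hpolyD])

lemma cl_hpoly_pd: "cl_hpoly m d H \<Longrightarrow> cl_hpoly m (d - 1) (cl_pd j H)"
  unfolding cl_hpoly_def cl_pd_def by (auto intro: hpoly_pd[unfolded One_nat_def])

lemma cl_hpoly_gen_mult: "cl_hpoly m d H \<Longrightarrow> hpoly m d (\<lambda>x. gen_mult j (H x) C)"
  unfolding gen_mult_def by (intro hpoly_scale cl_hpolyD)

text \<open>Anticommuting e_j and e_k turns the sum over j < k into minus the off-diagonal part of
  the product of the vector y with the Dirac operator. The diagonal of that product is minus the
  Euler operator.\<close>

lemma bivector_derivative_sum:
  assumes H: "cl_hpoly m d H" and C: "C \<subseteq> {..<m}"
  shows "(\<Sum>(j, k)\<in>{(j, k). j < k \<and> k < m}. y k * gen_mult j (gen_mult k (cl_pd j H y)) C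
       - y j * gen_mult j (gen_mult k (cl_pd k H y)) C)
    = - (\<Sum>j<m. y j * gen_mult j (\<lambda>C. \<Sum>k<m. gen_mult k (cl_pd k H y) C) C) - real d * H y C"
proof -
  let ?J = "{(j, k). j < k \<and> k < m}"
  let ?t = "\<lambda>j k. y j * gen_mult j (gen_mult k (cl_pd k H y)) C"
  have fin: "finite C" using C finite_subset by blast
  have finJ: "finite ?J" by (rule finite_subset[of _ "{..<m} \<times> {..<m}"]) auto
  have "(\<Sum>(j, k)\<in>?J. y k * gen_mult j (gen_mult k (cl_pd j H y)) C - ?t j k) = (\<Sum>(j, k)\<in>?J. - ?t k j - ?t j k)"
  proof (intro sum.cong refl, clarify)
    fix j k :: nat assume "j < k"
    hence "gen_mult j (gen_mult k (cl_pd j H y)) C = - gen_mult k (gen_mult j (cl_pd j H y)) C"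
      by (intro gen_mult_anticommute[OF fin]) simp
    thus "y k * gen_mult j (gen_mult k (cl_pd j H y)) C - ?t j k = - ?t k j - ?t j k" by simp
  qed
  also have "\<dots> = - ((\<Sum>(j, k)\<in>?J. ?t k j) + (\<Sum>(j, k)\<in>?J. ?t j k))"
    unfolding sum.distrib[symmetric] sum_negf[symmetric] by (intro sum.cong refl) auto
  also have "(\<Sum>(j, k)\<in>?J. ?t k j) = (\<Sum>(j, k)\<in>{(j, k). k < j \<and> j < m}. ?t j k)"
    by (intro sum.reindex_bij_witness[of _ prod.swap prod.swap]) auto
  also have "(\<Sum>(j, k)\<in>{(j, k). k < j \<and> j < m}. ?t j k) + (\<Sum>(j, k)\<in>?J. ?t j k)
     = (\<Sum>(j, k)\<in>{(j, k). k < j \<and> j < m} \<union> ?J. ?t j k)"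
    by (rule sum.union_disjoint[symmetric]) (auto intro: finite_subset[of _ "{..<m} \<times> {..<m}"])
  also have "{(j, k). k < j \<and> j < m} \<union> ?J = {..<m} \<times> {..<m} - (\<lambda>j. (j, j)) ` {..<m}" by auto
  also have "(\<Sum>(j, k)\<in>{..<m} \<times> {..<m} - (\<lambda>j. (j, j)) ` {..<m}. ?t j k) =
     (\<Sum>(j, k)\<in>{..<m} \<times> {..<m}. ?t j k) - (\<Sum>(j, k)\<in>(\<lambda>j. (j, j)) ` {..<m}. ?t j k)"
    by (rule sum_diff) auto
  also have "(\<Sum>(j, k)\<in>(\<lambda>j. (j, j)) ` {..<m}. ?t j k) = - (\<Sum>j<m. y j * cl_pd j H y C)"
    by (subst sum.reindex) (auto simp: inj_on_def gen_mult_self[OF fin] sum_negf)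
  also have "(\<Sum>j<m. y j * cl_pd j H y C) = real d * H y C"
    unfolding cl_pd_def by (rule euler[OF cl_hpolyD[OF H]])
  also have "(\<Sum>(j, k)\<in>{..<m} \<times> {..<m}. ?t j k) = (\<Sum>j<m. y j * gen_mult j (\<lambda>C. \<Sum>k<m. gen_mult k (cl_pd k H y) C) C)"
    by (simp add: sum.cartesian_product[symmetric] gen_mult_sum sum_distrib_left)
  finally show ?thesis by simp
qed

text \<open>The Dirac operator squares to minus the Laplacian: symmetrising the double sum leaves
  only the diagonal of the anticommutators.\<close>

lemma monogenic_harmonic:
  assumes M: "cl_hpoly m d M"
    and dirac0: "\<And>x C. C \<subseteq> {..<m} \<Longrightarrow> (\<Sum>j<m. gen_mult j (cl_pd j M x) C) = 0"
    and C: "C \<subseteq> {..<m}"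
  shows "lap m (\<lambda>x. M x C) x = 0"
proof -
  have fin: "finite C" using C finite_subset by blast
  let ?D = "\<lambda>j k. cl_pd k (cl_pd j M) x"
  let ?S = "\<Sum>k<m. \<Sum>j<m. gen_mult k (gen_mult j (?D j k)) C"
  have sym: "?D j k = ?D k j" for j k
    unfolding cl_pd_def by (rule ext) (simp add: pd_commute[OF cl_hpolyD[OF M]])
  have "(\<Sum>j<m. gen_mult k (gen_mult j (?D j k)) C) = 0" if "k < m" for k
  proof -
    have "(\<Sum>j<m. gen_mult j (?D j k) C') = 0" if "C' \<subseteq> {..<m}" for C'
    proof -
      have "(\<Sum>j<m. gen_mult j (?D j k) C') = (\<Sum>j<m. pd k (\<lambda>x. gen_mult j (cl_pd j M x) C') x)"
        by (simp add: pd_gen_mult[OF cl_hpoly_pd[OF M]])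
      also have "\<dots> = pd k (\<lambda>x. \<Sum>j<m. gen_mult j (cl_pd j M x) C') x"
        by (simp only: pd_sum[OF cl_hpoly_gen_mult[OF cl_hpoly_pd[OF M]]])
      finally show ?thesis by (simp add: dirac0[OF that])
    qed
    hence "gen_mult k (\<lambda>C. \<Sum>j<m. gen_mult j (?D j k) C) C = gen_mult k (\<lambda>_. 0) C"
      by (intro gen_mult_cong[OF _ that C]) auto
    thus ?thesis unfolding gen_mult_sum by (simp add: gen_mult_def)
  qed
  hence S0: "?S = 0" by simp
  have "?S = (\<Sum>k<m. \<Sum>j<m. gen_mult j (gen_mult k (?D j k)) C)"
    by (subst sum.swap) (simp add: sym)
  hence "2 * ?S = (\<Sum>k<m. \<Sum>j<m. gen_mult k (gen_mult j (?D j k)) C + gen_mult j (gen_mult k (?D j k)) C)"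
    by (simp add: sum.distrib)
  also have "\<dots> = (\<Sum>k<m. - 2 * ?D k k C)"
    by (intro sum.cong refl) (simp add: gen_mult_anticommutator[OF fin])
  also have "\<dots> = - 2 * lap m (\<lambda>x. M x C) x"
    by (simp add: lap_def cl_pd_def sum_distrib_left sum_negf)
  finally show ?thesis using S0 by simp
qed

lemma hpoly_prod:
  assumes "finite J" "J \<subseteq> {..<m}"
  shows "hpoly m (\<Sum>j\<in>J. \<alpha> j) (\<lambda>x. \<Prod>j\<in>J. x j ^ \<alpha> j)"
  using assms
proof (induction J rule: finite_induct)
  case empty show ?case using hpoly.const[of m 1] by simp
next
  case (insert j J)
  have "hpoly m (\<alpha> j * 1 + (\<Sum>j\<in>J. \<alpha> j)) (\<lambda>x. x j ^ \<alpha> j * (\<Prod>j\<in>J. x j ^ \<alpha> j))"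
    using insert by (intro hpoly_mult hpoly_power hpoly_var) auto
  thus ?case using insert.hyps by simp
qed

lemma cl_partial_eq:
  assumes "cl_hpoly m d M" shows "cl_partial M j x = cl_pd j M x"
proof
  fix A
  have "((\<lambda>h. M (x(j := h)) A) has_real_derivative cl_pd j M x A) (at (0 + x j))"
    using hpoly_DERIV[OF cl_hpolyD[OF assms], where x = x and j = j] by (simp add: cl_pd_def)
  hence "((\<lambda>h. M (x(j := x j + h)) A) has_real_derivative cl_pd j M x A) (at 0)"
    by (subst (asm) DERIV_shift) (simp add: add.commute)
  thus "cl_partial M j x A = cl_pd j M x A" unfolding cl_partial_def by (rule DERIV_imp_deriv)
qed

lemma monogenic_cl_hpoly:
  assumes "M \<in> spherical_monogenics m k" shows "cl_hpoly m k M"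
proof -
  from assms obtain c where c: "\<And>\<alpha> A. \<not> A \<subseteq> {..<m} \<Longrightarrow> c \<alpha> A = 0"
    and M: "\<And>x. M x = (\<lambda>A. \<Sum>\<alpha>\<in>multi_idx m k. c \<alpha> A * (\<Prod>j<m. x j ^ \<alpha> j))"
    unfolding spherical_monogenics_def by blast
  have "hpoly m k (\<lambda>x. \<Sum>\<alpha>\<in>multi_idx m k. c \<alpha> C * (\<Prod>j<m. x j ^ \<alpha> j))" for C
  proof (rule hpoly_sum)
    fix \<alpha> assume "\<alpha> \<in> multi_idx m k"
    hence "(\<Sum>j<m. \<alpha> j) = k" by (simp add: multi_idx_def)
    with hpoly_prod[of "{..<m}" m \<alpha>] show "hpoly m k (\<lambda>x. c \<alpha> C * (\<Prod>j<m. x j ^ \<alpha> j))"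
      by (intro hpoly_scale) auto
  qed
  thus ?thesis using c by (auto simp: cl_hpoly_def M intro: sum.neutral)
qed

lemma monogenic_dirac:
  assumes "M \<in> spherical_monogenics m k" "C \<subseteq> {..<m}"
  shows "(\<Sum>j<m. gen_mult j (cl_pd j M x) C) = 0"
proof -
  have "dirac m M x = (\<lambda>A. 0)" using assms(1) by (simp add: spherical_monogenics_def)
  hence "dirac m M x C = 0" by simp
  thus ?thesis
    by (simp add: dirac_def cl_partial_eq[OF monogenic_cl_hpoly[OF assms(1)]] cl_mult_gen[OF _ assms(2)])
qed

lemma cl_hpoly_vec_mult:
  assumes "cl_hpoly m d M"
  shows "cl_hpoly m (Suc d) (\<lambda>x. cl_mult m (cl_vec m x) (M x))"
proof -
  have "hpoly m (Suc d) (\<lambda>x. cl_mult m (cl_vec m x) (M x) C)" for C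
  proof (cases "C \<subseteq> {..<m}")
    case True
    have "hpoly m (Suc d) (\<lambda>x. \<Sum>j<m. x j * gen_mult j (M x) C)"
      by (rule hpoly_sum, rule hpoly.coord[OF _ cl_hpoly_gen_mult[OF assms]]) simp
    thus ?thesis using True by (simp add: cl_mult_vec)
  qed (simp add: cl_mult_left hpoly.zero)
  thus ?thesis by (auto simp: cl_hpoly_def cl_mult_left)
qed

lemma pd_coord_gen_mult:
  assumes "cl_hpoly m d M" "j < m"
  shows "pd k (\<lambda>x. x j * gen_mult j (M x) C) x = (if j = k then gen_mult j (M x) C else 0) + x j * gen_mult j (cl_pd k M x) C"
  using pd_mult[OF hpoly_var[OF assms(2)] cl_hpoly_gen_mult[OF assms(1)], of k j C]
  by (simp add: pd_coord pd_gen_mult[OF assms(1)])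

lemma cl_pd_vec_mult:
  assumes M: "cl_hpoly m d M" and C: "C \<subseteq> {..<m}" and k: "k < m"
  shows "cl_pd k (\<lambda>x. cl_mult m (cl_vec m x) (M x)) x C =
    gen_mult k (M x) C + (\<Sum>j<m. x j * gen_mult j (cl_pd k M x) C)"
proof -
  have "cl_pd k (\<lambda>x. cl_mult m (cl_vec m x) (M x)) x C = pd k (\<lambda>x. \<Sum>j<m. x j * gen_mult j (M x) C) x"
    by (simp add: cl_pd_def cl_mult_vec[OF C])
  also have "\<dots> = (\<Sum>j<m. pd k (\<lambda>x. x j * gen_mult j (M x) C) x)"
    by (subst pd_sum[where d = "Suc d"]) (auto intro: hpoly.coord cl_hpoly_gen_mult[OF M])
  also have "\<dots> = (\<Sum>j<m. (if j = k then gen_mult j (M x) C else 0) + x j * gen_mult j (cl_pd k M x) C)"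
    by (intro sum.cong refl pd_coord_gen_mult[OF M]) simp
  finally show ?thesis using k by (simp add: sum.distrib)
qed

text \<open>Moving the Dirac operator past the vector x yields -m from differentiating x, -2 d from
  the anticommutators by Euler's identity, and a remainder in which the operator acts on M and gives
  zero.\<close>

lemma dirac_vec_mult:
  assumes M: "cl_hpoly m d M" and C: "C \<subseteq> {..<m}"
    and dirac0: "\<And>C. C \<subseteq> {..<m} \<Longrightarrow> (\<Sum>j<m. gen_mult j (cl_pd j M x) C) = 0"
  shows "(\<Sum>k<m. gen_mult k (cl_pd k (\<lambda>x. cl_mult m (cl_vec m x) (M x)) x) C) = - (real m + 2 * real d) * M x C"
proof -
  have fin: "finite C" using C finite_subset by blast
  let ?g = "\<lambda>k j. x j * gen_mult k (gen_mult j (cl_pd k M x)) C"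
  have "gen_mult k (cl_pd k (\<lambda>x. cl_mult m (cl_vec m x) (M x)) x) C = - M x C + (\<Sum>j<m. ?g k j)" if "k < m" for k
  proof -
    have "gen_mult k (cl_pd k (\<lambda>x. cl_mult m (cl_vec m x) (M x)) x) C =
      gen_mult k (\<lambda>C. gen_mult k (M x) C + (\<Sum>j<m. x j * gen_mult j (cl_pd k M x) C)) C"
      by (rule gen_mult_cong[OF cl_pd_vec_mult[OF M _ that] that C])
    also have "\<dots> = gen_mult k (gen_mult k (M x)) C + (\<Sum>j<m. ?g k j)"
      unfolding gen_mult_sum[symmetric] gen_mult_scale[symmetric] by (simp add: gen_mult_def distrib_left)
    finally show ?thesis by (simp add: gen_mult_self[OF fin])
  qed
  hence "(\<Sum>k<m. gen_mult k (cl_pd k (\<lambda>x. cl_mult m (cl_vec m x) (M x)) x) C) =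
     - real m * M x C + (\<Sum>k<m. \<Sum>j<m. ?g k j)"
    by (simp add: sum_subtractf)
  also have "(\<Sum>k<m. \<Sum>j<m. ?g k j) = (\<Sum>k<m. \<Sum>j<m. (if j = k then - 2 * (x k * cl_pd k M x C) else 0)
      - x j * gen_mult j (gen_mult k (cl_pd k M x)) C)"
  proof (intro sum.cong refl)
    fix k j
    define a b where "a = gen_mult k (gen_mult j (cl_pd k M x)) C"
      and "b = gen_mult j (gen_mult k (cl_pd k M x)) C"
    have "a + b = (if k = j then - 2 * cl_pd k M x C else 0)"
      unfolding a_def b_def by (rule gen_mult_anticommutator[OF fin])
    hence "a = (if k = j then - 2 * cl_pd k M x C else 0) - b" by simp
    hence "x j * a = (if j = k then - 2 * (x k * cl_pd k M x C) else 0) - x j * b"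
      by (cases "j = k") (simp_all add: right_diff_distrib)
    thus "?g k j = (if j = k then - 2 * (x k * cl_pd k M x C) else 0) - x j * gen_mult j (gen_mult k (cl_pd k M x)) C"
      unfolding a_def b_def .
  qed
  also have "\<dots> = - 2 * (\<Sum>k<m. x k * cl_pd k M x C) - (\<Sum>k<m. \<Sum>j<m. x j * gen_mult j (gen_mult k (cl_pd k M x)) C)"
    by (simp add: sum_subtractf sum_distrib_left)
  also have "(\<Sum>k<m. x k * cl_pd k M x C) = real d * M x C"
    unfolding cl_pd_def by (rule euler[OF cl_hpolyD[OF M]])
  also have "(\<Sum>k<m. \<Sum>j<m. x j * gen_mult j (gen_mult k (cl_pd k M x)) C) = 0"
  proof -
    have "(\<Sum>k<m. \<Sum>j<m. x j * gen_mult j (gen_mult k (cl_pd k M x)) C) =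
      (\<Sum>j<m. x j * gen_mult j (\<lambda>C. \<Sum>k<m. gen_mult k (cl_pd k M x) C) C)"
      by (subst sum.swap) (simp add: gen_mult_sum sum_distrib_left)
    also have "\<dots> = (\<Sum>j<m. x j * gen_mult j (\<lambda>_. 0) C)"
      by (intro sum.cong arg_cong2[of _ _ _ _ "(*)"] refl gen_mult_cong[OF dirac0 _ C]) auto
    finally show ?thesis by (simp add: gen_mult_def)
  qed
  finally show ?thesis by (simp add: algebra_simps)
qed

text \<open>The Laplacian of x_j f is 2 times the j-th derivative of f when f is harmonic; summed
  with the generators this is twice the Dirac operator on M.\<close>

lemma vec_mult_harmonic:
  assumes M: "cl_hpoly m d M" and C: "C \<subseteq> {..<m}"
    and dirac0: "\<And>x C. C \<subseteq> {..<m} \<Longrightarrow> (\<Sum>j<m. gen_mult j (cl_pd j M x) C) = 0"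
  shows "lap m (\<lambda>x. cl_mult m (cl_vec m x) (M x) C) x = 0"
proof -
  have lapj: "lap m (\<lambda>x. x j * gen_mult j (M x) C) x = 2 * gen_mult j (cl_pd j M x) C" if j: "j < m" for j
  proof -
    have l0: "lap m (\<lambda>x. gen_mult j (M x) C) x = 0"
      unfolding gen_mult_def lap_scale[OF cl_hpolyD[OF M]]
      using monogenic_harmonic[OF M dirac0] C j by (simp add: toggle_subset)
    have lv: "lap m (\<lambda>x. x j) x = 0" by (simp add: lap_def pd_coord)
    have "(\<Sum>i<m. pd i (\<lambda>x. x j) x * pd i (\<lambda>x. gen_mult j (M x) C) x) =
      (\<Sum>i<m. if i = j then gen_mult j (cl_pd i M x) C else 0)"
      by (intro sum.cong refl) (auto simp: pd_coord pd_gen_mult[OF M])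
    thus ?thesis
      unfolding lap_mult[OF hpoly_var[OF j] cl_hpoly_gen_mult[OF M]] l0 lv using j by simp
  qed
  have h: "hpoly m (Suc d) (\<lambda>x. x j * gen_mult j (M x) C)" if "j < m" for j
    by (rule hpoly.coord[OF that cl_hpoly_gen_mult[OF M]])
  have "lap m (\<lambda>x. cl_mult m (cl_vec m x) (M x) C) x = (\<Sum>i<m. pd i (pd i (\<lambda>x. \<Sum>j<m. x j * gen_mult j (M x) C)) x)"
    by (simp add: lap_def cl_mult_vec[OF C])
  also have "\<dots> = (\<Sum>i<m. \<Sum>j<m. pd i (pd i (\<lambda>x. x j * gen_mult j (M x) C)) x)"
  proof (intro sum.cong refl)
    fix i
    have "pd i (\<lambda>x. \<Sum>j<m. x j * gen_mult j (M x) C) = (\<lambda>x. \<Sum>j<m. pd i (\<lambda>x. x j * gen_mult j (M x) C) x)"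
      by (rule pd_sum[OF h]) simp
    moreover have "pd i (\<lambda>x. \<Sum>j<m. pd i (\<lambda>x. x j * gen_mult j (M x) C) x) =
      (\<lambda>x. \<Sum>j<m. pd i (pd i (\<lambda>x. x j * gen_mult j (M x) C)) x)"
      by (rule pd_sum[OF hpoly_pd_Suc[OF h]]) simp
    ultimately show "pd i (pd i (\<lambda>x. \<Sum>j<m. x j * gen_mult j (M x) C)) x =
      (\<Sum>j<m. pd i (pd i (\<lambda>x. x j * gen_mult j (M x) C)) x)" by simp
  qed
  also have "\<dots> = (\<Sum>j<m. lap m (\<lambda>x. x j * gen_mult j (M x) C) x)"
    unfolding lap_def by (rule sum.swap)
  also have "\<dots> = 2 * (\<Sum>j<m. gen_mult j (cl_pd j M x) C)"
    by (simp add: lapj sum_distrib_left)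
  finally show ?thesis by (simp add: dirac0[OF C])
qed

text \<open>Paired with \<open>H\<close>, the bivector part of the kernel becomes the angular operator
  \<open>- y \<and> \<partial>\<close> applied to \<open>H\<close>; \<open>l\<close> is the eigenvalue of that operator.\<close>

definition bivector_eigen :: "nat \<Rightarrow> nat \<Rightarrow> real \<Rightarrow> ((nat \<Rightarrow> real) \<Rightarrow> cl) \<Rightarrow> bool" where
  "bivector_eigen m d l H \<longleftrightarrow> cl_hpoly m d H \<and>
     (\<forall>C. harmonic_poly m d (\<lambda>x. H x C)) \<and>
     (\<forall>y C. C \<subseteq> {..<m} \<longrightarrow>
       (\<Sum>(j, k)\<in>{(j, k). j < k \<and> k < m}. y k * gen_mult j (gen_mult k (cl_pd j H y)) C
          - y j * gen_mult j (gen_mult k (cl_pd k H y)) C) = l * H y C)"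

lemma cl_hpoly_harmonicI:
  assumes H: "cl_hpoly m d H" and "\<And>x C. C \<subseteq> {..<m} \<Longrightarrow> lap m (\<lambda>x. H x C) x = 0"
  shows "harmonic_poly m d (\<lambda>x. H x C)"
proof (cases "C \<subseteq> {..<m}")
  case True thus ?thesis using assms by (simp add: harmonic_poly_def cl_hpolyD[OF H])
next
  case False
  hence "(\<lambda>x. H x C) = (\<lambda>_. 0)" using H by (simp add: cl_hpoly_def)
  moreover have "harmonic_poly m d (\<lambda>_. 0)" by (simp add: harmonic_poly_def hpoly.zero lap_def)
  ultimately show ?thesis by simp
qed

lemma monogenic_bivector_eigen:
  assumes "M \<in> spherical_monogenics m k"
  shows "bivector_eigen m k (- real k) M"
proof -
  note M = monogenic_cl_hpoly[OF assms] and D = monogenic_dirac[OF assms]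
  have "(\<Sum>j<m. y j * gen_mult j (\<lambda>C. \<Sum>k<m. gen_mult k (cl_pd k M y) C) C) = 0" if C: "C \<subseteq> {..<m}" for y C
  proof (intro sum.neutral ballI)
    fix j assume "j \<in> {..<m}"
    hence "gen_mult j (\<lambda>C. \<Sum>k<m. gen_mult k (cl_pd k M y) C) C = gen_mult j (\<lambda>_. 0) C"
      by (intro gen_mult_cong[OF D _ C]) auto
    thus "y j * gen_mult j (\<lambda>C. \<Sum>k<m. gen_mult k (cl_pd k M y) C) C = 0" by (simp add: gen_mult_def)
  qed
  hence "(\<Sum>(j, l)\<in>{(j, l). j < l \<and> l < m}. y l * gen_mult j (gen_mult l (cl_pd j M y)) C
          - y j * gen_mult j (gen_mult l (cl_pd l M y)) C) = - real k * M y C"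
    if "C \<subseteq> {..<m}" for y C
    using that unfolding bivector_derivative_sum[OF M that] by simp
  moreover have "harmonic_poly m k (\<lambda>x. M x C)" for C
    by (rule cl_hpoly_harmonicI[OF M monogenic_harmonic[OF M D]])
  ultimately show ?thesis unfolding bivector_eigen_def by (intro conjI allI impI M)
qed

text \<open>The eigenvalue is m + 2 k, from the Dirac operator on x M, minus k + 1, from the degree
  of x M.\<close>

lemma vec_mult_bivector_eigen:
  assumes "M \<in> spherical_monogenics m k"
  shows "bivector_eigen m (Suc k) (real m + real k - 1) (\<lambda>x. cl_mult m (cl_vec m x) (M x))"
proof -
  note M = monogenic_cl_hpoly[OF assms] and D = monogenic_dirac[OF assms]
  let ?H = "\<lambda>x. cl_mult m (cl_vec m x) (M x)"
  note H = cl_hpoly_vec_mult[OF M]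
  have "(\<Sum>j<m. y j * gen_mult j (\<lambda>C. \<Sum>k<m. gen_mult k (cl_pd k ?H y) C) C) = - (real m + 2 * real k) * ?H y C"
    if C: "C \<subseteq> {..<m}" for y C
  proof -
    have "(\<Sum>j<m. y j * gen_mult j (\<lambda>C. \<Sum>k<m. gen_mult k (cl_pd k ?H y) C) C) =
      (\<Sum>j<m. y j * gen_mult j (\<lambda>C. - (real m + 2 * real k) * M y C) C)"
      by (intro sum.cong arg_cong2[of _ _ _ _ "(*)"] refl gen_mult_cong[OF dirac_vec_mult[OF M _ D] _ C]) auto
    also have "\<dots> = - (real m + 2 * real k) * (\<Sum>j<m. y j * gen_mult j (M y) C)"
      unfolding gen_mult_scale sum_distrib_left by (intro sum.cong) auto
    finally show ?thesis by (simp only: cl_mult_vec[OF C])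
  qed
  hence "(\<Sum>(j, k)\<in>{(j, k). j < k \<and> k < m}. y k * gen_mult j (gen_mult k (cl_pd j ?H y)) C
          - y j * gen_mult j (gen_mult k (cl_pd k ?H y)) C) = (real m + real k - 1) * ?H y C"
    if "C \<subseteq> {..<m}" for y C
    using that unfolding bivector_derivative_sum[OF H that] by (simp add: algebra_simps)
  moreover have "harmonic_poly m (Suc k) (\<lambda>x. ?H x C)" for C
    by (rule cl_hpoly_harmonicI[OF H vec_mult_harmonic[OF M _ D]])
  ultimately show ?thesis unfolding bivector_eigen_def by (intro conjI allI impI H)
qed

section \<open>The transform of an eigenfunction of the angular operator\<close>

text \<open>Kernels are not polynomials, so linearity of the expectation now has integrability as a
  separate condition.\<close>

definition gauss_integrable :: "nat \<Rightarrow> ((nat \<Rightarrow> real) \<Rightarrow> real) \<Rightarrow> bool" where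
  "gauss_integrable m f \<longleftrightarrow> integrable (lebesgue_m m) (\<lambda>x. f x * exp (- normsq_m m x / 2))"

lemma gauss_integrable_scale: "gauss_integrable m f \<Longrightarrow> gauss_integrable m (\<lambda>x. c * f x)"
  unfolding gauss_integrable_def by (simp add: mult.assoc)

lemma gauss_integrable_sum:
  "(\<And>i. i \<in> I \<Longrightarrow> gauss_integrable m (f i)) \<Longrightarrow> gauss_integrable m (\<lambda>x. \<Sum>i\<in>I. f i x)"
  unfolding gauss_integrable_def sum_distrib_right by (rule Bochner_Integration.integrable_sum)

lemma gauss_exp_add_integrable:
  assumes "gauss_integrable m f" "gauss_integrable m g"
  shows "gauss_exp m (\<lambda>x. f x + g x) = gauss_exp m f + gauss_exp m g"
  unfolding gauss_exp_def distrib_right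
  by (subst Bochner_Integration.integral_add)
     (use assms in \<open>simp_all only: gauss_integrable_def distrib_left\<close>)

lemma gauss_exp_sum_integrable:
  assumes "\<And>i. i \<in> I \<Longrightarrow> gauss_integrable m (f i)"
  shows "gauss_exp m (\<lambda>x. \<Sum>i\<in>I. f i x) = (\<Sum>i\<in>I. gauss_exp m (f i))"
  unfolding gauss_exp_def sum_distrib_right
  by (subst Bochner_Integration.integral_sum)
     (use assms in \<open>simp_all only: gauss_integrable_def sum_distrib_left\<close>)

lemma kern_integrable:
  assumes "hpoly m e B" "even m'" "i + 2 \<le> m'"
  shows "gauss_integrable m (\<lambda>x. kern m' i (inner_m m x y) (wedge_abs m x y) * (laguerre p a (normsq_m m x) * B x))"
proof -
  have i: "2 * (i div 2) + i mod 2 = i" by simp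
  have le: "2 * (i div 2) + i mod 2 + 2 \<le> m'" "i mod 2 \<le> 1" using assms(3) by auto
  show ?thesis
    using kernel_transform(1)[where h = "i div 2" and \<epsilon> = "i mod 2" and y = y and p = p and a = a,
      OF assms(1,2) le, unfolded i]
    by (simp only: gauss_integrable_def)
qed

text \<open>Treats \<open>psi_even\<close> and \<open>psi_odd\<close> together: they differ only in
  the degree and the angular eigenvalue of H.\<close>

lemma F_plus_eigen:
  fixes l :: real and p :: nat
  assumes H: "bivector_eigen m d l H" and m: "even m" "i + 2 \<le> m"
  defines "a \<equiv> real m / 2 + real d - 1"
  defines "\<psi> \<equiv> \<lambda>x. cl_scale (laguerre p a (normsq_m m x) * exp (- normsq_m m x / 2)) (H x)"
  defines "c \<equiv> if even (i + d)
    then (-1) ^ (m div 2 + i) * (dfact (int d + int i - 1) / dfact (int d + int m - int i - 3))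
    else (l - real i) * (dfact (int d + int i - 2) / dfact (int d + int m - int i - 2))"
  shows "F_plus m i \<psi> = (\<lambda>y. cl_scale (c * (-1) ^ p) (\<psi> y))"
proof (intro ext)
  fix y C
  show "F_plus m i \<psi> y C = cl_scale (c * (-1) ^ p) (\<psi> y) C"
  proof (cases "C \<subseteq> {..<m}")
    case False
    hence "H y C = 0" using H by (simp add: bivector_eigen_def cl_hpoly_def)
    thus ?thesis using False by (simp add: F_plus_def cl_scale_def cl_integral_def cl_mult_left \<psi>_def)
  next
    case C: True
    let ?s = "\<lambda>x. inner_m m x y" and ?t = "\<lambda>x. wedge_abs m x y" and ?L = "\<lambda>x. laguerre p a (normsq_m m x)"
    let ?w = "\<lambda>x. exp (- normsq_m m x / 2)" and ?J = "{(j, k). j < k \<and> k < m}"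
    \<comment> \<open>Multiplying by e_j e_k selects a single coordinate, \<open>D j k\<close>, with
      the sign \<open>\<sigma> j k\<close>; the bivector part thus becomes a finite sum of scalar
      expectations.\<close>
    define \<sigma> where "\<sigma> = (\<lambda>j k. gen_sign j (toggle j C) * gen_sign k (toggle k (toggle j C)))"
    define D where "D = (\<lambda>j k. toggle k (toggle j C))"
    have gm: "gen_mult j (gen_mult k v) C = \<sigma> j k * v (D j k)" for j k v
      by (simp add: gen_mult_def \<sigma>_def D_def)
    have harm: "harmonic_poly m d (\<lambda>x. H x A)" for A using H by (simp add: bivector_eigen_def)
    have m2: "even (m + 2)" "i + 2 \<le> m + 2" "i - 1 + 2 \<le> m" "i \<le> m" using m by auto
    define A where "A = (\<lambda>x. kern m (i - 1) (?s x) (?t x) * (?L x * H x C))"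
    define B where "B = (\<lambda>x. kern m i (?s x) (?t x) * (?L x * H x C))"
    define G where "G = (\<lambda>j k x. kern (m + 2) i (?s x) (?t x) * (?L x * ((x j * y k - x k * y j) * H x (D j k))))"
    have iA: "gauss_integrable m A" and iB: "gauss_integrable m B"
      unfolding A_def B_def using m m2 by (auto intro!: kern_integrable[OF harmonic_hpoly[OF harm]])
    have iG: "gauss_integrable m (G j k)" if "j < k" "k < m" for j k
      unfolding G_def using that m2
      by (intro kern_integrable[OF hpoly_mult[OF hpoly_bivector harmonic_hpoly[OF harm]]]) auto
    have fin: "finite ?J" by (rule finite_subset[of _ "{..<m} \<times> {..<m}"]) auto
    define R where "R = (-1) ^ p * laguerre p a (normsq_m m y) * exp (- normsq_m m y / 2)"
    have "cl_mult m (K_plus m i x y) (\<psi> x) C =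
      ((- real i * A x + (-1) ^ (m div 2 + i) * B x) + (\<Sum>(j, k)\<in>?J. \<sigma> j k * G j k x)) * ?w x" for x
    proof -
      have "cl_mult m (K_plus m i x y) (\<psi> x) C =
        (f_tilde m i (?s x) (?t x) + f_hat m i (?s x) (?t x)) * \<psi> x C + g_fun m i (?s x) (?t x) *
          (\<Sum>(j, k)\<in>?J. (x j * y k - x k * y j) * (\<sigma> j k * \<psi> x (D j k)))"
        by (simp add: K_plus_def Let_def cl_mult_add_left cl_mult_scale_left cl_mult_scalar[OF C] cl_mult_wedge[OF C] gm)
      also have "g_fun m i (?s x) (?t x) * (\<Sum>(j, k)\<in>?J. (x j * y k - x k * y j) * (\<sigma> j k * \<psi> x (D j k))) =
        (\<Sum>(j, k)\<in>?J. \<sigma> j k * G j k x) * ?w x"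
        unfolding sum_distrib_left sum_distrib_right
        by (intro sum.cong refl) (auto simp: g_fun_kern G_def \<psi>_def cl_scale_def)
      also have "(f_tilde m i (?s x) (?t x) + f_hat m i (?s x) (?t x)) * \<psi> x C =
        (- real i * A x + (-1) ^ (m div 2 + i) * B x) * ?w x"
        by (simp add: f_tilde_kern f_hat_kern A_def B_def \<psi>_def cl_scale_def algebra_simps)
      finally show ?thesis by (simp only: distrib_right)
    qed
    hence "F_plus m i \<psi> y C = gauss_exp m (\<lambda>x. (- real i * A x + (-1) ^ (m div 2 + i) * B x) + (\<Sum>(j, k)\<in>?J. \<sigma> j k * G j k x))"
      by (simp add: F_plus_def cl_scale_def cl_integral_def gauss_exp_def)
    also have "\<dots> = (- real i * gauss_exp m A + (-1) ^ (m div 2 + i) * gauss_exp m B) + (\<Sum>(j, k)\<in>?J. \<sigma> j k * gauss_exp m (G j k))"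
    proof -
      have 1: "gauss_exp m (\<lambda>x. - real i * A x + (-1) ^ (m div 2 + i) * B x) = - real i * gauss_exp m A + (-1) ^ (m div 2 + i) * gauss_exp m B"
        unfolding gauss_exp_scale[symmetric]
        by (rule gauss_exp_add_integrable[OF gauss_integrable_scale[OF iA] gauss_integrable_scale[OF iB]])
      have i1: "gauss_integrable m (\<lambda>x. - real i * A x + (-1) ^ (m div 2 + i) * B x)"
        using gauss_integrable_scale[OF iA, of "- real i"] gauss_integrable_scale[OF iB, of "(-1) ^ (m div 2 + i)"]
        unfolding gauss_integrable_def distrib_right by (rule Bochner_Integration.integrable_add)
      have i2: "gauss_integrable m (\<lambda>x. case jk of (j, k) \<Rightarrow> \<sigma> j k * G j k x)" if "jk \<in> ?J" for jk
        using that by (auto intro!: gauss_integrable_scale iG)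
      have 2: "gauss_exp m (\<lambda>x. \<Sum>(j, k)\<in>?J. \<sigma> j k * G j k x) = (\<Sum>(j, k)\<in>?J. \<sigma> j k * gauss_exp m (G j k))"
        by (subst gauss_exp_sum_integrable[OF i2]) (auto intro!: sum.cong simp: gauss_exp_scale)
      have i3: "gauss_integrable m (\<lambda>x. \<Sum>(j, k)\<in>?J. \<sigma> j k * G j k x)"
        by (rule gauss_integrable_sum) (rule i2)
      show ?thesis
        unfolding gauss_exp_add_integrable[OF i1 i3] 1 2 ..
    qed
    also have "\<dots> = c * (R * H y C)"
    proof (cases "even (i + d)")
      case True
      have "gauss_exp m (G j k) = 0" if "j < k" "k < m" for j k
        using bivector_kernel_transform[where y = y and p = p and j = j and k = k, OF harm[of "D j k"] m(1) m2(4)] that True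
        unfolding G_def a_def by simp
      hence "(\<Sum>(j, k)\<in>?J. \<sigma> j k * gauss_exp m (G j k)) = 0" by (intro sum.neutral) auto
      moreover have "real i * gauss_exp m A = 0"
      proof (cases i)
        case (Suc n)
        hence "odd (i - 1 + d)" using True by simp
        thus ?thesis using scalar_kernel_transform[where y = y and p = p, OF harm[of C] m(1) m2(3)]
          unfolding A_def a_def by simp
      qed simp
      moreover have "gauss_exp m B = dfact (int d + int i - 1) / dfact (int d + int m - int i - 3) * H y C * R"
        using scalar_kernel_transform[where y = y and p = p, OF harm[of C] m] True unfolding B_def a_def R_def by simp
      ultimately show ?thesis using True by (auto simp: c_def mult_ac)
    next
      case False
      define \<kappa> where "\<kappa> = dfact (int d + int i - 2) / dfact (int d + int m - int i - 2)"
      have E: "gauss_exp m (G j k) = \<kappa> * (y k * cl_pd j H y (D j k) - y j * cl_pd k H y (D j k)) * R" if "j < k" "k < m" for j k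
        using bivector_kernel_transform[where y = y and p = p and j = j and k = k, OF harm[of "D j k"] m(1) m2(4)] that False
        unfolding G_def a_def R_def \<kappa>_def cl_pd_def by simp
      have "(\<Sum>(j, k)\<in>?J. \<sigma> j k * gauss_exp m (G j k)) =
        (\<Sum>(j, k)\<in>?J. \<kappa> * R * (y k * (\<sigma> j k * cl_pd j H y (D j k)) - y j * (\<sigma> j k * cl_pd k H y (D j k))))"
      proof (intro sum.cong refl, clarify)
        fix j k assume jk: "j < k" "k < m"
        show "\<sigma> j k * gauss_exp m (G j k) =
          \<kappa> * R * (y k * (\<sigma> j k * cl_pd j H y (D j k)) - y j * (\<sigma> j k * cl_pd k H y (D j k)))"
          unfolding E[OF jk] by (simp add: algebra_simps)
      qed
      also have "\<dots> = \<kappa> * R * (\<Sum>(j, k)\<in>?J. y k * gen_mult j (gen_mult k (cl_pd j H y)) C - y j * gen_mult j (gen_mult k (cl_pd k H y)) C)"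
        unfolding gm sum_distrib_left by (intro sum.cong refl) auto
      also have "\<dots> = \<kappa> * R * (l * H y C)" using H C by (simp add: bivector_eigen_def)
      finally have 1: "(\<Sum>(j, k)\<in>?J. \<sigma> j k * gauss_exp m (G j k)) = \<kappa> * R * (l * H y C)" .
      have 2: "real i * gauss_exp m A = real i * (\<kappa> * H y C * R)"
      proof (cases i)
        case (Suc n)
        \<comment> \<open>With index i - 1 the scalar quotient of double factorials becomes exactly
          the bivector quotient, so the two contributions can be added.\<close>
        hence e: "even (i - 1 + d)" "int d + int (i - 1) - 1 = int d + int i - 2"
          "int d + int m - int (i - 1) - 3 = int d + int m - int i - 2" using False by auto
        show ?thesis
          unfolding A_def a_def R_def \<kappa>_def e(2,3) if_P[OF e(1)]
            scalar_kernel_transform[where y = y and p = p, OF harm[of C] m(1) m2(3)] ..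
      qed simp
      have 3: "gauss_exp m B = 0"
        using scalar_kernel_transform[where y = y and p = p, OF harm[of C] m] False unfolding B_def a_def by simp
      show ?thesis using 2 False unfolding 1 3 c_def \<kappa>_def[symmetric]
        by (auto simp: algebra_simps)
    qed
    also have "\<dots> = cl_scale (c * (-1) ^ p) (\<psi> y) C"
      by (simp add: R_def \<psi>_def cl_scale_def mult_ac)
    finally show ?thesis .
  qed
qed

section \<open>From the common constant to the stated eigenvalues\<close>

lemma dfact_step: "z \<ge> 1 \<Longrightarrow> dfact z = of_int z * dfact (z - 2)"
proof -
  assume z: "z \<ge> 1"
  show ?thesis
  \<comment> \<open>The case z = 1 rests on the convention that \<open>dfact (-1)\<close> is
    1.\<close>
  proof (cases "z = 1")
    case False
    with z have "0 \<le> z - 2" by simp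
    then obtain n where n: "z - 2 = int n" by (rule nonneg_int_cases)
    hence z': "z = int (Suc (Suc n))" by simp
    have "nat z = Suc (Suc n)" "nat (z - 2) = n" using n z' by auto
    thus ?thesis using z' by (simp add: dfact_def distrib_right)
  qed (simp add: dfact_def)
qed

theorem theorem4p3:
  fixes m i p k :: nat and M :: "(nat \<Rightarrow> real) \<Rightarrow> cl"
  assumes "even m" and "m \<ge> 2" and "i \<le> m - 2"
    and "M \<in> spherical_monogenics m k"
  shows
   "(even i \<and> even k \<longrightarrow>
      F_plus m i (psi_even m p k M) = (\<lambda>y. cl_scale ((-1) ^ (m div 2)
         * dfact (int k + int i - 1) / dfact (int k - int i + int m - 3) * (-1) ^ p)
         (psi_even m p k M y)) \<and>
      F_plus m i (psi_odd m p k M) = (\<lambda>y. cl_scale (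
         dfact (int k + int i - 1) / dfact (int k + int m - int i - 3) * (-1) ^ p)
         (psi_odd m p k M y))) \<and>
    (even i \<and> odd k \<longrightarrow>
      F_plus m i (psi_even m p k M) = (\<lambda>y. cl_scale (
         dfact (int k + int i) / dfact (int k + int m - int i - 2) * (-1) ^ (p + 1))
         (psi_even m p k M y)) \<and>
      F_plus m i (psi_odd m p k M) = (\<lambda>y. cl_scale ((-1) ^ (m div 2)
         * dfact (int k + int i) / dfact (int k - int i + int m - 2) * (-1) ^ p)
         (psi_odd m p k M y))) \<and>
    (odd i \<and> even k \<longrightarrow>
      F_plus m i (psi_even m p k M) = (\<lambda>y. cl_scale (
         dfact (int k + int i) / dfact (int k + int m - int i - 2) * (-1) ^ (p + 1))
         (psi_even m p k M y)) \<and>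
      F_plus m i (psi_odd m p k M) = (\<lambda>y. cl_scale ((-1) ^ (m div 2)
         * dfact (int k + int i) / dfact (int k + int m - int i - 2) * (-1) ^ (p + 1))
         (psi_odd m p k M y))) \<and>
    (odd i \<and> odd k \<longrightarrow>
      F_plus m i (psi_even m p k M) = (\<lambda>y. cl_scale ((-1) ^ (m div 2)
         * dfact (int k + int i - 1) / dfact (int k + int m - int i - 3) * (-1) ^ (p + 1))
         (psi_even m p k M y)) \<and>
      F_plus m i (psi_odd m p k M) = (\<lambda>y. cl_scale (
         dfact (int k + int i - 1) / dfact (int k + int m - int i - 3) * (-1) ^ p)
         (psi_odd m p k M y)))"
proof -
  have im: "i + 2 \<le> m" using assms by simp
  have e1: "int k - int i + int m - z = int k + int m - int i - z" for z by simp
  have even: "F_plus m i (psi_even m p k M) = (\<lambda>y. cl_scale ((if even (i + k)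
      then (-1) ^ (m div 2 + i) * (dfact (int k + int i - 1) / dfact (int k + int m - int i - 3))
      else - (dfact (int k + int i) / dfact (int k + int m - int i - 2))) * (-1) ^ p) (psi_even m p k M y))"
  proof -
    \<comment> \<open>The eigenvalue -k makes the coefficient -(k + i), which completes the
      numerator to \<open>dfact (k + i)\<close>. Oddness of i + k excludes zero.\<close>
    have "(- real k - real i) * (dfact (int k + int i - 2) / dfact (int k + int m - int i - 2)) =
      - (dfact (int k + int i) / dfact (int k + int m - int i - 2))" if "odd (i + k)"
    proof -
      have "int k + int i \<ge> 1" using that by (cases "i + k") auto
      hence "dfact (int k + int i) = (real k + real i) * dfact (int k + int i - 2)"
        using dfact_step[of "int k + int i"] by simp
      moreover have "- real k - real i = - (real k + real i)" by simp
      ultimately show ?thesis by (simp only: minus_mult_left[symmetric] times_divide_eq_right)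
    qed
    thus ?thesis
      using F_plus_eigen[OF monogenic_bivector_eigen[OF assms(4)] assms(1) im, of p]
      unfolding psi_even_def[abs_def] by simp
  qed
  have odd: "F_plus m i (psi_odd m p k M) = (\<lambda>y. cl_scale ((if even (i + k)
      then dfact (int k + int i - 1) / dfact (int k + int m - int i - 3)
      else (-1) ^ (m div 2 + i) * (dfact (int k + int i) / dfact (int k + int m - int i - 2))) * (-1) ^ p) (psi_odd m p k M y))"
  proof -
    have a: "real m / 2 + real (Suc k) - 1 = real m / 2 + real k" by simp
    \<comment> \<open>Degree k + 1 and eigenvalue m + k - 1: the coefficient m + k - 1 - i is the
      leading factor of the denominator and cancels. It is positive since i <= m - 2.\<close>
    have "of_int (int k + int m - int i - 1) = real m + real k - 1 - real i"
      "int k + int m - int i - 1 - 2 = int k + int m - int i - 3" by simp_all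
    moreover have "int k + int m - int i - 1 \<ge> 1" using im by simp
    note dfact_step[OF this]
    ultimately have "dfact (int k + int m - int i - 1) = (real m + real k - 1 - real i) * dfact (int k + int m - int i - 3)"
      by (simp only:)
    moreover have "real m + real k - 1 - real i \<noteq> 0" using im by linarith
    moreover have "int (Suc k) + int i - 2 = int k + int i - 1"
      "int (Suc k) + int m - int i - 2 = int k + int m - int i - 1" by simp_all
    ultimately have c: "(real m + real k - 1 - real i) * (dfact (int (Suc k) + int i - 2) / dfact (int (Suc k) + int m - int i - 2)) =
      dfact (int k + int i - 1) / dfact (int k + int m - int i - 3)"
      by (simp only: times_divide_eq_right mult_divide_mult_cancel_left simp_thms)
    have d: "dfact (int (Suc k) + int i - 1) / dfact (int (Suc k) + int m - int i - 3) =
      dfact (int k + int i) / dfact (int k + int m - int i - 2)"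
      by (simp add: algebra_simps)
    show ?thesis
      using F_plus_eigen[OF vec_mult_bivector_eigen[OF assms(4)] assms(1) im, of p]
      unfolding psi_odd_def[abs_def] a c d by simp
  qed
  \<comment> \<open>Splitting (-1)^(m div 2 + i) by the parity of i accounts for the exponents p and
    p + 1 in the \<open>f_hat\<close> cases.\<close>
  show ?thesis unfolding even odd e1 by (auto simp: power_add)
qed

end
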